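(* Consider the decentralized minimax problem $\min_{x\in\mathbb{R}^{M_1}}\max_{y\in\mathbb{R}^{M_2}} J(x,y)=\frac1K\sum_{k=1}^K J_k(x,y)$, $J_k(x,y)=\mathbb{E}_{\xi_k\sim\mathcal{D}_k}[Q_k(x,y;\xi_k)]$, and suppose that: each $J_k$ is $L_f$-smooth and $L_h$-second-order Lipschitz in $z=[x;y]$; the local stochastic gradients and Hessians are unbiased with variances bounded by $\sigma^2$ and $\sigma_h^2$; $J$ is (possibly) nonconvex in $x$, $-J$ is $\nu$-PL in $y$, and $\inf_x P(x)>-\infty$ with $P(x)=\max_y J(x,y)$; the mixing matrix $A$ is primitive and doubly stochastic with mixing rate $\lambda<1$ (precise forms in the context). Run the algorithm DiMA described in the context for $T$ communication rounds with $N$ local steps per round, with $\gamma=1$ and hyperparameters $$\beta=\mathcal{O}\Big(\frac{(NK)^{1/3}}{T^{2/3}}\Big),\quad \eta_y=\mathcal{O}\Big(\frac{(1-\lambda)^{1/2}(NK)^{1/3}}{T^{2/3}}\Big),\quad \eta_x=\mathcal{O}\Big(\frac{(1-\lambda)^{1/2}(NK)^{1/3}}{\kappa T^{2/3}}\Big),\quad \bar\eta_x=\frac{\eta_x}{NL_f},\quad \bar\eta_y=\frac{\eta_y}{NL_f},$$ for sufficiently large $T$, such that the conditions $\eta_x\le\frac{\eta_y}{2\kappa}$, $\bar\eta_x\le\bar\eta_y$ and $\beta<1$ hold. Then $$\frac1T\sum_{i=0}^{T-1}\mathbb{E}\big[\|\nabla P(\boldsymbol{x}_{c,i})\|+2L_f\|\boldsymbol{y}_{c,i}-\boldsymbol{y}^o(\boldsymbol{x}_{c,i})\|\big]\le\mathcal{O}\Bigg(\frac{\kappa}{(1-\lambda)^{1/2}(NKT)^{1/3}}+\frac{\kappa(NK)^{1/3}}{(1-\lambda)^{3/2}T^{2/3}}\Bigg),$$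 where $\boldsymbol{x}_{c,i}=\frac1K\sum_{k=1}^K\boldsymbol{x}_{k,i}$, $\boldsymbol{y}_{c,i}=\frac1K\sum_{k=1}^K\boldsymbol{y}_{k,i}$.
   Context: Problem and assumptions. There are $K$ agents; agent $k$ has loss $Q_k(x,y;\xi_k)$ with samples $\xi_k\sim\mathcal{D}_k$, $x\in\mathbb{R}^{M_1}$, $y\in\mathbb{R}^{M_2}$, $z=[x;y]$ (stacked column). $\|\cdot\|$ is the Euclidean norm (spectral norm for matrices). (A1) For each $k$ and all $z_1,z_2$: $\|\nabla J_k(z_1)-\nabla J_k(z_2)\|\le L_f\|z_1-z_2\|$ and $\|\nabla^2J_k(z_1)-\nabla^2J_k(z_2)\|\le L_h\|z_1-z_2\|$. (A2) $\mathbb{E}_{\xi_k}[\nabla_zQ_k(x,y;\xi_k)]=\nabla_zJ_k(x,y)$, $\mathbb{E}_{\xi_k}[\nabla_z^2Q_k(x,y;\xi_k)]=\nabla_z^2J_k(x,y)$, $\mathbb{E}\|\nabla_zQ_k(x,y;\xi_k)-\nabla_zJ_k(x,y)\|^2\le\sigma^2$, $\mathbb{E}\|\nabla_z^2Q_k(x,y;\xi_k)-\nabla_z^2J_k(x,y)\|^2\le\sigma_h^2$; all samples drawn (over agents, rounds and local steps) are independent of each other and of the point at which they are evaluated, agent $k$'s samples having law $\mathcal{D}_k$. (A3) $P(x)=\max_yJ(x,y)$ is well defined (the max is attained), $\inf_xP(x)>-\infty$, and $\|\nabla_yJ(x,y)\|^2\ge2\nu[\max_{y'}J(x,y')-J(x,y)]$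 for all $x,y$, with $\nu>0$. $\boldsymbol{y}^o(x)=\operatorname{argmax}_yJ(x,y)$; when the maximizer is not unique, $\|y-\boldsymbol{y}^o(x)\|$ is read as the distance from $y$ to the set of maximizers. $\kappa=L_f/\nu>1$. (A4) $A=[a_{k\ell}]\in\mathbb{R}^{K\times K}$ has nonnegative entries, $a_{k\ell}=0$ unless $\ell\in\mathcal{N}_k$ (neighbors of $k$), is primitive, $\mathbb{1}_K^\top A=\mathbb{1}_K^\top$, $A\mathbb{1}_K=\mathbb{1}_K$; $\lambda=\|A-\mathbb{1}_K\mathbb{1}_K^\top/K\|<1$. Algorithm DiMA (parameters $\eta_x,\eta_y,\bar\eta_x,\bar\eta_y>0$, $\beta>0$, $\gamma\in\{0,1\}$, $N\ge1$). Bold symbols are random. Stochastic Hessian-vector product: $\mathbf{hvp}_k(z_1,z_2;\xi)=\nabla_z^2Q_k(z_1;\xi)(z_1-z_2)$. Initialization: for all $k\in\{1,\dots,K\}$ and $n\in\{0,\dots,N-1\}$, $\boldsymbol{z}_{k,0}=\boldsymbol{z}_{k,-1}=\boldsymbol{z}_{k,-1,n}$, this common value being the same for all agents; $\boldsymbol{u}^x_{k,-1}=\boldsymbol{m}^x_{k,-1}=\nabla_xQ_k(\boldsymbol{z}_{k,-1};\boldsymbol{\xi}_{k,-1})$, $\boldsymbol{u}^y_{k,-1}=\boldsymbol{m}^y_{k,-1}=\nabla_yQ_k(\boldsymbol{z}_{k,-1};\boldsymbol{\xi}_{k,-1})$. For rounds $i=0,\dots,T-1$, each agent $k$: (1) sets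 $\boldsymbol{x}_{k,i,0}=\boldsymbol{x}_{k,i}$, $\boldsymbol{y}_{k,i,0}=\boldsymbol{y}_{k,i}$; for $n=0,\dots,N-1$, with a fresh sample $\boldsymbol{\xi}_{k,i,n}$ and $\boldsymbol{z}_{k,i,n}=[\boldsymbol{x}_{k,i,n};\boldsymbol{y}_{k,i,n}]$, computes $\boldsymbol{g}^x_{k,i,n}=\nabla_xQ_k(\boldsymbol{z}_{k,i,n};\boldsymbol{\xi}_{k,i,n})$, $\boldsymbol{g}^y_{k,i,n}=\nabla_yQ_k(\boldsymbol{z}_{k,i,n};\boldsymbol{\xi}_{k,i,n})$, $[\boldsymbol{h}^x_{k,i,n};\boldsymbol{h}^y_{k,i,n}]=\mathbf{hvp}_k(\boldsymbol{z}_{k,i,n},\boldsymbol{z}_{k,i-1,n};\boldsymbol{\xi}_{k,i,n})$, $\boldsymbol{x}_{k,i,n+1}=\boldsymbol{x}_{k,i,n}-\bar\eta_x\boldsymbol{g}^x_{k,i,n}/\|\boldsymbol{g}^x_{k,i,n}\|$, $\boldsymbol{y}_{k,i,n+1}=\boldsymbol{y}_{k,i,n}+\bar\eta_y\boldsymbol{g}^y_{k,i,n}/\|\boldsymbol{g}^y_{k,i,n}\|$; (2) forms $\boldsymbol{g}^x_{k,i}=\frac1N\sum_n\boldsymbol{g}^x_{k,i,n}$, $\boldsymbol{h}^x_{k,i}=\frac1N\sum_n\boldsymbol{h}^x_{k,i,n}$ (same for $y$); (3) $\boldsymbol{m}^x_{k,i}=(1-\beta)(\boldsymbol{m}^x_{k,i-1}+\gamma\boldsymbol{h}^x_{k,i})+\beta\boldsymbol{g}^x_{k,i}$,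 $\boldsymbol{u}^x_{k,i}=\sum_{\ell\in\mathcal{N}_k}a_{k\ell}(\boldsymbol{u}^x_{\ell,i-1}+\boldsymbol{m}^x_{\ell,i}-\boldsymbol{m}^x_{\ell,i-1})$ (same for $y$); (4) $\boldsymbol{x}_{k,i+1}=\sum_{\ell\in\mathcal{N}_k}a_{k\ell}\big(\boldsymbol{x}_{\ell,i}-\eta_x\boldsymbol{u}^x_{\ell,i}/\|\boldsymbol{u}^x_{\ell,i}\|\big)$, $\boldsymbol{y}_{k,i+1}=\sum_{\ell\in\mathcal{N}_k}a_{k\ell}\big(\boldsymbol{y}_{\ell,i}+\eta_y\boldsymbol{u}^y_{\ell,i}/\|\boldsymbol{u}^y_{\ell,i}\|\big)$. All vectors being normalized are assumed nonzero, so that the recursion is well defined. Order notation. $\mathcal{O}(\cdot)$ is standard complexity notation: hidden constants do not depend on $\kappa,\lambda,N,K,T$ (they may depend on $L_f,L_h,\sigma,\sigma_h$ and the initialization). In a hyperparameter choice, "$=\mathcal{O}(\cdot)$" means equal to a positive constant multiple of the displayed quantity. "Sufficiently large $T$" may depend on all the other problem parameters. *)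

theory Defs
  imports "HOL-Probability.Probability"
begin

text \<open>
  The stacked variable \<open>z = [x; y]\<close> is a pair in \<open>(real^'m) \<times> (real^'n)\<close>; the norm of a pair is
  the Euclidean norm of the stacked column, and \<open>fst\<close>/\<open>snd\<close> of a gradient are the partial gradients
  in \<open>x\<close> and \<open>y\<close>.  The Hessian is the derivative of the gradient as a bounded linear operator, whose
  norm is the operator (spectral) norm.
\<close>

definition grad :: "('a::euclidean_space \<Rightarrow> real) \<Rightarrow> 'a \<Rightarrow> 'a" where
  "grad f z = (THE g. GDERIV f z :> g)"

definition hess :: "('a::euclidean_space \<Rightarrow> real) \<Rightarrow> 'a \<Rightarrow> 'a \<Rightarrow>\<^sub>L 'a" where
  "hess f z = Blinfun (frechet_derivative (grad f) (at z))"

definition twice_differentiable :: "('a::euclidean_space \<Rightarrow> real) \<Rightarrow> bool" where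
  "twice_differentiable f \<longleftrightarrow> (\<forall>z. f differentiable (at z) \<and> grad f differentiable (at z))"

text \<open>The Bochner integral of an operator-valued function needs a second countable codomain.\<close>

instance blinfun :: (euclidean_space, euclidean_space) second_countable_topology
proof
  have "\<exists>k::('a \<Rightarrow>\<^sub>L 'b) set. finite k \<and> cball 0 (real n) \<subseteq> (\<Union>x\<in>k. ball x (inverse (real (Suc m))))"
    for n m :: nat
    using compact_cball[of "0::'a \<Rightarrow>\<^sub>L 'b" "real n"]
    unfolding compact_eq_totally_bounded by simp
  then obtain k :: "nat \<Rightarrow> nat \<Rightarrow> ('a \<Rightarrow>\<^sub>L 'b) set" where k: "\<And>n m. finite (k n m)"
    "\<And>n m. cball 0 (real n) \<subseteq> (\<Union>x\<in>k n m. ball x (inverse (real (Suc m))))"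
    by metis
  define B where "B = (\<Union>n m. (\<lambda>x. ball x (inverse (real (Suc m)))) ` k n m)"
  have cB: "countable B"
    unfolding B_def
    by (intro countable_UN countable_image countable_finite[OF k(1)] countableI_type)
  have "topological_basis B"
  proof (rule topological_basisI)
    show "open b" if "b \<in> B" for b
      using that by (auto simp: B_def)
    fix U :: "('a \<Rightarrow>\<^sub>L 'b) set" and f assume U: "open U" "f \<in> U"
    then obtain e where e: "e > 0" "ball f e \<subseteq> U"
      by (auto simp: open_contains_ball)
    obtain m where m: "inverse (real (Suc m)) < e / 2"
      using reals_Archimedean[of "e / 2"] e by auto
    obtain n where "norm f \<le> real n"
      using real_arch_simple by blast
    then obtain x where x: "x \<in> k n m" "f \<in> ball x (inverse (real (Suc m)))"
      using k(2)[of n m] by (auto simp: subset_iff)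
    have "ball x (inverse (real (Suc m))) \<subseteq> ball f e"
    proof
      fix g assume "g \<in> ball x (inverse (real (Suc m)))"
      then have "dist f g < e"
        using x m dist_triangle[of f g x] by (simp add: dist_commute)
      then show "g \<in> ball f e" by simp
    qed
    then show "\<exists>b\<in>B. f \<in> b \<and> b \<subseteq> U"
      using x e unfolding B_def by blast
  qed
  with cB show "\<exists>B::('a \<Rightarrow>\<^sub>L 'b) set set. countable B \<and> open = generate_topology B"
    using topological_basis_imp_subbasis by blast
qed

text \<open>
  Agents are \<open>{..<K}\<close>; \<open>Q k z s\<close> is the loss of agent \<open>k\<close> at the point \<open>z\<close> and the sample \<open>s\<close>,
  and \<open>D k\<close> is the law of its samples.
\<close>

definition local_obj ::
    "(nat \<Rightarrow> 's measure) \<Rightarrow> (nat \<Rightarrow> 'z \<Rightarrow> 's \<Rightarrow> real) \<Rightarrow> nat \<Rightarrow> 'z \<Rightarrow> real" where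
  "local_obj D Q k z = (\<integral>s. Q k z s \<partial>D k)"

definition global_obj ::
    "nat \<Rightarrow> (nat \<Rightarrow> 's measure) \<Rightarrow> (nat \<Rightarrow> 'z \<Rightarrow> 's \<Rightarrow> real) \<Rightarrow> 'z \<Rightarrow> real" where
  "global_obj K D Q z = (1 / real K) * (\<Sum>k<K. local_obj D Q k z)"

definition maximizers :: "('x \<times> 'y \<Rightarrow> real) \<Rightarrow> 'x \<Rightarrow> 'y set" where
  "maximizers J x = {y. \<forall>y'. J (x, y') \<le> J (x, y)}"

text \<open>A maximum whenever \<open>maximizers J x\<close> is nonempty, which \<open>pl_condition\<close> below demands.\<close>

definition primal :: "('x \<times> 'y \<Rightarrow> real) \<Rightarrow> 'x \<Rightarrow> real" where
  "primal J x = (SUP y. J (x, y))"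

definition smooth_objectives ::
    "nat \<Rightarrow> (nat \<Rightarrow> 's measure) \<Rightarrow> (nat \<Rightarrow> 'z::euclidean_space \<Rightarrow> 's \<Rightarrow> real) \<Rightarrow> real \<Rightarrow> real \<Rightarrow> bool"
  where
  "smooth_objectives K D Q Lf Lh \<longleftrightarrow>
    (\<forall>k<K. twice_differentiable (local_obj D Q k) \<and>
      (\<forall>z1 z2. norm (grad (local_obj D Q k) z1 - grad (local_obj D Q k) z2) \<le> Lf * norm (z1 - z2) \<and>
               norm (hess (local_obj D Q k) z1 - hess (local_obj D Q k) z2) \<le> Lh * norm (z1 - z2)))"

definition stochastic_oracles ::
    "nat \<Rightarrow> (nat \<Rightarrow> 's measure) \<Rightarrow> (nat \<Rightarrow> 'z::euclidean_space \<Rightarrow> 's \<Rightarrow> real) \<Rightarrow> real \<Rightarrow> real \<Rightarrow> bool"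
  where
  "stochastic_oracles K D Q \<sigma> \<sigma>h \<longleftrightarrow>
    (\<forall>k<K. prob_space (D k) \<and>
      (\<forall>s\<in>space (D k). twice_differentiable (\<lambda>z. Q k z s)) \<and>
      (\<forall>z. integrable (D k) (\<lambda>s. Q k z s) \<and>
           integrable (D k) (\<lambda>s. grad (\<lambda>z'. Q k z' s) z) \<and>
           (\<integral>s. grad (\<lambda>z'. Q k z' s) z \<partial>D k) = grad (local_obj D Q k) z \<and>
           integrable (D k) (\<lambda>s. hess (\<lambda>z'. Q k z' s) z) \<and>
           (\<integral>s. hess (\<lambda>z'. Q k z' s) z \<partial>D k) = hess (local_obj D Q k) z \<and>
           integrable (D k) (\<lambda>s. (norm (grad (\<lambda>z'. Q k z' s) z - grad (local_obj D Q k) z))\<^sup>2) \<and>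
           (\<integral>s. (norm (grad (\<lambda>z'. Q k z' s) z - grad (local_obj D Q k) z))\<^sup>2 \<partial>D k) \<le> \<sigma>\<^sup>2 \<and>
           integrable (D k) (\<lambda>s. (norm (hess (\<lambda>z'. Q k z' s) z - hess (local_obj D Q k) z))\<^sup>2) \<and>
           (\<integral>s. (norm (hess (\<lambda>z'. Q k z' s) z - hess (local_obj D Q k) z))\<^sup>2 \<partial>D k) \<le> \<sigma>h\<^sup>2))"

definition pl_condition ::
    "('x::euclidean_space \<times> 'y::euclidean_space \<Rightarrow> real) \<Rightarrow> real \<Rightarrow> bool" where
  "pl_condition J \<nu> \<longleftrightarrow> 0 < \<nu> \<and>
    (\<forall>x. maximizers J x \<noteq> {}) \<and> bdd_below (range (primal J)) \<and>
    (\<forall>x y. (norm (snd (grad J (x, y))))\<^sup>2 \<ge> 2 * \<nu> * (primal J x - J (x, y)))"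

text \<open>
  Real \<open>K \<times> K\<close> matrices are functions restricted to \<open>{..<K}\<close>, since the bound has to be uniform in
  \<open>K\<close>; \<open>nb k\<close> is the neighbourhood of agent \<open>k\<close>.
\<close>

primrec mpow :: "nat \<Rightarrow> (nat \<Rightarrow> nat \<Rightarrow> real) \<Rightarrow> nat \<Rightarrow> nat \<Rightarrow> nat \<Rightarrow> real" where
  "mpow K A 0 = (\<lambda>k l. if k = l then 1 else 0)"
| "mpow K A (Suc p) = (\<lambda>k l. \<Sum>j<K. A k j * mpow K A p j l)"

definition primitive_matrix :: "nat \<Rightarrow> (nat \<Rightarrow> nat \<Rightarrow> real) \<Rightarrow> bool" where
  "primitive_matrix K A \<longleftrightarrow>
    (\<forall>k<K. \<forall>l<K. 0 \<le> A k l) \<and> (\<exists>p\<ge>1. \<forall>k<K. \<forall>l<K. 0 < mpow K A p k l)"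

definition spectral_norm :: "nat \<Rightarrow> (nat \<Rightarrow> nat \<Rightarrow> real) \<Rightarrow> real" where
  "spectral_norm K B =
    (SUP v\<in>{v. L2_set v {..<K} \<le> 1}. L2_set (\<lambda>k. \<Sum>l<K. B k l * v l) {..<K})"

definition mixing_rate :: "nat \<Rightarrow> (nat \<Rightarrow> nat \<Rightarrow> real) \<Rightarrow> real" where
  "mixing_rate K A = spectral_norm K (\<lambda>k l. A k l - 1 / real K)"

definition mixing_network :: "nat \<Rightarrow> (nat \<Rightarrow> nat set) \<Rightarrow> (nat \<Rightarrow> nat \<Rightarrow> real) \<Rightarrow> bool" where
  "mixing_network K nb A \<longleftrightarrow>
    (\<forall>k<K. nb k \<subseteq> {..<K}) \<and>
    (\<forall>k<K. \<forall>l<K. l \<notin> nb k \<longrightarrow> A k l = 0) \<and>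
    primitive_matrix K A \<and>
    (\<forall>l<K. (\<Sum>k<K. A k l) = 1) \<and> (\<forall>k<K. (\<Sum>l<K. A k l) = 1) \<and>
    mixing_rate K A < 1"

text \<open>
  \<open>Init k\<close> indexes the initial sample of agent \<open>k\<close>, and \<open>Local k i n\<close> its sample at local step \<open>n\<close>
  of round \<open>i\<close>.
\<close>

datatype sample_idx = Init nat | Local nat nat nat

primrec agent_of :: "sample_idx \<Rightarrow> nat" where
  "agent_of (Init k) = k"
| "agent_of (Local k i n) = k"

definition sample_idxs :: "nat \<Rightarrow> nat \<Rightarrow> sample_idx set" where
  "sample_idxs K N = {Init k | k. k < K} \<union> {Local k i n | k i n. k < K \<and> n < N}"

record dima_params =
  steps :: nat
  eta_x :: real
  eta_y :: real
  loc_eta_x :: real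
  loc_eta_y :: real
  mom_beta :: real
  corr_gamma :: real

text \<open>The state at the start of round \<open>i\<close>.\<close>

record 'z dima_state =
  iter :: "nat \<Rightarrow> 'z"               (* z_{k,i} *)
  prev_local :: "nat \<Rightarrow> nat \<Rightarrow> 'z"  (* z_{k,i-1,n} *)
  prev_m :: "nat \<Rightarrow> 'z"             (* m_{k,i-1} *)
  prev_u :: "nat \<Rightarrow> 'z"             (* u_{k,i-1} *)

definition hvp ::
    "('z::euclidean_space \<Rightarrow> 's \<Rightarrow> real) \<Rightarrow> 'z \<Rightarrow> 'z \<Rightarrow> 's \<Rightarrow> 'z" where
  "hvp q z1 z2 s = blinfun_apply (hess (\<lambda>z. q z s) z1) (z1 - z2)"

text \<open>
  \<open>sgn v = v /\<^sub>R norm v\<close> is the normalization; \<open>ds n\<close> is the sample used at local step \<open>n\<close>.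
\<close>

primrec local_iter ::
    "dima_params \<Rightarrow> ('x::euclidean_space \<times> 'y::euclidean_space \<Rightarrow> 's \<Rightarrow> real) \<Rightarrow> (nat \<Rightarrow> 's) \<Rightarrow>
     'x \<times> 'y \<Rightarrow> nat \<Rightarrow> 'x \<times> 'y" where
  "local_iter p q ds z0 0 = z0"
| "local_iter p q ds z0 (Suc n) =
    (let z = local_iter p q ds z0 n; g = grad (\<lambda>z'. q z' (ds n)) z
     in (fst z - loc_eta_x p *\<^sub>R sgn (fst g), snd z + loc_eta_y p *\<^sub>R sgn (snd g)))"

definition round_local ::
    "dima_params \<Rightarrow> (nat \<Rightarrow> 'x::euclidean_space \<times> 'y::euclidean_space \<Rightarrow> 's \<Rightarrow> real) \<Rightarrow>
     (sample_idx \<Rightarrow> 's) \<Rightarrow> nat \<Rightarrow> ('x \<times> 'y) dima_state \<Rightarrow> nat \<Rightarrow> nat \<Rightarrow> 'x \<times> 'y" where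
  "round_local p Q s i st k n = local_iter p (Q k) (\<lambda>j. s (Local k i j)) (iter st k) n"

definition dima_round ::
    "nat \<Rightarrow> (nat \<Rightarrow> nat set) \<Rightarrow> (nat \<Rightarrow> nat \<Rightarrow> real) \<Rightarrow> dima_params \<Rightarrow>
     (nat \<Rightarrow> 'x::euclidean_space \<times> 'y::euclidean_space \<Rightarrow> 's \<Rightarrow> real) \<Rightarrow>
     (sample_idx \<Rightarrow> 's) \<Rightarrow> nat \<Rightarrow> ('x \<times> 'y) dima_state \<Rightarrow> ('x \<times> 'y) dima_state" where
  "dima_round K nb A p Q s i st =
    (let zl = round_local p Q s i st;
         g = (\<lambda>k. (1 / real (steps p)) *\<^sub>R
                (\<Sum>n<steps p. grad (\<lambda>z. Q k z (s (Local k i n))) (zl k n)));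
         h = (\<lambda>k. (1 / real (steps p)) *\<^sub>R
                (\<Sum>n<steps p. hvp (Q k) (zl k n) (prev_local st k n) (s (Local k i n))));
         m = (\<lambda>k. (1 - mom_beta p) *\<^sub>R (prev_m st k + corr_gamma p *\<^sub>R h k) + mom_beta p *\<^sub>R g k);
         u = (\<lambda>k. \<Sum>l\<in>nb k. A k l *\<^sub>R (prev_u st l + m l - prev_m st l))
     in \<lparr>iter = (\<lambda>k. (\<Sum>l\<in>nb k. A k l *\<^sub>R (fst (iter st l) - eta_x p *\<^sub>R sgn (fst (u l))),
                      \<Sum>l\<in>nb k. A k l *\<^sub>R (snd (iter st l) + eta_y p *\<^sub>R sgn (snd (u l))))),
         prev_local = zl, prev_m = m, prev_u = u\<rparr>)"

text \<open>The run from a common initial point \<open>z0\<close> along one realization \<open>s\<close> of the samples.\<close>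

primrec dima_run ::
    "nat \<Rightarrow> (nat \<Rightarrow> nat set) \<Rightarrow> (nat \<Rightarrow> nat \<Rightarrow> real) \<Rightarrow> dima_params \<Rightarrow>
     (nat \<Rightarrow> 'x::euclidean_space \<times> 'y::euclidean_space \<Rightarrow> 's \<Rightarrow> real) \<Rightarrow>
     'x \<times> 'y \<Rightarrow> (sample_idx \<Rightarrow> 's) \<Rightarrow> nat \<Rightarrow> ('x \<times> 'y) dima_state" where
  "dima_run K nb A p Q z0 s 0 =
    \<lparr>iter = (\<lambda>k. z0), prev_local = (\<lambda>k n. z0),
     prev_m = (\<lambda>k. grad (\<lambda>z. Q k z (s (Init k))) z0),
     prev_u = (\<lambda>k. grad (\<lambda>z. Q k z (s (Init k))) z0)\<rparr>"
| "dima_run K nb A p Q z0 s (Suc i) = dima_round K nb A p Q s i (dima_run K nb A p Q z0 s i)"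

definition centroid :: "nat \<Rightarrow> ('z::real_vector) dima_state \<Rightarrow> 'z" where
  "centroid K st = (1 / real K) *\<^sub>R (\<Sum>k<K. iter st k)"

text \<open>
  Every vector normalized in rounds \<open>0, \<dots>, T - 1\<close> is nonzero.  The direction used in round \<open>i\<close> is
  the field \<open>prev_u\<close> of the state after that round.
\<close>

definition normalizable ::
    "nat \<Rightarrow> (nat \<Rightarrow> nat set) \<Rightarrow> (nat \<Rightarrow> nat \<Rightarrow> real) \<Rightarrow> dima_params \<Rightarrow>
     (nat \<Rightarrow> 'x::euclidean_space \<times> 'y::euclidean_space \<Rightarrow> 's \<Rightarrow> real) \<Rightarrow>
     'x \<times> 'y \<Rightarrow> (sample_idx \<Rightarrow> 's) \<Rightarrow> nat \<Rightarrow> bool" where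
  "normalizable K nb A p Q z0 s T \<longleftrightarrow>
    (\<forall>i<T. \<forall>k<K.
      (\<forall>n<steps p.
        let g = grad (\<lambda>z. Q k z (s (Local k i n)))
                  (round_local p Q s i (dima_run K nb A p Q z0 s i) k n)
        in fst g \<noteq> 0 \<and> snd g \<noteq> 0) \<and>
      (let u = prev_u (dima_run K nb A p Q z0 s (Suc i)) k in fst u \<noteq> 0 \<and> snd u \<noteq> 0))"

text \<open>
  The samples and the (possibly random) initial point are jointly independent; hence each sample is
  independent of the point at which the algorithm evaluates it.  The library's \<open>indep_vars\<close> needs one
  common value type, so independence is stated for the generated events, with \<open>None\<close> indexing \<open>z0\<close>.
\<close>

definition dima_sampling ::
    "nat \<Rightarrow> nat \<Rightarrow> (nat \<Rightarrow> 's measure) \<Rightarrow> 'w measure \<Rightarrow> ('w \<Rightarrow> 'z::euclidean_space) \<Rightarrow>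
     (sample_idx \<Rightarrow> 'w \<Rightarrow> 's) \<Rightarrow> bool" where
  "dima_sampling K N D M z0 \<xi> \<longleftrightarrow>
    prob_space M \<and>
    z0 \<in> borel_measurable M \<and>
    (\<forall>j\<in>sample_idxs K N. \<xi> j \<in> measurable M (D (agent_of j)) \<and>
        distr M (D (agent_of j)) (\<xi> j) = D (agent_of j)) \<and>
    prob_space.indep_sets M
      (\<lambda>v. case v of
          None \<Rightarrow> {z0 -` B \<inter> space M | B. B \<in> sets borel}
        | Some j \<Rightarrow> {\<xi> j -` B \<inter> space M | B. B \<in> sets (D (agent_of j))})
      (insert None (Some ` sample_idxs K N))"

text \<open>
  \<open>\<Delta>0\<close> bounds the initial optimality gaps of the outer and of the inner problem.  The integrability
  conditions are void for a deterministic initial point.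
\<close>

definition initial_gap ::
    "nat \<Rightarrow> (nat \<Rightarrow> 's measure) \<Rightarrow>
     (nat \<Rightarrow> 'x::euclidean_space \<times> 'y::euclidean_space \<Rightarrow> 's \<Rightarrow> real) \<Rightarrow>
     'w measure \<Rightarrow> ('w \<Rightarrow> 'x \<times> 'y) \<Rightarrow> real \<Rightarrow> bool" where
  "initial_gap K D Q M z0 \<Delta>0 \<longleftrightarrow>
    (let J = global_obj K D Q in
      integrable M (\<lambda>\<omega>. J (z0 \<omega>)) \<and>
      integrable M (\<lambda>\<omega>. primal J (fst (z0 \<omega>))) \<and>
      (\<forall>k<K. integrable M (\<lambda>\<omega>. norm (grad (local_obj D Q k) (z0 \<omega>)))) \<and>
      (\<integral>\<omega>. primal J (fst (z0 \<omega>)) \<partial>M) - (INF x. primal J x) \<le> \<Delta>0 \<and>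
      (\<integral>\<omega>. primal J (fst (z0 \<omega>)) - J (z0 \<omega>) \<partial>M) \<le> \<Delta>0)"

end

(*
  The steps are normalized, so all displacements are deterministically of the order of the step
  sizes; only the direction errors are random.  Three facts drive the proof.
  (1) Under the PL condition the primal function P is smooth (with a kappa-dependent constant),
  grad P (x) is close to grad_x J (x, y) up to L dist (y, argmax J (x, .)), and gradient ascent of
  finite length gives the error bound dist (y, argmax J (x, .)) <= 4/3 |grad_y J (x, y)| / nu.
  (2) One round decreases P and the gap P - J up to the errors of the directions u_k.  The gap
  controls the average of |grad_y J|, hence of the distance term, and then P controls |grad P|.
  (3) The direction error splits into the consensus error of the gradient tracking, a geometric
  contraction whose average is of order T^(-2/3), and the error of the averaged momentum.  The
  Hessian correction makes the latter an AR(1) process with a second-order bias and noise that is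
  a martingale difference over all samples of a round, so its mean square is that of one sample
  divided by N K beta.
  Since T may be large depending on the instance, only the terms of order T^(-1/3) need
  constants that are uniform in the instance.
*)
theory Submission
  imports Defs
begin

section \<open>Gradients and Hessians\<close>

lemma norm_fst_le_norm: "norm (fst z) \<le> norm z"
  and norm_snd_le_norm: "norm (snd z) \<le> norm z"
  for z :: "'a::real_normed_vector \<times> 'b::real_normed_vector"
  using norm_fst_le[of "fst z" "snd z"] norm_snd_le[of "snd z" "fst z"] by simp_all

lemma GDERIV_imp_grad:
  fixes f :: "'a::euclidean_space \<Rightarrow> real"
  assumes "GDERIV f z :> g"
  shows "grad f z = g"
  unfolding grad_def
proof (rule the_equality)
  show "GDERIV f z :> g" by (rule assms)
  fix g' assume "GDERIV f z :> g'"
  then have "(\<lambda>h. inner h g') = (\<lambda>h. inner h g)"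
    using assms unfolding gderiv_def by (rule has_derivative_unique)
  then have "inner h g' = inner h g" for h by (rule fun_cong)
  then show "g' = g"
    using vector_eq_ldot[of g' g] by (simp add: inner_commute)
qed

lemma GDERIV_grad:
  fixes f :: "'a::euclidean_space \<Rightarrow> real"
  assumes "f differentiable (at z)"
  shows "GDERIV f z :> grad f z"
proof -
  obtain f' where f': "(f has_derivative f') (at z)"
    using assms by (auto simp: differentiable_def)
  have "f' h = inner h (\<Sum>b\<in>Basis. f' b *\<^sub>R b)" for h
  proof -
    interpret linear f' using f' by (rule has_derivative_linear)
    have "f' h = f' (\<Sum>b\<in>Basis. (h \<bullet> b) *\<^sub>R b)" by (simp add: euclidean_representation)
    then show ?thesis by (simp add: sum scale inner_sum_right mult.commute)
  qed
  then have "f' = (\<lambda>h. inner h (\<Sum>b\<in>Basis. f' b *\<^sub>R b))"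
    by blast
  with f' have *: "GDERIV f z :> (\<Sum>b\<in>Basis. f' b *\<^sub>R b)"
    unfolding gderiv_def by argo
  then show ?thesis using GDERIV_imp_grad[OF *] by simp
qed

lemma twice_differentiable_grad:
  assumes "twice_differentiable f"
  shows "GDERIV f z :> grad f z"
  using assms GDERIV_grad by (auto simp: twice_differentiable_def)

lemma twice_differentiable_hess:
  assumes "twice_differentiable f"
  shows "(grad f has_derivative blinfun_apply (hess f z)) (at z)"
proof -
  have "(grad f has_derivative frechet_derivative (grad f) (at z)) (at z)"
    using assms frechet_derivative_works by (auto simp: twice_differentiable_def)
  then show ?thesis
    unfolding hess_def by (simp add: bounded_linear_Blinfun_apply[OF has_derivative_bounded_linear])
qed

lemma GDERIV_sum:
  assumes "\<And>i. i \<in> I \<Longrightarrow> GDERIV (f i) z :> g i"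
  shows "GDERIV (\<lambda>z. \<Sum>i\<in>I. f i z) z :> (\<Sum>i\<in>I. g i)"
  using assms unfolding gderiv_def inner_sum_right by (intro has_derivative_sum) auto

lemma GDERIV_cmult:
  assumes "GDERIV f z :> g"
  shows "GDERIV (\<lambda>z. c * f z) z :> c *\<^sub>R g"
  using assms unfolding gderiv_def inner_scaleR_right
  by (rule has_derivative_mult_right)

lemma Lipschitz_gradient_bound:
  fixes f :: "'a::euclidean_space \<Rightarrow> real"
  assumes f: "\<And>z. GDERIV f z :> g z"
    and L: "\<And>z1 z2. norm (g z1 - g z2) \<le> L * norm (z1 - z2)" and "0 \<le> L"
  shows "\<bar>f z' - f z - g z \<bullet> (z' - z)\<bar> \<le> L * (norm (z' - z))\<^sup>2"
proof -
  have B: "onorm (\<lambda>h. h \<bullet> g x - h \<bullet> g z) \<le> L * norm (z' - z)" if "x \<in> closed_segment z z'" for x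
  proof (rule onorm_le)
    fix h
    have "\<bar>h \<bullet> (g x - g z)\<bar> \<le> norm h * norm (g x - g z)" by (rule Cauchy_Schwarz_ineq2)
    also have "\<dots> \<le> norm h * (L * norm (z' - z))"
      using L[of x z] mult_left_mono[OF segment_bound(1)[OF that] \<open>0 \<le> L\<close>]
      by (intro mult_left_mono) auto
    finally have "\<bar>h \<bullet> (g x - g z)\<bar> \<le> norm h * (L * norm (z' - z))" .
    then show "norm (h \<bullet> g x - h \<bullet> g z) \<le> L * norm (z' - z) * norm h"
      by (simp add: inner_diff_right mult.commute)
  qed
  have "norm (f z' - f z - (z' - z) \<bullet> g z) \<le> norm (z' - z) * (L * norm (z' - z))"
  proof (rule differentiable_bound_linearization[where S="closed_segment z z'" and f'="\<lambda>x h. h \<bullet> g x"])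
    show "z + t *\<^sub>R (z' - z) \<in> closed_segment z z'" if "t \<in> {0..1}" for t
      using that by (auto simp: in_segment algebra_simps intro!: exI[of _ t])
    show "(f has_derivative (\<lambda>h. h \<bullet> g x)) (at x within closed_segment z z')" for x
      using f[of x] unfolding gderiv_def by (rule has_derivative_at_withinI)
  qed (use B in \<open>auto simp: fun_diff_def\<close>)
  then show ?thesis by (simp add: power2_eq_square inner_commute mult_ac)
qed

lemma Lipschitz_hessian_bound:
  fixes G :: "'a::euclidean_space \<Rightarrow> 'a" and H :: "'a \<Rightarrow> 'a \<Rightarrow>\<^sub>L 'a"
  assumes G: "\<And>z. (G has_derivative blinfun_apply (H z)) (at z)"
    and L: "\<And>z1 z2. norm (H z1 - H z2) \<le> L * norm (z1 - z2)" and "0 \<le> L"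
  shows "norm (G z' - G z + H z (z - z')) \<le> L * (norm (z - z'))\<^sup>2"
proof -
  have B: "onorm (blinfun_apply (H x) - blinfun_apply (H z)) \<le> L * norm (z' - z)"
    if "x \<in> closed_segment z z'" for x
  proof -
    have "onorm (blinfun_apply (H x - H z)) \<le> L * norm (x - z)"
      using L[of x z] by (simp add: norm_blinfun.rep_eq)
    also have "norm (x - z) \<le> norm (z' - z)"
      using segment_bound(1)[OF that] by simp
    finally show ?thesis
      using \<open>0 \<le> L\<close> by (simp add: mult_left_mono minus_blinfun.rep_eq fun_diff_def)
  qed
  have "norm (G z' - G z - H z (z' - z)) \<le> norm (z' - z) * (L * norm (z' - z))"
  proof (rule differentiable_bound_linearization[where S="closed_segment z z'" and f'="\<lambda>x. blinfun_apply (H x)"])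
    show "z + t *\<^sub>R (z' - z) \<in> closed_segment z z'" if "t \<in> {0..1}" for t
      using that by (auto simp: in_segment algebra_simps intro!: exI[of _ t])
    show "(G has_derivative blinfun_apply (H x)) (at x within closed_segment z z')" for x
      using G[of x] by (rule has_derivative_at_withinI)
  qed (use B in \<open>auto simp: fun_diff_def\<close>)
  moreover have "H z (z - z') = - H z (z' - z)"
    by (metis blinfun.minus_right minus_diff_eq)
  ultimately show ?thesis by (simp add: power2_eq_square norm_minus_commute mult_ac)
qed

lemma has_derivative_imp_sequential_limit:
  fixes G :: "'a::real_normed_vector \<Rightarrow> 'b::real_normed_vector"
  assumes G: "(G has_derivative G') (at z)"
  shows "(\<lambda>n. real (Suc n) *\<^sub>R (G (z + (1 / real (Suc n)) *\<^sub>R h) - G z)) \<longlonglongrightarrow> G' h"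
proof (cases "h = 0")
  case True
  then show ?thesis using linear_0[OF has_derivative_linear[OF G]] by simp
next
  case False
  interpret linear G' using G by (rule has_derivative_linear)
  let ?y = "\<lambda>n. z + (1 / real (Suc n)) *\<^sub>R h"
  have "(\<lambda>n. (1 / real (Suc n)) *\<^sub>R h) \<longlonglongrightarrow> 0 *\<^sub>R h"
    using LIMSEQ_Suc[OF lim_1_over_n] by (intro tendsto_intros)
  then have "?y \<longlonglongrightarrow> z + 0"
    by (intro tendsto_intros) simp
  then have y: "filterlim ?y (at z) sequentially"
    using False by (simp add: filterlim_at)
  have "((\<lambda>y. (G y - G z - G' (y - z)) /\<^sub>R norm (y - z)) \<longlongrightarrow> 0) (at z)"
    using G by (simp add: has_derivative_at_within)
  from tendsto_scaleR[OF tendsto_const[of "norm h"] filterlim_compose[OF this y]]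
  have "(\<lambda>n. norm h *\<^sub>R ((G (?y n) - G z - G' (?y n - z)) /\<^sub>R norm (?y n - z))) \<longlonglongrightarrow> 0"
    by simp
  also have "(\<lambda>n. norm h *\<^sub>R ((G (?y n) - G z - G' (?y n - z)) /\<^sub>R norm (?y n - z)))
      = (\<lambda>n. real (Suc n) *\<^sub>R (G (?y n) - G z) - G' h)"
  proof
    fix n
    have c1: "norm h * (a * inverse (norm h)) = a"
      and c2: "norm h * (a * inverse (norm h) * inverse a) = (if a = 0 then 0 else 1)" for a
      using False by (auto simp: field_simps)
    have "G' (?y n - z) = (1 / real (Suc n)) *\<^sub>R G' h"
      using scale[of "1 / real (Suc n)" h] by simp
    moreover have "norm (?y n - z) = norm h / real (Suc n)" by simp
    ultimately show "norm h *\<^sub>R ((G (?y n) - G z - G' (?y n - z)) /\<^sub>R norm (?y n - z))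
        = real (Suc n) *\<^sub>R (G (?y n) - G z) - G' h"
      using False by (simp add: scaleR_diff_right c1 c2 del: of_nat_Suc)
  qed
  finally show ?thesis by (rule LIM_zero_cancel)
qed

lemma inner_sgn_ge: "norm p - 2 * norm (u - p) \<le> p \<bullet> sgn u" for p u :: "'a::real_inner"
proof -
  have "norm u = u \<bullet> sgn u"
    by (cases "u = 0") (auto simp: sgn_div_norm dot_square_norm power2_eq_square)
  moreover have "\<bar>(u - p) \<bullet> sgn u\<bar> \<le> norm (u - p) * norm (sgn u)"
    by (rule Cauchy_Schwarz_ineq2)
  moreover have "norm (u - p) * norm (sgn u) \<le> norm (u - p) * 1"
    by (intro mult_left_mono) (auto simp: norm_sgn)
  moreover have "norm p \<le> norm u + norm (u - p)"
    using norm_triangle_sub[of p u] by (simp add: norm_minus_commute)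
  ultimately show ?thesis by (simp add: inner_diff_left)
qed

section \<open>The inner problem under the Polyak-Lojasiewicz condition\<close>

lemma quadratic_remainder_imp_GDERIV:
  fixes f :: "'a::real_inner \<Rightarrow> real"
  assumes "\<And>z'. \<bar>f z' - f z - g \<bullet> (z' - z)\<bar> \<le> C * (norm (z' - z))\<^sup>2"
  shows "GDERIV f z :> g"
  unfolding gderiv_def
proof (rule has_derivativeI_sandwich[where e=1 and H="\<lambda>y. C * norm (y - z)"])
  show "bounded_linear (\<lambda>h. h \<bullet> g)" by (rule bounded_linear_inner_left)
  show "norm (f y - f z - (y - z) \<bullet> g) / norm (y - z) \<le> C * norm (y - z)" if "y \<noteq> z" for y
    using assms[of y] that by (simp add: divide_simps power2_eq_square inner_commute mult.assoc)
  have "((\<lambda>y. C * norm (y - z)) \<longlongrightarrow> C * norm (z - z)) (at z)" by (intro tendsto_intros)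
  then show "((\<lambda>y. C * norm (y - z)) \<longlongrightarrow> 0) (at z)" by simp
qed simp

locale pl_objective =
  fixes J :: "'x::euclidean_space \<times> 'y::euclidean_space \<Rightarrow> real" and L \<nu> :: real
  assumes GD: "\<And>z. GDERIV J z :> grad J z"
    and Lip: "\<And>z1 z2. norm (grad J z1 - grad J z2) \<le> L * norm (z1 - z2)"
    and L_pos: "0 < L"
    and pl: "pl_condition J \<nu>"
begin

lemma nu_pos: "0 < \<nu>" and maximizers_nonempty: "maximizers J x \<noteq> {}"
  and PL: "2 * \<nu> * (primal J x - J (x, y)) \<le> (norm (snd (grad J (x, y))))\<^sup>2"
  and primal_bdd: "bdd_below (range (primal J))"
  using pl by (auto simp: pl_condition_def)

lemma quad: "\<bar>J z' - J z - grad J z \<bullet> (z' - z)\<bar> \<le> L * (norm (z' - z))\<^sup>2"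
  using Lipschitz_gradient_bound[OF GD Lip] L_pos by simp

lemma J_le_primal: "J (x, y) \<le> primal J x"
proof -
  obtain y0 where "y0 \<in> maximizers J x" using maximizers_nonempty by blast
  then have "bdd_above (range (\<lambda>y. J (x, y)))"
    by (auto simp: maximizers_def bdd_above_def)
  then show ?thesis unfolding primal_def by (rule cSUP_upper[OF UNIV_I])
qed

lemma primal_eq: "y \<in> maximizers J x \<Longrightarrow> primal J x = J (x, y)"
proof (rule antisym)
  show "primal J x \<le> J (x, y)" if "y \<in> maximizers J x"
    using that unfolding primal_def maximizers_def by (intro cSUP_least) auto
qed (rule J_le_primal)

lemma maximizers_iff: "y \<in> maximizers J x \<longleftrightarrow> primal J x \<le> J (x, y)"
  using primal_eq J_le_primal order_trans by (fastforce simp: maximizers_def)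

lemma continuous_J: "continuous_on UNIV J"
  using GD unfolding gderiv_def
  by (meson continuous_at_imp_continuous_on has_derivative_continuous)

lemma closed_maximizers: "closed (maximizers J x)"
proof -
  have "continuous_on UNIV (\<lambda>y. J (x, y))"
    by (rule continuous_on_compose2[OF continuous_J]) (auto intro!: continuous_intros)
  then have "closed {y. primal J x \<le> J (x, y)}"
    by (intro closed_Collect_le continuous_intros)
  also have "{y. primal J x \<le> J (x, y)} = maximizers J x"
    by (auto simp: maximizers_iff)
  finally show ?thesis .
qed

lemma Lip_fst: "norm (fst (grad J z1) - fst (grad J z2)) \<le> L * norm (z1 - z2)"
  and Lip_snd: "norm (snd (grad J z1) - snd (grad J z2)) \<le> L * norm (z1 - z2)"
  using Lip[of z1 z2] norm_fst_le_norm[of "grad J z1 - grad J z2"] norm_snd_le_norm[of "grad J z1 - grad J z2"]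
  by auto

text \<open>
  The step size \<open>1 / (4 L)\<close> is small enough for the path-length constant \<open>4/3\<close> of
  \<open>error_bound\<close> to stay below 2, which the step-size ratio \<open>\<eta>x \<le> \<eta>y / (2 \<kappa>)\<close> requires.
\<close>

lemma ascent_step:
  "J (x, y) + 3 / (16 * L) * (norm (snd (grad J (x, y))))\<^sup>2
    \<le> J (x, y + (1 / (4 * L)) *\<^sub>R snd (grad J (x, y)))"
proof -
  let ?g = "snd (grad J (x, y))"
  have "J (x, y) + (1 / (4 * L)) * (norm ?g)\<^sup>2 - L * ((norm ?g) / (4 * L))\<^sup>2
      \<le> J (x, y + (1 / (4 * L)) *\<^sub>R ?g)"
    using quad[of "(x, y + (1 / (4 * L)) *\<^sub>R ?g)" "(x, y)"] L_pos
    by (simp add: inner_prod_def norm_Pair dot_square_norm abs_le_iff)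
  moreover have "(1 / (4 * L)) * (norm ?g)\<^sup>2 - L * ((norm ?g) / (4 * L))\<^sup>2
      = 3 / (16 * L) * (norm ?g)\<^sup>2"
    using L_pos by (simp add: field_simps power2_eq_square)
  ultimately show ?thesis by linarith
qed

lemma maximizer_critical:
  assumes "y \<in> maximizers J x"
  shows "snd (grad J (x, y)) = 0"
proof -
  have "3 / (16 * L) * (norm (snd (grad J (x, y))))\<^sup>2 \<le> 0"
    using ascent_step[of x y] J_le_primal[of x "y + (1 / (4 * L)) *\<^sub>R snd (grad J (x, y))"]
      primal_eq[OF assms] by linarith
  then have "(norm (snd (grad J (x, y))))\<^sup>2 \<le> 0"
    using L_pos by (simp add: mult_le_0_iff divide_le_0_iff)
  then show ?thesis by simp
qed

lemma error_bound:
  "\<exists>y'\<in>maximizers J x. norm (y - y') \<le> 4 / 3 * norm (snd (grad J (x, y))) / \<nu>"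
proof -
  define g where "g = (\<lambda>y. snd (grad J (x, y)))"
  define Y where "Y = rec_nat y (\<lambda>_ y. y + (1 / (4 * L)) *\<^sub>R g y)"
  have Y0: "Y 0 = y" and YS: "Y (Suc n) = Y n + (1 / (4 * L)) *\<^sub>R g (Y n)" for n
    by (simp_all add: Y_def)
  define \<delta> where "\<delta> = (\<lambda>n. primal J x - J (x, Y n))"
  define r where "r = (\<lambda>n. norm (Y (Suc n) - Y n))"
  define q where "q = sqrt (2 * \<nu>)"
  have q_pos: "q > 0" using nu_pos by (simp add: q_def)
  have \<delta>_nn: "\<delta> n \<ge> 0" for n using J_le_primal by (simp add: \<delta>_def)
  have r_eq: "norm (g (Y n)) = 4 * L * r n" for n
    using L_pos by (simp add: r_def YS)
  have r_nn: "r n \<ge> 0" for n by (simp add: r_def)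
  have PL': "q * sqrt (\<delta> n) \<le> norm (g (Y n))" for n
  proof -
    have "sqrt (2 * \<nu> * \<delta> n) \<le> sqrt ((norm (g (Y n)))\<^sup>2)"
      using PL[of x "Y n"] by (intro real_sqrt_le_mono) (simp add: \<delta>_def g_def)
    then show ?thesis by (simp add: q_def real_sqrt_mult)
  qed
  have dec: "3 / 8 * q * r n \<le> sqrt (\<delta> n) - sqrt (\<delta> (Suc n))" for n
  proof -
    define a b where "a = sqrt (\<delta> n)" and "b = sqrt (\<delta> (Suc n))"
    have ab: "a\<^sup>2 = \<delta> n" "b\<^sup>2 = \<delta> (Suc n)" "0 \<le> a" "0 \<le> b"
      using \<delta>_nn by (auto simp: a_def b_def)
    have "3 / (16 * L) * (norm (g (Y n)))\<^sup>2 \<le> \<delta> n - \<delta> (Suc n)"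
      using ascent_step[of x "Y n"] by (simp add: \<delta>_def YS g_def)
    moreover have "3 / (16 * L) * (norm (g (Y n)))\<^sup>2 = 3 / 4 * r n * norm (g (Y n))"
      using L_pos by (simp add: r_eq power2_eq_square)
    ultimately have gain: "3 / 4 * r n * norm (g (Y n)) \<le> a\<^sup>2 - b\<^sup>2" by (simp add: ab)
    have "b\<^sup>2 \<le> a\<^sup>2"
      using gain mult_nonneg_nonneg[OF mult_nonneg_nonneg[of "3/4" "r n"] norm_ge_zero[of "g (Y n)"]] r_nn[of n]
      by linarith
    then have "b \<le> a" using power2_le_imp_le ab(3) by blast
    show ?thesis
    proof (cases "a = 0")
      case True
      then have "b = 0" using \<open>b \<le> a\<close> ab by simp
      with True gain have "3 / 4 * r n * norm (g (Y n)) \<le> 0" by simp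
      then have "r n * r n * (3 * L) \<le> 0" by (simp add: r_eq mult_ac)
      then have "r n = 0" using L_pos by (auto simp: mult_le_0_iff)
      then show ?thesis using True \<open>b = 0\<close> unfolding a_def b_def by simp
    next
      case False
      then have "a > 0" using ab by simp
      have "3 / 4 * r n * (q * a) \<le> 3 / 4 * r n * norm (g (Y n))"
        using PL'[of n] r_nn[of n] by (intro mult_left_mono) (auto simp: a_def)
      also have "\<dots> \<le> (a - b) * (a + b)" using gain by (simp add: power2_eq_square algebra_simps)
      also have "\<dots> \<le> (a - b) * (2 * a)" using \<open>b \<le> a\<close> by (intro mult_left_mono) auto
      finally have "(3 / 8 * q * r n) * (2 * a) \<le> (a - b) * (2 * a)" by (simp add: mult_ac)
      then have "3 / 8 * q * r n \<le> a - b" using \<open>a > 0\<close> by (simp add: mult_le_cancel_right)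
      then show ?thesis by (simp add: a_def b_def)
    qed
  qed
  have sum_r: "sum r {..<m} \<le> sqrt (\<delta> 0) * 8 / (3 * q)" for m
  proof -
    have "3 / 8 * q * sum r {..<m} \<le> (\<Sum>n<m. sqrt (\<delta> n) - sqrt (\<delta> (Suc n)))"
      unfolding sum_distrib_left by (intro sum_mono dec)
    also have "\<dots> = sqrt (\<delta> 0) - sqrt (\<delta> m)" by (rule sum_lessThan_telescope')
    also have "\<dots> \<le> sqrt (\<delta> 0)" using \<delta>_nn by simp
    finally show ?thesis using q_pos by (simp add: field_simps)
  qed
  then have sr: "summable r" by (intro summableI_nonneg_bounded r_nn)
  then have sY: "summable (\<lambda>n. Y (Suc n) - Y n)" unfolding r_def by (rule summable_norm_cancel)
  define y' where "y' = y + (\<Sum>n. Y (Suc n) - Y n)"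
  have "(\<lambda>m. y + (\<Sum>n<m. Y (Suc n) - Y n)) \<longlonglongrightarrow> y'"
    unfolding y'_def by (intro tendsto_intros summable_LIMSEQ sY)
  then have lim: "Y \<longlonglongrightarrow> y'" by (simp add: sum_lessThan_telescope Y0)
  have "norm (y' - y) \<le> suminf r"
    unfolding y'_def r_def using summable_norm[OF sr[unfolded r_def]] by simp
  also have "\<dots> \<le> sqrt (\<delta> 0) * 8 / (3 * q)" by (rule suminf_le_const[OF sr sum_r])
  also have "\<dots> \<le> norm (g y) / q * 8 / (3 * q)"
    using PL'[of 0] q_pos by (intro divide_right_mono mult_right_mono) (auto simp: Y0 field_simps)
  also have "\<dots> = 4 / 3 * norm (g y) / \<nu>"
  proof -
    have "q * q = 2 * \<nu>" using nu_pos by (simp add: q_def)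
    then show ?thesis using q_pos nu_pos by (simp add: field_simps)
  qed
  finally have dist: "norm (y - y') \<le> 4 / 3 * norm (g y) / \<nu>" by (simp add: norm_minus_commute)
  have "(\<lambda>n. 4 * L * r n / q) \<longlonglongrightarrow> 4 * L * 0 / q"
    by (intro tendsto_intros summable_LIMSEQ_zero[OF sr]) (use q_pos in auto)
  then have "(\<lambda>n. 4 * L * r n / q) \<longlonglongrightarrow> 0" by simp
  moreover have "norm (sqrt (\<delta> n)) \<le> 4 * L * r n / q" for n
    using PL'[of n] q_pos \<delta>_nn[of n] by (simp add: r_eq field_simps)
  ultimately have "(\<lambda>n. sqrt (\<delta> n)) \<longlonglongrightarrow> 0"
    by (intro Lim_null_comparison[of "\<lambda>n. sqrt (\<delta> n)"]) (auto intro: always_eventually)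
  then have "(\<lambda>n. (sqrt (\<delta> n))\<^sup>2) \<longlonglongrightarrow> 0\<^sup>2" by (intro tendsto_intros)
  then have "\<delta> \<longlonglongrightarrow> 0" using \<delta>_nn by simp
  moreover have "\<delta> \<longlonglongrightarrow> primal J x - J (x, y')"
    unfolding \<delta>_def
    by (intro tendsto_intros continuous_on_tendsto_compose[OF continuous_J] lim) auto
  ultimately have "primal J x - J (x, y') = 0" using LIMSEQ_unique by blast
  then have "y' \<in> maximizers J x" by (simp add: maximizers_iff)
  with dist show ?thesis by (auto simp: g_def)
qed

lemma L_infdist_le: "L * infdist y (maximizers J x) \<le> 4 / 3 * (L / \<nu>) * norm (snd (grad J (x, y)))"
proof -
  obtain y' where y': "y' \<in> maximizers J x" "norm (y - y') \<le> 4 / 3 * norm (snd (grad J (x, y))) / \<nu>"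
    using error_bound by blast
  then have "infdist y (maximizers J x) \<le> 4 / 3 * norm (snd (grad J (x, y))) / \<nu>"
    using infdist_le[OF y'(1), of y] by (simp add: dist_norm)
  from mult_left_mono[OF this, of L] show ?thesis using L_pos by (simp add: mult_ac)
qed

definition "LP = L + L\<^sup>2 / (2 * \<nu>)"

lemma LP_pos: "0 < LP"
  using L_pos nu_pos by (simp add: LP_def add_pos_nonneg)

lemma primal_quad:
  assumes y: "y \<in> maximizers J x"
  shows "\<bar>primal J x' - primal J x - fst (grad J (x, y)) \<bullet> (x' - x)\<bar> \<le> LP * (norm (x' - x))\<^sup>2"
proof -
  have q: "\<bar>J (x', y) - primal J x - fst (grad J (x, y)) \<bullet> (x' - x)\<bar> \<le> L * (norm (x' - x))\<^sup>2"
    using quad[of "(x', y)" "(x, y)"] by (simp add: inner_prod_def norm_Pair primal_eq[OF y])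
  have "norm (snd (grad J (x', y))) \<le> L * norm (x' - x)"
    using Lip_snd[of "(x', y)" "(x, y)"] by (simp add: maximizer_critical[OF y] norm_Pair)
  then have "(norm (snd (grad J (x', y))))\<^sup>2 \<le> (L * norm (x' - x))\<^sup>2"
    by (intro power_mono) auto
  with PL[of x' y] have "primal J x' - J (x', y) \<le> L\<^sup>2 / (2 * \<nu>) * (norm (x' - x))\<^sup>2"
    using nu_pos by (simp add: field_simps power_mult_distrib)
  with q J_le_primal[of x' y] show ?thesis
    unfolding LP_def distrib_right by linarith
qed

lemma grad_primal: "y \<in> maximizers J x \<Longrightarrow> grad (primal J) x = fst (grad J (x, y))"
  using primal_quad by (intro GDERIV_imp_grad quadratic_remainder_imp_GDERIV)

lemma primal_descent:
  "\<bar>primal J x' - primal J x - grad (primal J) x \<bullet> (x' - x)\<bar> \<le> LP * (norm (x' - x))\<^sup>2"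
  using maximizers_nonempty[of x] primal_quad grad_primal by fastforce

lemma nearest_maximizer:
  obtains y' where "y' \<in> maximizers J x" "infdist y (maximizers J x) = norm (y - y')"
  using infdist_attains_inf[OF closed_maximizers maximizers_nonempty] by (metis dist_norm)

lemma grad_primal_near:
  "norm (grad (primal J) x - fst (grad J (x, y))) \<le> L * infdist y (maximizers J x)"
proof -
  obtain y' where y': "y' \<in> maximizers J x" "infdist y (maximizers J x) = norm (y - y')"
    by (rule nearest_maximizer)
  then show ?thesis
    using Lip_fst[of "(x, y')" "(x, y)"] by (simp add: grad_primal norm_Pair norm_minus_commute)
qed

lemma maximizers_near:
  assumes "y \<in> maximizers J x"
  obtains y' where "y' \<in> maximizers J x'" "norm (y - y') \<le> 4 / 3 * (L / \<nu>) * norm (x - x')"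
proof -
  obtain y' where y': "y' \<in> maximizers J x'" "norm (y - y') \<le> 4 / 3 * norm (snd (grad J (x', y))) / \<nu>"
    using error_bound by blast
  have "norm (snd (grad J (x', y))) \<le> L * norm (x - x')"
    using Lip_snd[of "(x', y)" "(x, y)"]
    by (simp add: maximizer_critical[OF assms] norm_Pair norm_minus_commute)
  then have "4 / 3 * norm (snd (grad J (x', y))) / \<nu> \<le> 4 / 3 * (L * norm (x - x')) / \<nu>"
    using nu_pos by (intro divide_right_mono mult_left_mono) auto
  with y' show ?thesis by (intro that[of y']) auto
qed

definition "crit z = norm (grad (primal J) (fst z)) + 2 * L * infdist (snd z) (maximizers J (fst z))"

lemma crit_nonneg: "0 \<le> crit z"
  using L_pos by (simp add: crit_def infdist_nonneg)

lemma crit_le: "crit z \<le> (1 + 4 * (L / \<nu>)) * norm (grad J z)"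
proof -
  obtain x y where z: "z = (x, y)" by fastforce
  have "norm (grad (primal J) x) \<le> norm (fst (grad J z)) + L * infdist y (maximizers J x)"
    using grad_primal_near[of x y] norm_triangle_sub[of "grad (primal J) x" "fst (grad J z)"]
    by (simp add: z)
  then have "crit z \<le> norm (fst (grad J z)) + 3 * (L * infdist y (maximizers J x))"
    by (simp add: crit_def z)
  also have "\<dots> \<le> norm (fst (grad J z)) + 3 * (4 / 3 * (L / \<nu>) * norm (snd (grad J z)))"
    using L_infdist_le[of y x] by (simp add: z)
  also have "\<dots> \<le> norm (grad J z) + 3 * (4 / 3 * (L / \<nu>) * norm (grad J z))"
    using L_pos nu_pos by (intro add_mono mult_left_mono norm_fst_le_norm norm_snd_le_norm) auto
  finally show ?thesis by (simp add: algebra_simps)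
qed

lemma continuous_crit: "continuous_on UNIV crit"
proof -
  define c where "c = 4 / 3 * (L / \<nu>)"
  have c: "0 \<le> c" using L_pos nu_pos by (simp add: c_def)
  have inf: "infdist y' (maximizers J x') \<le> infdist y (maximizers J x) + (norm (y - y') + c * norm (x - x'))"
    for x y x' y'
  proof -
    obtain v where v: "v \<in> maximizers J x" "infdist y (maximizers J x) = norm (y - v)"
      by (rule nearest_maximizer)
    obtain v' where v': "v' \<in> maximizers J x'" "norm (v - v') \<le> c * norm (x - x')"
      using maximizers_near[OF v(1)] unfolding c_def by blast
    have "infdist y' (maximizers J x') \<le> norm (y' - v')"
      using infdist_le[OF v'(1), of y'] by (simp add: dist_norm)
    also have "\<dots> = norm ((y' - y) + (y - v) + (v - v'))" by simp
    also have "\<dots> \<le> norm (y' - y) + norm (y - v) + norm (v - v')"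
      using norm_triangle_ineq[of "(y' - y) + (y - v)" "v - v'"] norm_triangle_ineq[of "y' - y" "y - v"]
      by linarith
    finally show ?thesis using v v' by (simp add: norm_minus_commute)
  qed
  have P: "norm (grad (primal J) x - grad (primal J) x') \<le> L * (norm (x - x') + c * norm (x - x'))" for x x'
  proof -
    obtain v where v: "v \<in> maximizers J x" using maximizers_nonempty by blast
    obtain v' where v': "v' \<in> maximizers J x'" "norm (v - v') \<le> c * norm (x - x')"
      using maximizers_near[OF v] unfolding c_def by blast
    have "norm (grad (primal J) x - grad (primal J) x') \<le> L * norm ((x, v) - (x', v'))"
      using Lip_fst[of "(x, v)" "(x', v')"] by (simp add: grad_primal[OF v] grad_primal[OF v'(1)])
    also have "norm ((x, v) - (x', v')) \<le> norm (x - x') + norm (v - v')"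
      by (simp add: norm_Pair_le)
    finally show ?thesis using v' L_pos mult_left_mono[of "norm (x - x') + norm (v - v')" "norm (x - x') + c * norm (x - x')" L]
      by (smt (verit) mult_left_mono)
  qed
  define B where "B = (L * (1 + c)) + 2 * L * (1 + c)"
  have le: "crit z' - crit z \<le> B * norm (z - z')" for z z'
  proof -
    obtain x y x' y' where z: "z = (x, y)" "z' = (x', y')" by fastforce
    have n: "norm (x - x') \<le> norm (z - z')" "norm (y - y') \<le> norm (z - z')"
      using norm_fst_le_norm[of "z - z'"] norm_snd_le_norm[of "z - z'"] by (auto simp: z)
    have "norm (grad (primal J) x') - norm (grad (primal J) x) \<le> L * (norm (x - x') + c * norm (x - x'))"
      using P[of x x'] norm_triangle_ineq2[of "grad (primal J) x'" "grad (primal J) x"]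
      by (simp add: norm_minus_commute)
    also have "\<dots> \<le> L * (norm (z - z') + c * norm (z - z'))"
      using n c L_pos by (intro mult_left_mono add_mono) auto
    finally have 1: "norm (grad (primal J) x') - norm (grad (primal J) x) \<le> L * (1 + c) * norm (z - z')"
      by (simp add: algebra_simps)
    have "infdist y' (maximizers J x') - infdist y (maximizers J x) \<le> norm (z - z') + c * norm (z - z')"
      using inf[of y' x' y x] n mult_left_mono[OF n(1) c] by linarith
    then have "2 * L * (infdist y' (maximizers J x') - infdist y (maximizers J x)) \<le> 2 * L * (norm (z - z') + c * norm (z - z'))"
      using L_pos by (intro mult_left_mono) auto
    with 1 show ?thesis by (simp add: crit_def z B_def algebra_simps)
  qed
  have "B-lipschitz_on UNIV crit"
  proof (rule lipschitz_onI)
    show "dist (crit z) (crit z') \<le> B * dist z z'" for z z'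
      using le[of z z'] le[of z' z] by (auto simp: dist_norm norm_minus_commute)
    show "0 \<le> B" using L_pos c by (simp add: B_def)
  qed
  then show ?thesis by (rule lipschitz_on_continuous_on)
qed

lemma one_step:
  fixes u :: "nat \<Rightarrow> 'x \<times> 'y"
  assumes K: "1 \<le> K" and \<eta>: "0 \<le> \<eta>x" "0 \<le> \<eta>y"
    and fz: "fst z' = fst z - \<eta>x *\<^sub>R ((1 / real K) *\<^sub>R (\<Sum>k<K. sgn (fst (u k))))"
    and sz: "snd z' = snd z + \<eta>y *\<^sub>R ((1 / real K) *\<^sub>R (\<Sum>k<K. sgn (snd (u k))))"
  defines "E \<equiv> (1 / real K) * (\<Sum>k<K. norm (u k - grad J z))"
    and "d \<equiv> L * infdist (snd z) (maximizers J (fst z))"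
  shows "primal J (fst z') \<le> primal J (fst z) - \<eta>x * norm (grad (primal J) (fst z))
          + 2 * \<eta>x * (d + E) + LP * \<eta>x\<^sup>2"
    and "primal J (fst z') - J z' \<le> primal J (fst z) - J z + \<eta>x * d
          - \<eta>y * norm (snd (grad J z)) + 2 * \<eta>y * E + LP * \<eta>x\<^sup>2 + L * (\<eta>x + \<eta>y)\<^sup>2"
proof -
  define sx where "sx = (1 / real K) *\<^sub>R (\<Sum>k<K. sgn (fst (u k)))"
  define sy where "sy = (1 / real K) *\<^sub>R (\<Sum>k<K. sgn (snd (u k)))"
  define g where "g = grad (primal J) (fst z)"
  have avg_le1: "norm ((1 / real K) *\<^sub>R (\<Sum>k<K. f k)) \<le> 1" if "\<And>k. norm (f k) \<le> 1"
    for f :: "nat \<Rightarrow> 'b::real_normed_vector"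
    using sum_norm_le[of "{..<K}" f "\<lambda>_. 1"] that K by (simp add: field_simps)
  have nsx: "norm sx \<le> 1" and nsy: "norm sy \<le> 1"
    unfolding sx_def sy_def by (intro avg_le1; simp add: norm_sgn)+
  have Dx: "fst z' - fst z = - \<eta>x *\<^sub>R sx" and Dy: "snd z' - snd z = \<eta>y *\<^sub>R sy"
    using fz sz by (simp_all add: sx_def sy_def)
  have nDx: "norm (fst z' - fst z) \<le> \<eta>x" and nDy: "norm (snd z' - snd z) \<le> \<eta>y"
    unfolding Dx Dy using nsx nsy \<eta> by (simp_all add: mult_left_le)
  have near: "norm (g - fst (grad J z)) \<le> d"
    using grad_primal_near[of "fst z" "snd z"] by (simp add: g_def d_def)
  have avg_const: "(1 / real K) * (\<Sum>k<K. c) = c" for c :: real using K by simp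
  have "(1 / real K) * (\<Sum>k<K. norm g - 2 * (d + norm (u k - grad J z)))
      \<le> (1 / real K) * (\<Sum>k<K. g \<bullet> sgn (fst (u k)))"
  proof (intro mult_left_mono sum_mono)
    fix k
    have "norm (fst (u k) - g) \<le> norm (fst (u k) - fst (grad J z)) + norm (fst (grad J z) - g)"
      using norm_triangle_ineq[of "fst (u k) - fst (grad J z)" "fst (grad J z) - g"] by simp
    also have "\<dots> \<le> norm (u k - grad J z) + d"
      using near norm_fst_le_norm[of "u k - grad J z"] by (simp add: norm_minus_commute)
    finally have "norm g - 2 * (d + norm (u k - grad J z)) \<le> norm g - 2 * norm (fst (u k) - g)"
      by simp
    also have "\<dots> \<le> g \<bullet> sgn (fst (u k))" by (rule inner_sgn_ge)
    finally show "norm g - 2 * (d + norm (u k - grad J z)) \<le> g \<bullet> sgn (fst (u k))" .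
  qed simp
  also have "(1 / real K) * (\<Sum>k<K. norm g - 2 * (d + norm (u k - grad J z))) = norm g - 2 * (d + E)"
    unfolding E_def using K
    by (simp add: sum_subtractf sum.distrib sum_distrib_left[symmetric] field_simps)
  also have "(1 / real K) * (\<Sum>k<K. g \<bullet> sgn (fst (u k))) = g \<bullet> sx"
    by (simp add: sx_def inner_sum_right)
  finally have gsx: "\<eta>x * (norm g - 2 * (d + E)) \<le> \<eta>x * (g \<bullet> sx)"
    using \<eta> by (intro mult_left_mono) auto
  have P: "primal J (fst z') \<le> primal J (fst z) + g \<bullet> (fst z' - fst z) + LP * \<eta>x\<^sup>2"
    using primal_descent[of "fst z'" "fst z"] mult_left_mono[OF power_mono[OF nDx, of 2], of LP] LP_pos
    unfolding g_def by (smt (verit) norm_ge_zero)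
  then show "primal J (fst z') \<le> primal J (fst z) - \<eta>x * norm (grad (primal J) (fst z))
          + 2 * \<eta>x * (d + E) + LP * \<eta>x\<^sup>2"
    using gsx unfolding Dx g_def[symmetric] by (simp add: algebra_simps)
  define h where "h = snd (grad J z)"
  have "(1 / real K) * (\<Sum>k<K. norm h - 2 * norm (u k - grad J z))
      \<le> (1 / real K) * (\<Sum>k<K. h \<bullet> sgn (snd (u k)))"
  proof (intro mult_left_mono sum_mono)
    fix k
    have "norm (snd (u k) - h) \<le> norm (u k - grad J z)"
      using norm_snd_le_norm[of "u k - grad J z"] by (simp add: h_def)
    then show "norm h - 2 * norm (u k - grad J z) \<le> h \<bullet> sgn (snd (u k))"
      using inner_sgn_ge[of h "snd (u k)"] by linarith
  qed simp
  also have "(1 / real K) * (\<Sum>k<K. norm h - 2 * norm (u k - grad J z)) = norm h - 2 * E"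
    unfolding E_def using K
    by (simp add: sum_subtractf sum_distrib_left[symmetric] field_simps)
  also have "(1 / real K) * (\<Sum>k<K. h \<bullet> sgn (snd (u k))) = h \<bullet> sy"
    by (simp add: sy_def inner_sum_right)
  finally have hsy: "\<eta>y * (norm h - 2 * E) \<le> \<eta>y * (h \<bullet> sy)"
    using \<eta> by (intro mult_left_mono) auto
  have "norm (z' - z) \<le> \<eta>x + \<eta>y"
    using norm_Pair_le[of "fst z' - fst z" "snd z' - snd z"] nDx nDy
    by (simp add: prod_eq_iff minus_prod_def)
  then have "L * (norm (z' - z))\<^sup>2 \<le> L * (\<eta>x + \<eta>y)\<^sup>2"
    using L_pos by (intro mult_left_mono power_mono) auto
  then have "J z + grad J z \<bullet> (z' - z) - L * (\<eta>x + \<eta>y)\<^sup>2 \<le> J z'"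
    using quad[of z' z] by linarith
  moreover have "grad J z \<bullet> (z' - z) = fst (grad J z) \<bullet> (fst z' - fst z) + h \<bullet> (snd z' - snd z)"
    by (simp add: inner_prod_def h_def)
  moreover have "(g - fst (grad J z)) \<bullet> (fst z' - fst z) \<le> d * \<eta>x"
    using norm_cauchy_schwarz[of "g - fst (grad J z)" "fst z' - fst z"]
      mult_mono[OF near nDx] order_trans[OF norm_ge_zero near] by (smt (verit) norm_ge_zero)
  ultimately show "primal J (fst z') - J z' \<le> primal J (fst z) - J z + \<eta>x * d
          - \<eta>y * norm (snd (grad J z)) + 2 * \<eta>y * E + LP * \<eta>x\<^sup>2 + L * (\<eta>x + \<eta>y)\<^sup>2"
    using P hsy unfolding Dy h_def[symmetric]
    by (simp add: inner_diff_left algebra_simps)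
qed

end

section \<open>Averaging over a mixing network\<close>

definition mean :: "nat \<Rightarrow> (nat \<Rightarrow> 'z::real_vector) \<Rightarrow> 'z" where
  "mean K X = (1 / real K) *\<^sub>R (\<Sum>k<K. X k)"

definition frob :: "nat \<Rightarrow> (nat \<Rightarrow> 'z::real_normed_vector) \<Rightarrow> real" where
  "frob K X = L2_set (\<lambda>k. norm (X k)) {..<K}"

lemma mean_add: "mean K (\<lambda>k. X k + Y k) = mean K X + mean K Y"
  and mean_diff: "mean K (\<lambda>k. X k - Y k) = mean K X - mean K Y"
  and mean_scaleR: "mean K (\<lambda>k. c *\<^sub>R X k) = c *\<^sub>R mean K X"
  and mean_cong: "(\<And>k. k < K \<Longrightarrow> X k = Y k) \<Longrightarrow> mean K X = mean K Y"
  for X Y :: "nat \<Rightarrow> 'z::real_vector"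
  by (auto simp: mean_def sum.distrib sum_subtractf scaleR_add_right scaleR_diff_right
      scaleR_sum_right[symmetric] mult.commute)

lemma mean_const: "1 \<le> K \<Longrightarrow> mean K (\<lambda>_. c) = (c::'z::real_vector)"
  by (simp add: mean_def sum_constant_scaleR)

lemma mean_mono: "(\<And>k. k < K \<Longrightarrow> f k \<le> g k) \<Longrightarrow> mean K f \<le> (mean K g :: real)"
  by (auto simp: mean_def intro!: mult_left_mono sum_mono divide_right_mono)

lemma norm_mean_le: "norm (mean K X) \<le> mean K (\<lambda>k. norm (X k))"
  for X :: "nat \<Rightarrow> 'z::real_normed_vector"
  by (auto simp: mean_def intro!: divide_right_mono norm_sum)

lemma mean_le: "1 \<le> K \<Longrightarrow> (\<And>k. k < K \<Longrightarrow> f k \<le> c) \<Longrightarrow> mean K f \<le> (c::real)"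
  using mean_mono[of K f "\<lambda>_. c"] mean_const[of K c] by simp

lemma norm_mean_le_const:
  fixes X :: "nat \<Rightarrow> 'z::real_normed_vector"
  shows "1 \<le> K \<Longrightarrow> (\<And>k. k < K \<Longrightarrow> norm (X k) \<le> c) \<Longrightarrow> norm (mean K X) \<le> c"
  using norm_mean_le mean_le order_trans by metis

lemma frob_nonneg: "0 \<le> frob K X"
  by (simp add: frob_def)

lemma frob_triangle: "frob K (\<lambda>k. X k + Y k) \<le> frob K X + frob K Y"
  unfolding frob_def
  by (rule order_trans[OF L2_set_mono L2_set_triangle_ineq]) (auto simp: norm_triangle_ineq)

lemma frob_triangle_diff: "frob K (\<lambda>k. X k - Y k) \<le> frob K X + frob K Y"
  unfolding frob_def
  by (rule order_trans[OF L2_set_mono L2_set_triangle_ineq]) (auto simp: norm_triangle_ineq4)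

lemma frob_le: "(\<And>k. k < K \<Longrightarrow> norm (X k) \<le> c) \<Longrightarrow> 0 \<le> c \<Longrightarrow> frob K X \<le> sqrt (real K) * c"
proof -
  assume *: "\<And>k. k < K \<Longrightarrow> norm (X k) \<le> c" and "0 \<le> c"
  have "frob K X \<le> L2_set (\<lambda>_. c) {..<K}"
    unfolding frob_def using * by (intro L2_set_mono) auto
  also have "\<dots> = sqrt (real K) * c" using \<open>0 \<le> c\<close> by (simp add: L2_set_def real_sqrt_mult)
  finally show ?thesis .
qed

lemma norm_le_frob: "k < K \<Longrightarrow> norm (X k) \<le> frob K X"
  unfolding frob_def by (rule member_le_L2_set) auto

lemma frob_le_sum: "frob K X \<le> (\<Sum>k<K. norm (X k))"
  unfolding frob_def by (rule L2_set_le_sum) auto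

lemma sum_norm_power2: "(\<Sum>k<K. (norm (X k))\<^sup>2) = (frob K X)\<^sup>2"
  by (simp add: frob_def L2_set_def sum_nonneg)

lemma frob_cong: "(\<And>k. k < K \<Longrightarrow> X k = Y k) \<Longrightarrow> frob K X = frob K Y"
  unfolding frob_def by (rule L2_set_cong) auto

lemma spectral_norm_bdd:
  fixes K :: nat
  shows "bdd_above ((\<lambda>v. L2_set (\<lambda>k. \<Sum>l<K. B k l * v l) {..<K}) ` {v. L2_set v {..<K} \<le> 1})"
proof (rule bdd_aboveI2)
  fix v :: "nat \<Rightarrow> real" assume "v \<in> {v. L2_set v {..<K} \<le> 1}"
  then have v: "\<bar>v l\<bar> \<le> 1" if "l < K" for l
  proof -
    have "L2_set (\<lambda>l. \<bar>v l\<bar>) {..<K} = L2_set v {..<K}" by (simp add: L2_set_def)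
    then show ?thesis
      using member_le_L2_set[of "{..<K}" l "\<lambda>l. \<bar>v l\<bar>"] that \<open>v \<in> _\<close> by auto
  qed
  have "L2_set (\<lambda>k. \<Sum>l<K. B k l * v l) {..<K} \<le> (\<Sum>k<K. \<bar>\<Sum>l<K. B k l * v l\<bar>)"
    by (rule L2_set_le_sum_abs)
  also have "\<dots> \<le> (\<Sum>k<K. \<Sum>l<K. \<bar>B k l\<bar>)"
  proof (intro sum_mono order_trans[OF sum_abs])
    fix k l assume "l \<in> {..<K}"
    then show "\<bar>B k l * v l\<bar> \<le> \<bar>B k l\<bar>"
      using v[of l] by (simp add: abs_mult mult_left_le)
  qed
  finally show "L2_set (\<lambda>k. \<Sum>l<K. B k l * v l) {..<K} \<le> (\<Sum>k<K. \<Sum>l<K. \<bar>B k l\<bar>)" .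
qed

lemma spectral_norm_nonneg: "0 \<le> spectral_norm K B"
proof -
  have "L2_set (\<lambda>k. \<Sum>l<K. B k l * (\<lambda>_. 0) l) {..<K} \<le> spectral_norm K B"
    unfolding spectral_norm_def by (intro cSUP_upper spectral_norm_bdd) (simp add: L2_set_def)
  then show ?thesis by (simp add: L2_set_def)
qed

lemma spectral_norm_L2_set:
  "L2_set (\<lambda>k. \<Sum>l<K. B k l * v l) {..<K} \<le> spectral_norm K B * L2_set v {..<K}"
proof (cases "L2_set v {..<K} = 0")
  case True
  then have "v l = 0" if "l < K" for l using that by (simp add: L2_set_eq_0_iff)
  then have "L2_set (\<lambda>k. \<Sum>l<K. B k l * v l) {..<K} = 0" by (simp add: L2_set_def)
  then show ?thesis using True by simp
next
  case False
  define n where "n = L2_set v {..<K}"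
  have n: "n > 0" using False by (simp add: n_def order_less_le)
  let ?w = "\<lambda>l. v l * (1 / n)"
  have "L2_set ?w {..<K} = L2_set v {..<K} * (1 / n)"
    using n by (subst L2_set_left_distrib) auto
  then have "L2_set ?w {..<K} = 1" using n by (simp add: n_def)
  then have "L2_set (\<lambda>k. \<Sum>l<K. B k l * ?w l) {..<K} \<le> spectral_norm K B"
    unfolding spectral_norm_def by (intro cSUP_upper spectral_norm_bdd) simp
  also have "L2_set (\<lambda>k. \<Sum>l<K. B k l * ?w l) {..<K} = L2_set (\<lambda>k. (\<Sum>l<K. B k l * v l) * (1 / n)) {..<K}"
    by (simp add: sum_divide_distrib)
  also have "\<dots> = L2_set (\<lambda>k. \<Sum>l<K. B k l * v l) {..<K} * (1 / n)"
    using n by (subst L2_set_left_distrib) auto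
  finally show ?thesis using n by (simp add: field_simps n_def)
qed

lemma frob_power2_Basis: "(frob K X)\<^sup>2 = (\<Sum>b\<in>Basis. (L2_set (\<lambda>k. X k \<bullet> b) {..<K})\<^sup>2)"
  for X :: "nat \<Rightarrow> 'z::euclidean_space"
proof -
  have "(frob K X)\<^sup>2 = (\<Sum>k<K. \<Sum>b\<in>Basis. (X k \<bullet> b)\<^sup>2)"
    unfolding sum_norm_power2[symmetric] power2_norm_eq_inner
    by (intro sum.cong refl) (subst euclidean_inner, simp add: power2_eq_square)
  also have "\<dots> = (\<Sum>b\<in>Basis. \<Sum>k<K. (X k \<bullet> b)\<^sup>2)" by (rule sum.swap)
  finally show ?thesis by (simp add: L2_set_def sum_nonneg)
qed

lemma frob_matrix_le:
  fixes X :: "nat \<Rightarrow> 'z::euclidean_space"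
  shows "frob K (\<lambda>k. \<Sum>l<K. B k l *\<^sub>R X l) \<le> spectral_norm K B * frob K X"
proof (rule power2_le_imp_le)
  have "(frob K (\<lambda>k. \<Sum>l<K. B k l *\<^sub>R X l))\<^sup>2
      = (\<Sum>b\<in>Basis. (L2_set (\<lambda>k. \<Sum>l<K. B k l * (X l \<bullet> b)) {..<K})\<^sup>2)"
    unfolding frob_power2_Basis by (simp add: inner_sum_left)
  also have "\<dots> \<le> (\<Sum>b\<in>Basis. (spectral_norm K B * L2_set (\<lambda>l. X l \<bullet> b) {..<K})\<^sup>2)"
    by (intro sum_mono power_mono spectral_norm_L2_set) auto
  also have "\<dots> = (spectral_norm K B * frob K X)\<^sup>2"
    by (simp add: power_mult_distrib frob_power2_Basis sum_distrib_left)
  finally show "(frob K (\<lambda>k. \<Sum>l<K. B k l *\<^sub>R X l))\<^sup>2 \<le> (spectral_norm K B * frob K X)\<^sup>2" .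
qed (simp add: spectral_norm_nonneg frob_nonneg)

lemma mixing_network_sum:
  fixes f :: "nat \<Rightarrow> 'z::real_vector"
  assumes "mixing_network K nb A" "k < K"
  shows "(\<Sum>l\<in>nb k. A k l *\<^sub>R f l) = (\<Sum>l<K. A k l *\<^sub>R f l)"
  using assms by (intro sum.mono_neutral_left) (auto simp: mixing_network_def)

lemma consensus_step:
  fixes X S Y :: "nat \<Rightarrow> 'z::euclidean_space"
  assumes net: "mixing_network K nb A" and K: "1 \<le> K"
    and Y: "\<And>k. k < K \<Longrightarrow> Y k = (\<Sum>l<K. A k l *\<^sub>R (X l + S l))"
  shows "mean K Y = mean K X + mean K S"
    and "frob K (\<lambda>k. Y k - mean K Y)
      \<le> mixing_rate K A * (frob K (\<lambda>k. X k - mean K X) + frob K S)"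
proof -
  have col: "(\<Sum>k<K. A k l) = 1" and row: "(\<Sum>k<K. A l k) = 1" if "l < K" for l
    using net that by (auto simp: mixing_network_def)
  have "(\<Sum>k<K. Y k) = (\<Sum>l<K. \<Sum>k<K. A k l *\<^sub>R (X l + S l))"
    using Y by (subst sum.swap) simp
  also have "\<dots> = (\<Sum>l<K. X l + S l)"
    using col by (simp add: scaleR_sum_left[symmetric])
  finally show m: "mean K Y = mean K X + mean K S"
    by (simp add: mean_def sum.distrib scaleR_add_right)
  have "Y k - mean K Y = (\<Sum>l<K. (A k l - 1 / real K) *\<^sub>R ((X l - mean K X) + S l))" if k: "k < K" for k
  proof -
    have "(\<Sum>l<K. (A k l - 1 / real K) *\<^sub>R ((X l - mean K X) + S l))
        = (\<Sum>l<K. A k l *\<^sub>R (X l + S l)) - (1 / real K) *\<^sub>R (\<Sum>l<K. X l + S l)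
          - (\<Sum>l<K. A k l - 1 / real K) *\<^sub>R mean K X"
      unfolding scaleR_sum_left scaleR_sum_right sum_subtractf[symmetric]
      by (intro sum.cong refl) (simp add: algebra_simps)
    also have "(\<Sum>l<K. A k l - 1 / real K) = 0" using row[OF k] K by (simp add: sum_subtractf)
    also have "(1 / real K) *\<^sub>R (\<Sum>l<K. X l + S l) = mean K Y"
      unfolding m by (simp add: mean_def sum.distrib scaleR_add_right)
    finally show ?thesis using Y[OF k] by simp
  qed
  then have "frob K (\<lambda>k. Y k - mean K Y)
      = frob K (\<lambda>k. \<Sum>l<K. (A k l - 1 / real K) *\<^sub>R ((X l - mean K X) + S l))"
    by (rule frob_cong)
  also have "\<dots> \<le> mixing_rate K A * frob K (\<lambda>l. (X l - mean K X) + S l)"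
    unfolding mixing_rate_def by (rule frob_matrix_le)
  also have "\<dots> \<le> mixing_rate K A * (frob K (\<lambda>k. X k - mean K X) + frob K S)"
    unfolding mixing_rate_def by (intro mult_left_mono frob_triangle spectral_norm_nonneg)
  finally show "frob K (\<lambda>k. Y k - mean K Y)
      \<le> mixing_rate K A * (frob K (\<lambda>k. X k - mean K X) + frob K S)" .
qed

section \<open>Pathwise estimates\<close>

locale dima =
  fixes K N :: nat and nb :: "nat \<Rightarrow> nat set" and A :: "nat \<Rightarrow> nat \<Rightarrow> real"
    and D :: "nat \<Rightarrow> 's measure" and Q :: "nat \<Rightarrow> 'x::euclidean_space \<times> 'y::euclidean_space \<Rightarrow> 's \<Rightarrow> real"
    and L Lh \<sigma> \<sigma>h \<beta> \<eta>x \<eta>y :: real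
  assumes K: "1 \<le> K" and N: "1 \<le> N"
    and L: "0 < L" and Lh: "0 \<le> Lh" and sg: "0 \<le> \<sigma>" and sgh: "0 \<le> \<sigma>h"
    and \<beta>: "0 < \<beta>" "\<beta> < 1" and \<eta>: "0 \<le> \<eta>x" "0 \<le> \<eta>y"
    and smooth: "smooth_objectives K D Q L Lh"
    and oracles: "stochastic_oracles K D Q \<sigma> \<sigma>h"
    and net: "mixing_network K nb A"
begin

definition "p = \<lparr>steps = N, eta_x = \<eta>x, eta_y = \<eta>y, loc_eta_x = \<eta>x / (real N * L),
  loc_eta_y = \<eta>y / (real N * L), mom_beta = \<beta>, corr_gamma = 1\<rparr>"

definition "run z s = dima_run K nb A p Q z s"
definition "Z z s i k = iter (run z s i) k"
definition "W z s i k n = round_local p Q s i (run z s i) k n"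
definition "Wp z s i k n = prev_local (run z s i) k n"
definition "mm z s i k = prev_m (run z s i) k"
definition "uu z s i k = prev_u (run z s i) k"
definition "gQ k z s = grad (\<lambda>z. Q k z s) z"
definition "hQ k z s = hess (\<lambda>z. Q k z s) z"
definition "gJ k z = grad (local_obj D Q k) z"
definition "hJ k z = hess (local_obj D Q k) z"
definition "dir z s i l = (- \<eta>x *\<^sub>R sgn (fst (uu z s (Suc i) l)), \<eta>y *\<^sub>R sgn (snd (uu z s (Suc i) l)))"
definition "V z s i k n = W z s i k n - Wp z s i k n"

definition "lam = mixing_rate K A"
definition "\<eta> = \<eta>x + \<eta>y"

lemma lam: "0 \<le> lam" "lam < 1"
  using net by (auto simp: lam_def mixing_rate_def spectral_norm_nonneg mixing_network_def)

lemma le_div_gap: "0 \<le> x \<Longrightarrow> x \<le> x / (1 - lam)"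
  using lam by (simp add: pos_le_divide_eq mult_left_le)

lemma \<eta>_nonneg: "0 \<le> \<eta>" using \<eta> by (simp add: \<eta>_def)

lemma run_0: "Z z s 0 k = z" "Wp z s 0 k n = z" "mm z s 0 k = gQ k z (s (Init k))"
    "uu z s 0 k = gQ k z (s (Init k))"
  by (simp_all add: Z_def Wp_def mm_def uu_def run_def gQ_def)

lemma W_0: "W z s i k 0 = Z z s i k"
  by (simp add: W_def Z_def round_local_def)

lemma W_Suc: "W z s i k (Suc n) = W z s i k n +
   (- (\<eta>x / (real N * L)) *\<^sub>R sgn (fst (gQ k (W z s i k n) (s (Local k i n)))),
    (\<eta>y / (real N * L)) *\<^sub>R sgn (snd (gQ k (W z s i k n) (s (Local k i n)))))"
  by (simp add: W_def round_local_def Let_def gQ_def p_def prod_eq_iff)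

lemma Wp_Suc: "Wp z s (Suc i) k n = W z s i k n"
  by (simp add: Wp_def W_def run_def dima_round_def Let_def)

lemma mm_Suc: "mm z s (Suc i) k =
    (1 - \<beta>) *\<^sub>R (mm z s i k + mean N (\<lambda>n. hQ k (W z s i k n) (s (Local k i n)) (V z s i k n)))
    + \<beta> *\<^sub>R mean N (\<lambda>n. gQ k (W z s i k n) (s (Local k i n)))"
  by (simp add: mm_def V_def Wp_def W_def run_def dima_round_def Let_def gQ_def hQ_def mean_def
      hvp_def p_def)

lemma uu_Suc_nb: "uu z s (Suc i) k = (\<Sum>l\<in>nb k. A k l *\<^sub>R (uu z s i l + (mm z s (Suc i) l - mm z s i l)))"
  by (simp add: uu_def mm_def run_def dima_round_def Let_def algebra_simps)

lemma uu_Suc: "k < K \<Longrightarrow> uu z s (Suc i) k = (\<Sum>l<K. A k l *\<^sub>R (uu z s i l + (mm z s (Suc i) l - mm z s i l)))"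
  unfolding uu_Suc_nb by (rule mixing_network_sum[OF net])

lemma Z_Suc_nb: "Z z s (Suc i) k = (\<Sum>l\<in>nb k. A k l *\<^sub>R (Z z s i l + dir z s i l))"
  by (simp add: Z_def uu_def run_def dima_round_def Let_def dir_def p_def prod_eq_iff fst_sum snd_sum)

lemma Z_Suc: "k < K \<Longrightarrow> Z z s (Suc i) k = (\<Sum>l<K. A k l *\<^sub>R (Z z s i l + dir z s i l))"
  unfolding Z_Suc_nb by (rule mixing_network_sum[OF net])

lemma norm_triangle3: "norm (a + b + c) \<le> norm a + norm b + norm c"
  and norm_triangle4: "norm (a + b + c + d) \<le> norm a + norm b + norm c + norm d"
  for a b c d :: "'a::real_normed_vector"
  using norm_triangle_ineq[of a b] norm_triangle_ineq[of "a + b" c] norm_triangle_ineq[of "a + b + c" d]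
  by linarith+

lemma norm_sgn_pair_le: "0 \<le> a \<Longrightarrow> 0 \<le> b \<Longrightarrow> norm (- a *\<^sub>R sgn u, b *\<^sub>R sgn v) \<le> a + b"
  for u :: "'u::real_normed_vector" and v :: "'v::real_normed_vector"
  using norm_Pair_le[of "- a *\<^sub>R sgn u" "b *\<^sub>R sgn v"] by (simp add: norm_sgn split: if_splits)

lemma norm_dir: "norm (dir z s i l) \<le> \<eta>"
  unfolding dir_def \<eta>_def using \<eta> by (rule norm_sgn_pair_le)

lemma frob_dir: "frob K (dir z s i) \<le> sqrt (real K) * \<eta>"
  using norm_dir \<eta>_nonneg by (rule frob_le)

definition "zc z s i = mean K (Z z s i)"

lemma zc_0: "zc z s 0 = z" using mean_const[OF K, of z] by (simp add: zc_def run_0 cong: mean_cong)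

lemma zc_Suc: "zc z s (Suc i) = zc z s i + mean K (dir z s i)"
  unfolding zc_def by (rule consensus_step(1)[OF net K Z_Suc])

lemma norm_zc_diff: "norm (zc z s i - z) \<le> real i * \<eta>"
proof (induction i)
  case (Suc i)
  have "norm (mean K (dir z s i)) \<le> \<eta>" by (rule norm_mean_le_const[OF K norm_dir])
  with Suc show ?case
    using norm_triangle_ineq[of "zc z s i - z" "mean K (dir z s i)"]
    by (simp add: zc_Suc algebra_simps)
qed (simp add: zc_0)

lemma Z_dev: "frob K (\<lambda>k. Z z s i k - zc z s i) \<le> sqrt (real K) * \<eta> / (1 - lam)"
proof (induction i)
  case 0
  show ?case
    using lam \<eta>_nonneg by (simp add: run_0 zc_0 frob_def L2_set_def)
next
  case (Suc i)
  have "frob K (\<lambda>k. Z z s (Suc i) k - zc z s (Suc i))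
      \<le> lam * (frob K (\<lambda>k. Z z s i k - zc z s i) + frob K (dir z s i))"
    unfolding zc_def lam_def by (rule consensus_step(2)[OF net K Z_Suc])
  also have "\<dots> \<le> lam * (sqrt (real K) * \<eta> / (1 - lam) + sqrt (real K) * \<eta>)"
    using Suc frob_dir lam by (intro mult_left_mono add_mono)
  also have "\<dots> = (lam * (2 - lam)) * (sqrt (real K) * \<eta> / (1 - lam))"
    using lam by (simp add: field_simps)
  also have "\<dots> \<le> 1 * (sqrt (real K) * \<eta> / (1 - lam))"
  proof (rule mult_right_mono)
    show "lam * (2 - lam) \<le> 1" using zero_le_power2[of "1 - lam"] by (simp add: power2_eq_square algebra_simps)
  qed (use lam \<eta>_nonneg in auto)
  finally show ?case by simp
qed

lemma Z_diff: "frob K (\<lambda>k. Z z s (Suc i) k - Z z s i k) \<le> 3 * sqrt (real K) * \<eta> / (1 - lam)"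
proof -
  have "frob K (\<lambda>k. Z z s (Suc i) k - Z z s i k)
      = frob K (\<lambda>k. ((Z z s (Suc i) k - zc z s (Suc i)) - (Z z s i k - zc z s i)) + mean K (dir z s i))"
    by (simp add: zc_Suc)
  also have "\<dots> \<le> frob K (\<lambda>k. (Z z s (Suc i) k - zc z s (Suc i)) - (Z z s i k - zc z s i))
      + frob K (\<lambda>k. mean K (dir z s i))"
    by (rule frob_triangle)
  also have "\<dots> \<le> (sqrt (real K) * \<eta> / (1 - lam) + sqrt (real K) * \<eta> / (1 - lam)) + sqrt (real K) * \<eta>"
    using norm_mean_le_const[OF K norm_dir] \<eta>_nonneg
    by (intro add_mono order_trans[OF frob_triangle_diff] Z_dev frob_le)
  finally have "frob K (\<lambda>k. Z z s (Suc i) k - Z z s i k)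
      \<le> (sqrt (real K) * \<eta> / (1 - lam) + sqrt (real K) * \<eta> / (1 - lam)) + sqrt (real K) * \<eta>" .
  moreover have "sqrt (real K) * \<eta> \<le> sqrt (real K) * \<eta> / (1 - lam)"
    using lam \<eta>_nonneg by (simp add: pos_le_divide_eq mult_left_le)
  ultimately have "frob K (\<lambda>k. Z z s (Suc i) k - Z z s i k) \<le> 3 * (sqrt (real K) * \<eta> / (1 - lam))"
    by linarith
  then show ?thesis by (simp add: mult.assoc)
qed

lemma W_drift: "n \<le> N \<Longrightarrow> norm (W z s i k n - Z z s i k) \<le> \<eta> / L"
proof -
  have *: "norm (W z s i k n - Z z s i k) \<le> real n * (\<eta> / (real N * L))" for n
  proof (induction n)
    case (Suc n)
    define w where "w = W z s i k (Suc n) - W z s i k n"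
    have "norm w \<le> \<eta>x / (real N * L) + \<eta>y / (real N * L)"
      unfolding w_def W_Suc add_diff_cancel_left' using \<eta> L by (intro norm_sgn_pair_le) auto
    then have "norm w \<le> \<eta> / (real N * L)" by (simp add: \<eta>_def add_divide_distrib)
    moreover have "W z s i k (Suc n) - Z z s i k = (W z s i k n - Z z s i k) + w"
      by (simp add: w_def)
    ultimately show ?case
      using Suc norm_triangle_ineq[of "W z s i k n - Z z s i k" w]
      by (simp only: of_nat_Suc distrib_right mult_1)
  qed (simp add: W_0)
  assume "n \<le> N"
  then have "real n * (\<eta> / (real N * L)) \<le> real N * (\<eta> / (real N * L))"
    using \<eta>_nonneg L by (intro mult_right_mono) auto
  also have "\<dots> = \<eta> / L" using N by simp
  finally show ?thesis using *[of n] by linarith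
qed

definition "Dd = (2 / L + 3) * \<eta> / (1 - lam)"

lemma Dd_nonneg: "0 \<le> Dd"
  using L lam \<eta>_nonneg by (simp add: Dd_def)

lemma frob_V: "n < N \<Longrightarrow> frob K (\<lambda>k. V z s i k n) \<le> sqrt (real K) * Dd"
proof -
  assume n: "n < N"
  have drift: "frob K (\<lambda>k. W z s i k n - Z z s i k) \<le> sqrt (real K) * (\<eta> / L)" for i
    using W_drift n \<eta>_nonneg L by (intro frob_le) auto
  have "frob K (\<lambda>k. V z s i k n) \<le> 2 * (sqrt (real K) * (\<eta> / L)) + 3 * sqrt (real K) * \<eta> / (1 - lam)"
  proof (cases i)
    case 0
    have "frob K (\<lambda>k. V z s i k n) = frob K (\<lambda>k. W z s i k n - Z z s i k)"
      by (simp add: V_def run_0 0)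
    also have "\<dots> \<le> sqrt (real K) * (\<eta> / L)" by (rule drift)
    also have "\<dots> \<le> 2 * (sqrt (real K) * (\<eta> / L)) + 3 * sqrt (real K) * \<eta> / (1 - lam)"
    proof -
      have "0 \<le> sqrt (real K) * (\<eta> / L)" "0 \<le> 3 * sqrt (real K) * \<eta> / (1 - lam)"
        using \<eta>_nonneg L lam by auto
      then show ?thesis by linarith
    qed
    finally show ?thesis .
  next
    case (Suc j)
    have "frob K (\<lambda>k. V z s i k n) = frob K (\<lambda>k. ((W z s (Suc j) k n - Z z s (Suc j) k)
        - (W z s j k n - Z z s j k)) + (Z z s (Suc j) k - Z z s j k))"
      by (simp add: V_def Wp_Suc Suc)
    also have "\<dots> \<le> (sqrt (real K) * (\<eta> / L) + sqrt (real K) * (\<eta> / L)) + 3 * sqrt (real K) * \<eta> / (1 - lam)"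
      by (intro order_trans[OF frob_triangle] order_trans[OF frob_triangle_diff] add_mono drift Z_diff)
    finally show ?thesis by (simp only: mult_2)
  qed
  moreover have "2 * (sqrt (real K) * (\<eta> / L)) \<le> 2 * (sqrt (real K) * (\<eta> / L)) / (1 - lam)"
    using \<eta>_nonneg L by (intro le_div_gap) auto
  moreover have "sqrt (real K) * Dd
      = 2 * (sqrt (real K) * (\<eta> / L)) / (1 - lam) + 3 * sqrt (real K) * \<eta> / (1 - lam)"
    using lam L by (simp add: Dd_def divide_simps) (simp add: algebra_simps)
  ultimately show ?thesis by linarith
qed

lemma norm_V: "k < K \<Longrightarrow> n < N \<Longrightarrow> norm (V z s i k n) \<le> sqrt (real K) * Dd"
  using order_trans[OF norm_le_frob frob_V] .

lemma mean_V_power2: "n < N \<Longrightarrow> mean K (\<lambda>k. (norm (V z s i k n))\<^sup>2) \<le> Dd\<^sup>2"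
proof -
  assume n: "n < N"
  have "(frob K (\<lambda>k. V z s i k n))\<^sup>2 \<le> (sqrt (real K) * Dd)\<^sup>2"
    by (intro power_mono frob_V n frob_nonneg)
  then show ?thesis
    using K by (simp add: mean_def sum_norm_power2 power_mult_distrib field_simps)
qed

lemma smooth': "k < K \<Longrightarrow> twice_differentiable (local_obj D Q k)"
  and Lip_gJ: "k < K \<Longrightarrow> norm (gJ k z1 - gJ k z2) \<le> L * norm (z1 - z2)"
  and Lip_hJ: "k < K \<Longrightarrow> norm (hJ k z1 - hJ k z2) \<le> Lh * norm (z1 - z2)"
  using smooth unfolding smooth_objectives_def gJ_def hJ_def by blast+

lemma lobj_diff: "k < K \<Longrightarrow> GDERIV (local_obj D Q k) z :> gJ k z"
  and hJ: "k < K \<Longrightarrow> (gJ k has_derivative blinfun_apply (hJ k z)) (at z)"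
  unfolding gJ_def[abs_def] hJ_def
  by (rule twice_differentiable_grad twice_differentiable_hess; rule smooth'; assumption)+

definition "J = global_obj K D Q"

lemma GDERIV_J: "GDERIV J z :> mean K (\<lambda>k. gJ k z)"
  unfolding J_def global_obj_def[abs_def] mean_def
  by (intro GDERIV_cmult GDERIV_sum lobj_diff) auto

lemma grad_J: "grad J z = mean K (\<lambda>k. gJ k z)"
  by (rule GDERIV_imp_grad[OF GDERIV_J])

lemma Lip_J: "norm (grad J z1 - grad J z2) \<le> L * norm (z1 - z2)"
  unfolding grad_J mean_diff[symmetric] by (intro norm_mean_le_const K Lip_gJ)

definition "gp z s i k = mean N (\<lambda>n. gJ k (Wp z s i k n))"
definition "ee z s i k = mm z s i k - gp z s i k"
definition "bias z s i k = mean N (\<lambda>n. gJ k (Wp z s i k n) - gJ k (W z s i k n) + hJ k (W z s i k n) (V z s i k n))"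
definition "zeta z s i k n =
  (1 - \<beta>) *\<^sub>R ((hQ k (W z s i k n) (s (Local k i n)) - hJ k (W z s i k n)) (V z s i k n))
  + \<beta> *\<^sub>R (gQ k (W z s i k n) (s (Local k i n)) - gJ k (W z s i k n))"

lemma ee_Suc: "ee z s (Suc i) k = (1 - \<beta>) *\<^sub>R ee z s i k + (1 - \<beta>) *\<^sub>R bias z s i k + mean N (zeta z s i k)"
  unfolding ee_def bias_def zeta_def[abs_def] gp_def mm_Suc Wp_Suc minus_blinfun.rep_eq
    mean_add mean_diff mean_scaleR
  by (simp add: algebra_simps)

lemma norm_bias_le: "k < K \<Longrightarrow> norm (bias z s i k) \<le> Lh * mean N (\<lambda>n. (norm (V z s i k n))\<^sup>2)"
proof -
  assume k: "k < K"
  have "norm (bias z s i k) \<le> mean N (\<lambda>n. Lh * (norm (V z s i k n))\<^sup>2)"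
    unfolding bias_def V_def
    by (intro order_trans[OF norm_mean_le] mean_mono
        Lipschitz_hessian_bound[OF hJ Lip_hJ Lh] k)
  also have "\<dots> = Lh * mean N (\<lambda>n. (norm (V z s i k n))\<^sup>2)"
    using mean_scaleR[of N Lh "\<lambda>n. (norm (V z s i k n))\<^sup>2"] by simp
  finally show ?thesis .
qed

lemma norm_bias: "k < K \<Longrightarrow> norm (bias z s i k) \<le> Lh * (real K * Dd\<^sup>2)"
proof -
  assume k: "k < K"
  have "(norm (V z s i k n))\<^sup>2 \<le> real K * Dd\<^sup>2" if "n < N" for n
    using power_mono[OF norm_V[OF k that, of z s i], of 2] by (simp add: power_mult_distrib)
  then show ?thesis
    using norm_bias_le[OF k, of z s i] mult_left_mono[OF mean_le[OF N, of "\<lambda>n. (norm (V z s i k n))\<^sup>2"] Lh]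
    by (meson order_trans)
qed

lemma norm_mean_bias: "norm (mean K (bias z s i)) \<le> Lh * Dd\<^sup>2"
proof -
  have "norm (mean K (bias z s i)) \<le> mean K (\<lambda>k. Lh * mean N (\<lambda>n. (norm (V z s i k n))\<^sup>2))"
    by (intro order_trans[OF norm_mean_le] mean_mono norm_bias_le)
  also have "\<dots> = Lh * mean N (\<lambda>n. mean K (\<lambda>k. (norm (V z s i k n))\<^sup>2))"
    unfolding mean_def scaleR_sum_right sum_distrib_left
    by (subst sum.swap) (simp add: mult_ac)
  also have "\<dots> \<le> Lh * Dd\<^sup>2"
    by (intro mult_left_mono Lh mean_le N mean_V_power2)
  finally show ?thesis .
qed

lemma norm_gp_diff: "k < K \<Longrightarrow> norm (gp z s (Suc i) k - gp z s i k) \<le> L * (sqrt (real K) * Dd)"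
  unfolding gp_def Wp_Suc mean_diff[symmetric]
  using L norm_V by (intro norm_mean_le_const N order_trans[OF Lip_gJ]) (auto simp: V_def intro!: mult_left_mono)

lemma norm_mm_diff:
  assumes k: "k < K"
  shows "norm (mm z s (Suc i) k - mm z s i k)
    \<le> \<beta> * norm (ee z s i k) + Lh * (real K * Dd\<^sup>2) + norm (mean N (zeta z s i k)) + L * (sqrt (real K) * Dd)"
proof -
  have eq: "mm z s (Suc i) k - mm z s i k = (- \<beta>) *\<^sub>R ee z s i k + (1 - \<beta>) *\<^sub>R bias z s i k
      + mean N (zeta z s i k) + (gp z s (Suc i) k - gp z s i k)"
    using ee_Suc[of z s i k] by (simp add: ee_def algebra_simps)
  have "norm (mm z s (Suc i) k - mm z s i k) \<le> norm ((- \<beta>) *\<^sub>R ee z s i k)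
      + norm ((1 - \<beta>) *\<^sub>R bias z s i k)
      + norm (mean N (zeta z s i k)) + norm (gp z s (Suc i) k - gp z s i k)"
    unfolding eq by (rule norm_triangle4)
  moreover have "norm ((1 - \<beta>) *\<^sub>R bias z s i k) \<le> 1 * norm (bias z s i k)"
    unfolding norm_scaleR using \<beta> by (intro mult_right_mono) auto
  ultimately show ?thesis
    using norm_bias[OF k, of z s i] norm_gp_diff[OF k, of z s i] \<beta> by simp
qed

lemma norm_ee_Suc:
  assumes k: "k < K"
  shows "norm (ee z s (Suc i) k)
    \<le> (1 - \<beta>) * norm (ee z s i k) + Lh * (real K * Dd\<^sup>2) + norm (mean N (zeta z s i k))"
proof -
  have "norm (ee z s (Suc i) k) \<le> norm ((1 - \<beta>) *\<^sub>R ee z s i k) + norm ((1 - \<beta>) *\<^sub>R bias z s i k)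
      + norm (mean N (zeta z s i k))"
    unfolding ee_Suc by (rule norm_triangle3)
  moreover have "norm ((1 - \<beta>) *\<^sub>R bias z s i k) \<le> 1 * norm (bias z s i k)"
    unfolding norm_scaleR using \<beta> by (intro mult_right_mono) auto
  ultimately show ?thesis
    using norm_bias[OF k, of z s i] \<beta> by simp
qed

lemma mean_uu: "mean K (uu z s i) = mean K (mm z s i)"
proof (induction i)
  case (Suc i)
  have "mean K (uu z s (Suc i)) = mean K (uu z s i) + mean K (\<lambda>k. mm z s (Suc i) k - mm z s i k)"
    by (rule consensus_step(1)[OF net K uu_Suc])
  then show ?case by (simp add: Suc mean_diff)
qed (simp add: run_0)

definition "udev z s i = frob K (\<lambda>k. uu z s i k - mean K (mm z s i))"

lemma udev_Suc: "udev z s (Suc i) \<le> lam * (udev z s i + (\<Sum>k<K. norm (mm z s (Suc i) k - mm z s i k)))"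
proof -
  have "udev z s (Suc i) \<le> lam * (udev z s i + frob K (\<lambda>k. mm z s (Suc i) k - mm z s i k))"
    unfolding udev_def lam_def mean_uu[symmetric] by (rule consensus_step(2)[OF net K uu_Suc])
  also have "\<dots> \<le> lam * (udev z s i + (\<Sum>k<K. norm (mm z s (Suc i) k - mm z s i k)))"
    using lam by (intro mult_left_mono add_left_mono frob_le_sum)
  finally show ?thesis .
qed

lemma norm_mean_gp: "norm (mean K (gp z s (Suc i)) - grad J (zc z s i)) \<le> L * (\<eta> / L + sqrt (real K) * \<eta> / (1 - lam))"
proof -
  have *: "norm (gp z s (Suc i) k - gJ k (zc z s i)) \<le> L * (\<eta> / L + sqrt (real K) * \<eta> / (1 - lam))"
    if k: "k < K" for k
  proof -
    have eq: "gp z s (Suc i) k - gJ k (zc z s i) = mean N (\<lambda>n. gJ k (W z s i k n) - gJ k (zc z s i))"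
      by (simp add: gp_def Wp_Suc mean_diff mean_const[OF N])
    show ?thesis unfolding eq
    proof (rule norm_mean_le_const[OF N])
      fix n assume "n < N"
      then have 1: "norm (W z s i k n - Z z s i k) \<le> \<eta> / L" using W_drift by simp
      have 2: "norm (Z z s i k - zc z s i) \<le> sqrt (real K) * \<eta> / (1 - lam)"
        using order_trans[OF norm_le_frob Z_dev, OF k] .
      have "norm (W z s i k n - zc z s i) \<le> \<eta> / L + sqrt (real K) * \<eta> / (1 - lam)"
        using 1 2 norm_triangle_ineq[of "W z s i k n - Z z s i k" "Z z s i k - zc z s i"] by simp
      then show "norm (gJ k (W z s i k n) - gJ k (zc z s i)) \<le> L * (\<eta> / L + sqrt (real K) * \<eta> / (1 - lam))"
        using Lip_gJ[OF k, of "W z s i k n" "zc z s i"] mult_left_mono[of "norm (W z s i k n - zc z s i)" _ L] L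
        by (meson less_imp_le order_trans)
    qed
  qed
  show ?thesis
    unfolding grad_J mean_diff[symmetric] by (rule norm_mean_le_const[OF K *])
qed

definition "uerr z s i = (1 / real K) * (\<Sum>k<K. norm (uu z s (Suc i) k - grad J (zc z s i)))"

lemma uerr_le: "uerr z s i \<le> udev z s (Suc i) + norm (mean K (ee z s (Suc i)))
    + L * (\<eta> / L + sqrt (real K) * \<eta> / (1 - lam))"
proof -
  have "mean K (\<lambda>k. norm (uu z s (Suc i) k - grad J (zc z s i))) \<le> udev z s (Suc i)
    + norm (mean K (ee z s (Suc i))) + L * (\<eta> / L + sqrt (real K) * \<eta> / (1 - lam))"
  proof (rule mean_le[OF K])
    fix k assume k: "k < K"
    have eq: "uu z s (Suc i) k - grad J (zc z s i) = (uu z s (Suc i) k - mean K (mm z s (Suc i)))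
      + mean K (ee z s (Suc i)) + (mean K (gp z s (Suc i)) - grad J (zc z s i))"
      by (simp add: ee_def[abs_def] mean_diff)
    have "norm (uu z s (Suc i) k - grad J (zc z s i)) \<le> norm (uu z s (Suc i) k - mean K (mm z s (Suc i)))
      + norm (mean K (ee z s (Suc i))) + norm (mean K (gp z s (Suc i)) - grad J (zc z s i))"
      unfolding eq by (rule norm_triangle3)
    moreover have "norm (uu z s (Suc i) k - mean K (mm z s (Suc i))) \<le> udev z s (Suc i)"
      unfolding udev_def by (rule norm_le_frob[OF k])
    ultimately show "norm (uu z s (Suc i) k - grad J (zc z s i)) \<le> udev z s (Suc i)
      + norm (mean K (ee z s (Suc i))) + L * (\<eta> / L + sqrt (real K) * \<eta> / (1 - lam))"
      using norm_mean_gp[of z s i] by linarith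
  qed
  then show ?thesis by (simp add: uerr_def mean_def)
qed

text \<open>The part of the averaged momentum error that is driven by the sampling noise alone.\<close>

primrec noise :: "'x \<times> 'y \<Rightarrow> (sample_idx \<Rightarrow> 's) \<Rightarrow> nat \<Rightarrow> 'x \<times> 'y" where
  "noise z s 0 = 0"
| "noise z s (Suc i) = (1 - \<beta>) *\<^sub>R noise z s i + mean K (\<lambda>k. mean N (zeta z s i k))"

lemma mean_ee_le: "norm (mean K (ee z s i))
    \<le> (1 - \<beta>) ^ i * norm (mean K (ee z s 0)) + Lh * Dd\<^sup>2 / \<beta> + norm (noise z s i)"
proof -
  have "norm (mean K (ee z s i) - noise z s i) \<le> (1 - \<beta>) ^ i * norm (mean K (ee z s 0)) + Lh * Dd\<^sup>2 / \<beta>"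
  proof (induction i)
    case (Suc i)
    let ?q = "Lh * Dd\<^sup>2"
    have q: "0 \<le> ?q" using Lh by simp
    have eq: "mean K (ee z s (Suc i)) - noise z s (Suc i)
        = (1 - \<beta>) *\<^sub>R (mean K (ee z s i) - noise z s i) + (1 - \<beta>) *\<^sub>R mean K (bias z s i)"
      by (simp only: ee_Suc[abs_def] mean_add mean_scaleR noise.simps) (simp add: algebra_simps)
    have "norm (mean K (ee z s (Suc i)) - noise z s (Suc i)) \<le> (1 - \<beta>) * norm (mean K (ee z s i) - noise z s i) + (1 - \<beta>) * norm (mean K (bias z s i))"
      unfolding eq using \<beta> by (intro order_trans[OF norm_triangle_ineq]) simp
    also have "\<dots> \<le> (1 - \<beta>) * ((1 - \<beta>) ^ i * norm (mean K (ee z s 0)) + ?q / \<beta>) + (1 - \<beta>) * ?q"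
      using Suc norm_mean_bias \<beta> by (intro add_mono mult_left_mono) auto
    also have "\<dots> = (1 - \<beta>) ^ Suc i * norm (mean K (ee z s 0)) + (1 - \<beta>\<^sup>2) * (?q / \<beta>)"
      using \<beta> by (simp add: field_simps power2_eq_square)
    also have "\<dots> \<le> (1 - \<beta>) ^ Suc i * norm (mean K (ee z s 0)) + 1 * (?q / \<beta>)"
      using \<beta> q by (intro add_mono mult_right_mono order_refl) auto
    finally show ?case by simp
  qed (use \<beta> Lh in simp)
  then show ?thesis
    using norm_triangle_sub[of "mean K (ee z s i)" "noise z s i"] by linarith
qed

end

section \<open>Measurability\<close>

lemma measurable_compose_Caratheodory:
  fixes f :: "'z::{metric_space, second_countable_topology} \<Rightarrow> 's \<Rightarrow> 'b::metric_space"
  assumes f: "\<And>z. f z \<in> borel_measurable D"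
    and cont: "\<And>s. s \<in> space D \<Longrightarrow> continuous_on UNIV (\<lambda>z. f z s)"
    and Z: "Z \<in> borel_measurable M" and X: "X \<in> measurable M D"
  shows "(\<lambda>w. f (Z w) (X w)) \<in> borel_measurable M"
proof -
  obtain F where F: "\<And>i. simple_function M (F i)"
    and lim: "\<And>w. w \<in> space M \<Longrightarrow> (\<lambda>i. F i w) \<longlonglongrightarrow> Z w"
    using borel_measurable_implies_sequence_metric[OF Z, of undefined] by blast
  show ?thesis
  proof (rule borel_measurable_LIMSEQ_metric)
    fix i
    have "F i \<in> measurable M (count_space (F i ` space M))"
      using F[of i] by (subst measurable_count_space_eq2) (auto simp: simple_function_def)
    then show "(\<lambda>w. f (F i w) (X w)) \<in> borel_measurable M"
      using F[of i] measurable_compose[OF X f]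
      by (intro measurable_compose_countable'[where g="F i" and f="\<lambda>z w. f z (X w)"])
        (auto simp: simple_function_def intro: countable_finite)
  next
    fix w assume "w \<in> space M"
    then show "(\<lambda>i. f (F i w) (X w)) \<longlonglongrightarrow> f (Z w) (X w)"
      using cont[of "X w"] lim measurable_space[OF X]
      by (intro continuous_on_tendsto_compose[of UNIV "\<lambda>z. f z (X w)"]) auto
  qed
qed

lemma borel_measurable_sgn_euclidean[measurable (raw)]:
  fixes f :: "'a \<Rightarrow> 'b::euclidean_space"
  assumes [measurable]: "f \<in> borel_measurable M"
  shows "(\<lambda>w. sgn (f w)) \<in> borel_measurable M"
  unfolding sgn_div_norm by measurable

lemma borel_measurable_fst_euclidean[measurable (raw)]:
  "f \<in> borel_measurable M \<Longrightarrow> (\<lambda>w. fst (f w)) \<in> borel_measurable M"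
  and borel_measurable_snd_euclidean[measurable (raw)]:
  "f \<in> borel_measurable M \<Longrightarrow> (\<lambda>w. snd (f w)) \<in> borel_measurable M"
  for f :: "'a \<Rightarrow> 'x::euclidean_space \<times> 'y::euclidean_space"
  by (rule measurable_compose[where g=fst] measurable_compose[where g=snd], assumption,
      intro borel_measurable_continuous_onI continuous_intros)+

lemma borel_measurable_mean[measurable (raw)]:
  fixes f :: "nat \<Rightarrow> 'a \<Rightarrow> 'b::euclidean_space"
  assumes [measurable]: "\<And>k. k < K \<Longrightarrow> f k \<in> borel_measurable M"
  shows "(\<lambda>w. mean K (\<lambda>k. f k w)) \<in> borel_measurable M"
  unfolding mean_def by measurable

context dima
begin

lemma stoch_moments:
  assumes "k < K"
  shows "prob_space (D k)"
    and "s \<in> space (D k) \<Longrightarrow> twice_differentiable (\<lambda>z. Q k z s)"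
    and "integrable (D k) (\<lambda>s. gQ k z s)" and "(\<integral>s. gQ k z s \<partial>D k) = gJ k z"
    and "integrable (D k) (\<lambda>s. hQ k z s)" and "(\<integral>s. hQ k z s \<partial>D k) = hJ k z"
    and "integrable (D k) (\<lambda>s. (norm (gQ k z s - gJ k z))\<^sup>2)"
    and "(\<integral>s. (norm (gQ k z s - gJ k z))\<^sup>2 \<partial>D k) \<le> \<sigma>\<^sup>2"
    and "integrable (D k) (\<lambda>s. (norm (hQ k z s - hJ k z))\<^sup>2)"
    and "(\<integral>s. (norm (hQ k z s - hJ k z))\<^sup>2 \<partial>D k) \<le> \<sigma>h\<^sup>2"
  using oracles assms unfolding stochastic_oracles_def gQ_def gJ_def hQ_def hJ_def by blast+

lemma hQ: "k < K \<Longrightarrow> s \<in> space (D k) \<Longrightarrow>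
    ((\<lambda>z. gQ k z s) has_derivative blinfun_apply (hQ k z s)) (at z)"
  using twice_differentiable_hess[OF stoch_moments(2)] unfolding gQ_def[abs_def] hQ_def by blast

lemma measurable_gQ:
  assumes "k < K" "Z' \<in> borel_measurable M" "X \<in> measurable M (D k)"
  shows "(\<lambda>w. gQ k (Z' w) (X w)) \<in> borel_measurable M"
proof (rule measurable_compose_Caratheodory[OF _ _ assms(2,3)])
  show "(\<lambda>s. gQ k z s) \<in> borel_measurable (D k)" for z
    using stoch_moments(3)[OF assms(1)] by (rule borel_measurable_integrable)
  show "continuous_on UNIV (\<lambda>z. gQ k z s)" if "s \<in> space (D k)" for s
    using hQ[OF assms(1) that] by (meson continuous_at_imp_continuous_on has_derivative_continuous)
qed

lemma measurable_hQ:
  assumes k: "k < K" and [measurable]: "Z' \<in> borel_measurable M" "V' \<in> borel_measurable M"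
    and X: "X \<in> measurable M (D k)"
  shows "(\<lambda>w. hQ k (Z' w) (X w) (V' w)) \<in> borel_measurable M"
proof (rule borel_measurable_LIMSEQ_metric)
  have [measurable]: "(\<lambda>w. gQ k (Z' w + (1 / real (Suc n)) *\<^sub>R V' w) (X w)) \<in> borel_measurable M"
    "(\<lambda>w. gQ k (Z' w) (X w)) \<in> borel_measurable M" for n
    by (intro measurable_gQ k X; measurable)+
  show "(\<lambda>w. real (Suc n) *\<^sub>R (gQ k (Z' w + (1 / real (Suc n)) *\<^sub>R V' w) (X w) - gQ k (Z' w) (X w)))
      \<in> borel_measurable M" for n by measurable
  show "(\<lambda>n. real (Suc n) *\<^sub>R (gQ k (Z' w + (1 / real (Suc n)) *\<^sub>R V' w) (X w) - gQ k (Z' w) (X w)))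
      \<longlonglongrightarrow> hQ k (Z' w) (X w) (V' w)" if "w \<in> space M" for w
    using measurable_space[OF X that] by (intro has_derivative_imp_sequential_limit hQ k)
qed

lemma measurable_gJ[measurable (raw)]:
  assumes "k < K" "Z' \<in> borel_measurable M"
  shows "(\<lambda>w. gJ k (Z' w)) \<in> borel_measurable M"
  using hJ[OF assms(1)]
  by (intro measurable_compose[OF assms(2)] borel_measurable_continuous_onI)
    (meson continuous_at_imp_continuous_on has_derivative_continuous)

lemma measurable_hJ[measurable (raw)]:
  assumes k[measurable]: "k < K" and [measurable]: "Z' \<in> borel_measurable M" "V' \<in> borel_measurable M"
  shows "(\<lambda>w. hJ k (Z' w) (V' w)) \<in> borel_measurable M"
proof (rule borel_measurable_LIMSEQ_metric)
  show "(\<lambda>w. real (Suc n) *\<^sub>R (gJ k (Z' w + (1 / real (Suc n)) *\<^sub>R V' w) - gJ k (Z' w)))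
      \<in> borel_measurable M" for n by measurable
  show "(\<lambda>n. real (Suc n) *\<^sub>R (gJ k (Z' w + (1 / real (Suc n)) *\<^sub>R V' w) - gJ k (Z' w)))
      \<longlonglongrightarrow> hJ k (Z' w) (V' w)" for w
    by (intro has_derivative_imp_sequential_limit hJ k)
qed

end

locale dima_measurable = dima K N nb A D Q L Lh \<sigma> \<sigma>h \<beta> \<eta>x \<eta>y
  for K N nb A and D :: "nat \<Rightarrow> 's measure"
    and Q :: "nat \<Rightarrow> 'x::euclidean_space \<times> 'y::euclidean_space \<Rightarrow> 's \<Rightarrow> real"
    and L Lh \<sigma> \<sigma>h \<beta> \<eta>x \<eta>y +
  fixes M :: "'w measure" and z0 :: "'w \<Rightarrow> 'x \<times> 'y" and \<xi> :: "sample_idx \<Rightarrow> 'w \<Rightarrow> 's"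
  assumes z0[measurable]: "z0 \<in> borel_measurable M"
    and \<xi>: "\<And>j. j \<in> sample_idxs K N \<Longrightarrow> \<xi> j \<in> measurable M (D (agent_of j))"
begin

abbreviation "samp w \<equiv> (\<lambda>j. \<xi> j w)"

lemma \<xi>_Init: "k < K \<Longrightarrow> \<xi> (Init k) \<in> measurable M (D k)"
  using \<xi>[of "Init k"] by (auto simp: sample_idxs_def)

lemma \<xi>_Local: "k < K \<Longrightarrow> n < N \<Longrightarrow> \<xi> (Local k i n) \<in> measurable M (D k)"
  using \<xi>[of "Local k i n"] by (auto simp: sample_idxs_def)

lemma measurable_W_of_Z:
  assumes k: "k < K" and [measurable]: "(\<lambda>w. Z (z0 w) (samp w) i k) \<in> borel_measurable M" and "n \<le> N"
  shows "(\<lambda>w. W (z0 w) (samp w) i k n) \<in> borel_measurable M"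
  using \<open>n \<le> N\<close>
proof (induction n)
  case (Suc n)
  then have [measurable]: "(\<lambda>w. W (z0 w) (samp w) i k n) \<in> borel_measurable M" by simp
  have [measurable]: "(\<lambda>w. gQ k (W (z0 w) (samp w) i k n) (\<xi> (Local k i n) w)) \<in> borel_measurable M"
    using Suc.prems by (intro measurable_gQ k \<xi>_Local) auto
  show ?case unfolding W_Suc by measurable
qed (simp add: W_0)

lemma measurable_state:
  "(\<forall>k<K. (\<lambda>w. Z (z0 w) (samp w) i k) \<in> borel_measurable M
    \<and> (\<lambda>w. mm (z0 w) (samp w) i k) \<in> borel_measurable M
    \<and> (\<lambda>w. uu (z0 w) (samp w) i k) \<in> borel_measurable M
    \<and> (\<forall>n<N. (\<lambda>w. Wp (z0 w) (samp w) i k n) \<in> borel_measurable M))"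
proof (induction i)
  case 0
  then show ?case
    unfolding run_0 using z0 \<xi>_Init measurable_gQ[OF _ z0] by auto
next
  case (Suc i)
  have [measurable]: "(\<lambda>w. Z (z0 w) (samp w) i k) \<in> borel_measurable M"
    "(\<lambda>w. mm (z0 w) (samp w) i k) \<in> borel_measurable M"
    "(\<lambda>w. uu (z0 w) (samp w) i k) \<in> borel_measurable M" if "k < K" for k
    using Suc that by auto
  have [measurable]: "(\<lambda>w. Wp (z0 w) (samp w) i k n) \<in> borel_measurable M" if "k < K" "n < N" for k n
    using Suc that by auto
  have [measurable]: "(\<lambda>w. W (z0 w) (samp w) i k n) \<in> borel_measurable M" if "k < K" "n < N" for k n
    using that by (intro measurable_W_of_Z) auto
  have [measurable]: "(\<lambda>w. V (z0 w) (samp w) i k n) \<in> borel_measurable M" if "k < K" "n < N" for k n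
    unfolding V_def using that by measurable
  have [measurable]: "(\<lambda>w. gQ k (W (z0 w) (samp w) i k n) (\<xi> (Local k i n) w)) \<in> borel_measurable M"
    "(\<lambda>w. hQ k (W (z0 w) (samp w) i k n) (\<xi> (Local k i n) w) (V (z0 w) (samp w) i k n)) \<in> borel_measurable M"
    if "k < K" "n < N" for k n
    using that by (intro measurable_gQ measurable_hQ \<xi>_Local; measurable)+
  have mm[measurable]: "(\<lambda>w. mm (z0 w) (samp w) (Suc i) k) \<in> borel_measurable M" if [measurable]: "k < K" for k
    unfolding mm_Suc by measurable
  have uu[measurable]: "(\<lambda>w. uu (z0 w) (samp w) (Suc i) k) \<in> borel_measurable M" if [measurable]: "k < K" for k
    unfolding uu_Suc[OF that] by measurable
  have Z: "(\<lambda>w. Z (z0 w) (samp w) (Suc i) k) \<in> borel_measurable M" if [measurable]: "k < K" for k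
    unfolding Z_Suc[OF that] dir_def by measurable
  show ?case
    using mm uu Z measurable_W_of_Z unfolding Wp_Suc
    using \<open>\<And>n k. k < K \<Longrightarrow> n < N \<Longrightarrow> (\<lambda>w. W (z0 w) (samp w) i k n) \<in> borel_measurable M\<close> by blast
qed

lemma measurable_run[measurable]:
  "k < K \<Longrightarrow> (\<lambda>w. Z (z0 w) (samp w) i k) \<in> borel_measurable M"
  "k < K \<Longrightarrow> (\<lambda>w. mm (z0 w) (samp w) i k) \<in> borel_measurable M"
  "k < K \<Longrightarrow> (\<lambda>w. uu (z0 w) (samp w) i k) \<in> borel_measurable M"
  "k < K \<Longrightarrow> n < N \<Longrightarrow> (\<lambda>w. Wp (z0 w) (samp w) i k n) \<in> borel_measurable M"
  "k < K \<Longrightarrow> n < N \<Longrightarrow> (\<lambda>w. W (z0 w) (samp w) i k n) \<in> borel_measurable M"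
  using measurable_state measurable_W_of_Z by auto

lemma measurable_V[measurable]:
  "k < K \<Longrightarrow> n < N \<Longrightarrow> (\<lambda>w. V (z0 w) (samp w) i k n) \<in> borel_measurable M"
  unfolding V_def by measurable

lemma measurable_gp_ee[measurable]:
  "k < K \<Longrightarrow> (\<lambda>w. gp (z0 w) (samp w) i k) \<in> borel_measurable M"
  "k < K \<Longrightarrow> (\<lambda>w. ee (z0 w) (samp w) i k) \<in> borel_measurable M"
  unfolding gp_def ee_def by measurable

lemma measurable_zeta[measurable]:
  assumes [measurable]: "k < K" "n < N"
  shows "(\<lambda>w. zeta (z0 w) (samp w) i k n) \<in> borel_measurable M"
proof -
  have [measurable]: "(\<lambda>w. gQ k (W (z0 w) (samp w) i k n) (\<xi> (Local k i n) w)) \<in> borel_measurable M"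
    "(\<lambda>w. hQ k (W (z0 w) (samp w) i k n) (\<xi> (Local k i n) w) (V (z0 w) (samp w) i k n)) \<in> borel_measurable M"
    using assms by (intro measurable_gQ measurable_hQ \<xi>_Local; measurable)+
  show ?thesis unfolding zeta_def minus_blinfun.rep_eq by measurable
qed

lemma measurable_noise[measurable]: "(\<lambda>w. noise (z0 w) (samp w) i) \<in> borel_measurable M"
proof (induction i)
  case (Suc i)
  have [measurable]: "(\<lambda>w. mean K (\<lambda>k. mean N (zeta (z0 w) (samp w) i k))) \<in> borel_measurable M"
    by (intro borel_measurable_mean measurable_zeta)
  note Suc[measurable]
  show ?case unfolding noise.simps by measurable
qed simp

lemma measurable_zc[measurable]: "(\<lambda>w. zc (z0 w) (samp w) i) \<in> borel_measurable M"
  unfolding zc_def by measurable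

lemma measurable_grad_J: "f \<in> borel_measurable M \<Longrightarrow> (\<lambda>w. grad J (f w)) \<in> borel_measurable M"
  unfolding grad_J by measurable

lemma measurable_uerr[measurable]: "(\<lambda>w. uerr (z0 w) (samp w) i) \<in> borel_measurable M"
  using measurable_grad_J[OF measurable_zc] unfolding uerr_def by measurable

lemma measurable_udev[measurable]: "(\<lambda>w. udev (z0 w) (samp w) i) \<in> borel_measurable M"
  unfolding udev_def frob_def L2_set_def by measurable

end

section \<open>Orthogonality of the sampling noise\<close>

definition square_integrable :: "'w measure \<Rightarrow> ('w \<Rightarrow> 'b::euclidean_space) \<Rightarrow> bool" where
  "square_integrable M f \<longleftrightarrow> f \<in> borel_measurable M \<and> integrable M (\<lambda>w. (norm (f w))\<^sup>2)"

lemma square_integrable_inner: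
  assumes "square_integrable M f" "square_integrable M g"
  shows "integrable M (\<lambda>w. f w \<bullet> g w)"
proof (rule Bochner_Integration.integrable_bound)
  show "integrable M (\<lambda>w. (norm (f w))\<^sup>2 + (norm (g w))\<^sup>2)"
    using assms by (auto simp: square_integrable_def)
  show "(\<lambda>w. f w \<bullet> g w) \<in> borel_measurable M"
    using assms by (auto simp: square_integrable_def)
  have "\<bar>f w \<bullet> g w\<bar> \<le> (norm (f w))\<^sup>2 + (norm (g w))\<^sup>2" for w
  proof -
    have "\<bar>f w \<bullet> g w\<bar> \<le> norm (f w) * norm (g w)" by (rule Cauchy_Schwarz_ineq2)
    also have "\<dots> \<le> 2 * norm (f w) * norm (g w)" by simp
    also have "\<dots> \<le> (norm (f w))\<^sup>2 + (norm (g w))\<^sup>2" by (rule sum_squares_bound)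
    finally show ?thesis .
  qed
  then show "AE w in M. norm (f w \<bullet> g w) \<le> norm ((norm (f w))\<^sup>2 + (norm (g w))\<^sup>2)"
    by (intro AE_I2) (auto simp: abs_of_nonneg)
qed

lemma square_integrable_add:
  assumes "square_integrable M f" "square_integrable M g"
  shows "square_integrable M (\<lambda>w. f w + g w)"
proof -
  have "(norm (f w + g w))\<^sup>2 = (norm (f w))\<^sup>2 + 2 * (f w \<bullet> g w) + (norm (g w))\<^sup>2" for w
    by (simp add: power2_norm_eq_inner inner_add_left inner_add_right inner_commute)
  then show ?thesis
    using assms square_integrable_inner[OF assms] by (auto simp: square_integrable_def)
qed

lemma square_integrable_scaleR:
  "square_integrable M f \<Longrightarrow> square_integrable M (\<lambda>w. c *\<^sub>R f w)"
  by (auto simp: square_integrable_def power_mult_distrib)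

lemma square_integrable_zero: "square_integrable M (\<lambda>_. 0)"
  by (simp add: square_integrable_def)

lemma square_integrable_sum:
  "(\<And>a. a \<in> I \<Longrightarrow> square_integrable M (f a)) \<Longrightarrow> square_integrable M (\<lambda>w. \<Sum>a\<in>I. f a w)"
  by (induction I rule: infinite_finite_induct)
    (auto intro: square_integrable_add square_integrable_zero)

lemma integral_norm_sum_orthogonal:
  assumes I: "finite I" and sq: "\<And>a. a \<in> I \<Longrightarrow> square_integrable M (f a)"
    and orth: "\<And>a b. a \<in> I \<Longrightarrow> b \<in> I \<Longrightarrow> a \<noteq> b \<Longrightarrow> (\<integral>w. f a w \<bullet> f b w \<partial>M) = 0"
  shows "(\<integral>w. (norm (\<Sum>a\<in>I. f a w))\<^sup>2 \<partial>M) = (\<Sum>a\<in>I. \<integral>w. (norm (f a w))\<^sup>2 \<partial>M)"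
proof -
  have "(\<integral>w. (norm (\<Sum>a\<in>I. f a w))\<^sup>2 \<partial>M) = (\<integral>w. (\<Sum>a\<in>I. \<Sum>b\<in>I. f a w \<bullet> f b w) \<partial>M)"
    unfolding power2_norm_eq_inner inner_sum_left inner_sum_right
    by (subst sum.swap) (rule refl)
  also have "\<dots> = (\<Sum>a\<in>I. \<Sum>b\<in>I. \<integral>w. f a w \<bullet> f b w \<partial>M)"
    using sq by (simp add: Bochner_Integration.integral_sum square_integrable_inner)
  also have "\<dots> = (\<Sum>a\<in>I. \<Sum>b\<in>I. if a = b then \<integral>w. (norm (f a w))\<^sup>2 \<partial>M else 0)"
    using orth by (intro sum.cong refl) (auto simp: power2_norm_eq_inner)
  also have "\<dots> = (\<Sum>a\<in>I. \<integral>w. (norm (f a w))\<^sup>2 \<partial>M)"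
    using I by (simp add: sum.delta)
  finally show ?thesis .
qed

context prob_space
begin

lemma integrable_norm_of_square:
  assumes "square_integrable M f"
  shows "integrable M (\<lambda>w. norm (f w))"
proof (rule Bochner_Integration.integrable_bound)
  show "integrable M (\<lambda>w. 1 + (norm (f w))\<^sup>2)" "(\<lambda>w. norm (f w)) \<in> borel_measurable M"
    using assms by (auto simp: square_integrable_def)
  have "norm (f w) \<le> 1 + (norm (f w))\<^sup>2" for w
    using sum_squares_bound[of "norm (f w)" 1] norm_ge_zero[of "f w"] by (simp only: power_one)
  then show "AE w in M. norm (norm (f w)) \<le> norm (1 + (norm (f w))\<^sup>2)"
    by (intro AE_I2) (auto simp: abs_of_nonneg)
qed

lemma expectation_norm_le:
  assumes f: "square_integrable M f" and c: "expectation (\<lambda>w. (norm (f w))\<^sup>2) \<le> c\<^sup>2" "0 \<le> c"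
  shows "expectation (\<lambda>w. norm (f w)) \<le> c"
proof (rule power2_le_imp_le[OF _ c(2)])
  have "0 \<le> variance (\<lambda>w. norm (f w))" by (rule variance_positive)
  also have "\<dots> = expectation (\<lambda>w. (norm (f w))\<^sup>2) - (expectation (\<lambda>w. norm (f w)))\<^sup>2"
    using f integrable_norm_of_square[OF f] by (intro variance_eq) (auto simp: square_integrable_def)
  finally show "(expectation (\<lambda>w. norm (f w)))\<^sup>2 \<le> c\<^sup>2" using c(1) by linarith
qed

end

context dima
begin

lemma run_cong:
  assumes "\<And>j. j \<noteq> Local k i n \<Longrightarrow> s j = s' j" and "i' \<le> i"
  shows "run z s i' = run z s' i'"
  using assms(2)
proof (induction i')
  case 0
  then show ?case using assms(1) by (simp add: run_def)
next
  case (Suc i')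
  have "s (Local k' i' n') = s' (Local k' i' n')" for k' n' using Suc.prems assms(1) by auto
  then have "round_local p Q s i' = round_local p Q s' i'"
    by (intro ext) (simp add: round_local_def)
  with Suc \<open>\<And>k' n'. s (Local k' i' n') = s' (Local k' i' n')\<close> show ?case
    by (simp add: run_def dima_round_def)
qed

lemma W_cong:
  assumes s: "\<And>j. j \<noteq> Local k i n \<Longrightarrow> s j = s' j" and "i' < i \<or> i' = i \<and> (k' \<noteq> k \<or> n' \<le> n)"
  shows "W z s i' k' n' = W z s' i' k' n'"
  using assms(2)
proof (induction n')
  case 0
  then have "i' \<le> i" by auto
  then show ?case using run_cong[where k=k and i=i and n=n and s=s and s'=s', OF s] by (simp add: W_0 Z_def)
next
  case (Suc n')
  then have "s (Local k' i' n') = s' (Local k' i' n')" by (intro s) auto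
  moreover have "W z s i' k' n' = W z s' i' k' n'" using Suc by auto
  ultimately show ?case by (simp add: W_Suc)
qed

lemma V_cong:
  assumes s: "\<And>j. j \<noteq> Local k i n \<Longrightarrow> s j = s' j" and "i' < i \<or> i' = i \<and> (k' \<noteq> k \<or> n' \<le> n)"
  shows "V z s i' k' n' = V z s' i' k' n'"
proof -
  have "i' \<le> i" using assms(2) by auto
  with run_cong[where k=k and i=i and n=n and s=s and s'=s', OF s] have "run z s i' = run z s' i'" by blast
  then show ?thesis
    using W_cong[where k=k and i=i and n=n and s=s and s'=s', OF s assms(2), of z]
    by (simp add: V_def Wp_def)
qed

lemma zeta_cong:
  assumes s: "\<And>j. j \<noteq> Local k i n \<Longrightarrow> s j = s' j" and "i' < i \<or> i' = i \<and> (k' \<noteq> k \<or> n' < n)"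
  shows "zeta z s i' k' n' = zeta z s' i' k' n'"
proof -
  have "s (Local k' i' n') = s' (Local k' i' n')" using assms(2) by (intro s) auto
  moreover have "i' < i \<or> i' = i \<and> (k' \<noteq> k \<or> n' \<le> n)" using assms(2) by auto
  ultimately show ?thesis
    using W_cong[where k=k and i=i and n=n and s=s and s'=s', OF s] V_cong[where k=k and i=i and n=n and s=s and s'=s', OF s] by (simp add: zeta_def)
qed

lemma noise_cong:
  assumes s: "\<And>j. j \<noteq> Local k i n \<Longrightarrow> s j = s' j" and "i' \<le> i"
  shows "noise z s i' = noise z s' i'"
  using assms(2)
proof (induction i')
  case (Suc i')
  then have "zeta z s i' = zeta z s' i'" by (intro ext zeta_cong[where k=k and i=i and n=n and s=s and s'=s', OF s]) auto
  with Suc show ?case by simp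
qed simp

end

locale dima_prob = dima_measurable K N nb A D Q L Lh \<sigma> \<sigma>h \<beta> \<eta>x \<eta>y M z0 \<xi>
  for K N nb A and D :: "nat \<Rightarrow> 's measure"
    and Q :: "nat \<Rightarrow> 'x::euclidean_space \<times> 'y::euclidean_space \<Rightarrow> 's \<Rightarrow> real"
    and L Lh \<sigma> \<sigma>h \<beta> \<eta>x \<eta>y
    and M :: "'w measure" and z0 :: "'w \<Rightarrow> 'x \<times> 'y" and \<xi> :: "sample_idx \<Rightarrow> 'w \<Rightarrow> 's" +
  assumes sampling: "dima_sampling K N D M z0 \<xi>"
begin

sublocale prob_space M
  using sampling by (simp add: dima_sampling_def)

definition "gen v = (case v of
          None \<Rightarrow> {z0 -` B \<inter> space M | B. B \<in> sets borel}
        | Some j \<Rightarrow> {\<xi> j -` B \<inter> space M | B. B \<in> sets (D (agent_of j))})"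

definition rest :: "sample_idx \<Rightarrow> 'w measure" where
  "rest b = sigma (space M) (\<Union>v\<in>insert None (Some ` sample_idxs K N) - {Some b}. gen v)"

lemma gen_subset: "v \<in> insert None (Some ` sample_idxs K N) \<Longrightarrow> gen v \<subseteq> sets M"
  using measurable_sets[OF z0] measurable_sets[OF \<xi>] by (auto simp: gen_def)

lemma gen_subset_Pow: "gen v \<subseteq> Pow (space M)"
  by (auto simp: gen_def split: option.splits)

lemma Int_stable_gen: "Int_stable (gen v)"
proof (cases v)
  case None
  show ?thesis unfolding Int_stable_def gen_def None option.case
  proof safe
    fix B B' :: "('x \<times> 'y) set" assume "B \<in> sets borel" "B' \<in> sets borel"
    then show "\<exists>B''. z0 -` B \<inter> space M \<inter> (z0 -` B' \<inter> space M) = z0 -` B'' \<inter> space M \<and> B'' \<in> sets borel"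
      by (intro exI[of _ "B \<inter> B'"]) auto
  qed
next
  case (Some j)
  show ?thesis unfolding Int_stable_def gen_def Some option.case
  proof safe
    fix B B' assume "B \<in> sets (D (agent_of j))" "B' \<in> sets (D (agent_of j))"
    then show "\<exists>B''. \<xi> j -` B \<inter> space M \<inter> (\<xi> j -` B' \<inter> space M) = \<xi> j -` B'' \<inter> space M \<and> B'' \<in> sets (D (agent_of j))"
      by (intro exI[of _ "B \<inter> B'"]) auto
  qed
qed

lemma space_rest[simp]: "space (rest b) = space M"
  by (simp add: rest_def space_measure_of_conv)

lemma sets_rest: "sets (rest b) = sigma_sets (space M) (\<Union>v\<in>insert None (Some ` sample_idxs K N) - {Some b}. gen v)"
  unfolding rest_def using gen_subset_Pow by (intro sets_measure_of) blast

lemma sets_rest_subset: "sets (rest b) \<subseteq> sets M"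
  unfolding sets_rest using gen_subset by (intro sets.sigma_sets_subset) blast

lemma measurable_from_rest: "f \<in> measurable (rest b) N' \<Longrightarrow> f \<in> measurable M N'"
  using sets_rest_subset by (auto simp: measurable_def)

lemma z0_rest: "z0 \<in> borel_measurable (rest b)"
proof (rule measurableI)
  fix B :: "('x \<times> 'y) set" assume "B \<in> sets borel"
  then have "z0 -` B \<inter> space M \<in> gen None" by (auto simp: gen_def)
  then show "z0 -` B \<inter> space (rest b) \<in> sets (rest b)"
    unfolding sets_rest space_rest by (intro sigma_sets.Basic) blast
qed simp

lemma \<xi>_rest:
  assumes "j \<in> sample_idxs K N" "j \<noteq> b"
  shows "\<xi> j \<in> measurable (rest b) (D (agent_of j))"
proof (rule measurableI)
  fix B assume "B \<in> sets (D (agent_of j))"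
  then have "\<xi> j -` B \<inter> space M \<in> gen (Some j)" by (auto simp: gen_def)
  then show "\<xi> j -` B \<inter> space (rest b) \<in> sets (rest b)"
    unfolding sets_rest space_rest using assms by (intro sigma_sets.Basic) blast
qed (use measurable_space[OF \<xi>[OF assms(1)]] in simp)

lemma distr_rest_sample:
  assumes b: "b \<in> sample_idxs K N"
  shows "distr M (rest b \<Otimes>\<^sub>M D (agent_of b)) (\<lambda>w. (w, \<xi> b w))
    = distr M (rest b) (\<lambda>w. w) \<Otimes>\<^sub>M D (agent_of b)"
proof -
  let ?I = "insert None (Some ` sample_idxs K N)"
  define I where "I = case_bool (?I - {Some b}) {Some b}"
  have ind: "indep_sets gen ?I"
    using sampling unfolding dima_sampling_def gen_def[abs_def] by blast
  have "(\<Union>j\<in>UNIV. I j) = ?I" using b by (auto simp: I_def UNIV_bool)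
  then have "indep_sets (\<lambda>j. sigma_sets (space M) (\<Union>i\<in>I j. gen i)) UNIV"
    using ind by (intro indep_sets_collect_sigma Int_stable_gen)
      (auto simp: disjoint_family_on_def I_def split: bool.splits)
  also have "(\<lambda>j. sigma_sets (space M) (\<Union>i\<in>I j. gen i))
      = case_bool (sets (rest b)) (sigma_sets (space M) (gen (Some b)))"
    by (auto simp: fun_eq_iff I_def sets_rest split: bool.splits)
  finally have 1: "indep_set (sets (rest b)) (sigma_sets (space M) (gen (Some b)))"
    by (simp add: indep_set_def)
  have idm: "(\<lambda>w. w) \<in> measurable M (rest b)" by (rule measurable_from_rest[of _ b]) simp
  have dist: "distr M (D (agent_of b)) (\<xi> b) = D (agent_of b)"
    using sampling b unfolding dima_sampling_def by blast
  interpret R: prob_space "distr M (rest b) (\<lambda>w. w)" using idm by (rule prob_space_distr)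
  interpret Db: prob_space "D (agent_of b)"
    using prob_space_distr[OF \<xi>[OF b]] by (simp add: dist)
  have pm: "(\<lambda>w. (w, \<xi> b w)) \<in> measurable M (rest b \<Otimes>\<^sub>M D (agent_of b))"
    using idm \<xi>[OF b] by simp
  show ?thesis
  proof (rule pair_measure_eqI[symmetric])
    fix A B assume A: "A \<in> sets (distr M (rest b) (\<lambda>w. w))" and B: "B \<in> sets (D (agent_of b))"
    have A': "A \<in> sets (rest b)" "A \<subseteq> space M"
      using A sets.sets_into_space[of A "rest b"] by auto
    have B': "\<xi> b -` B \<inter> space M \<in> sigma_sets (space M) (gen (Some b))"
      using B by (intro sigma_sets.Basic) (auto simp: gen_def)
    have "emeasure (distr M (rest b \<Otimes>\<^sub>M D (agent_of b)) (\<lambda>w. (w, \<xi> b w))) (A \<times> B)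
        = emeasure M (A \<inter> (\<xi> b -` B \<inter> space M))"
      using pm A' B A'(2) by (subst emeasure_distr) (auto intro!: arg_cong[where f="emeasure M"])
    also have "\<dots> = ennreal (prob A * prob (\<xi> b -` B \<inter> space M))"
      unfolding emeasure_eq_measure using indep_setD[OF 1 A'(1) B'] by simp
    also have "\<dots> = emeasure M A * emeasure M (\<xi> b -` B \<inter> space M)"
      by (simp add: emeasure_eq_measure ennreal_mult)
    also have "emeasure M A = emeasure (distr M (rest b) (\<lambda>w. w)) A"
      using A' by (subst emeasure_distr[OF idm]) (auto intro!: arg_cong[where f="emeasure M"])
    also have "emeasure M (\<xi> b -` B \<inter> space M) = emeasure (D (agent_of b)) B"
      using B \<xi>[OF b] by (subst dist[symmetric], subst emeasure_distr) auto
    finally show "emeasure (distr M (rest b) (\<lambda>w. w)) A * emeasure (D (agent_of b)) B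
      = emeasure (distr M (rest b \<Otimes>\<^sub>M D (agent_of b)) (\<lambda>w. (w, \<xi> b w))) (A \<times> B)" ..
  qed (unfold_locales, auto intro!: sets_pair_measure_cong)
qed

lemma agent_of_less: "b \<in> sample_idxs K N \<Longrightarrow> agent_of b < K"
  by (auto simp: sample_idxs_def)

definition "oerr c1 c2 k z v s =
  c1 *\<^sub>R ((hQ k z s - hJ k z) v) + c2 *\<^sub>R (gQ k z s - gJ k z)"

lemma oerr_moments:
  assumes k: "k < K"
  shows "integrable (D k) (oerr c1 c2 k z v)" and "(\<integral>s. oerr c1 c2 k z v s \<partial>D k) = 0"
    and "(\<integral>\<^sup>+s. ennreal ((norm (oerr c1 c2 k z v s))\<^sup>2) \<partial>D k)
      \<le> ennreal (2 * c1\<^sup>2 * \<sigma>h\<^sup>2 * (norm v)\<^sup>2 + 2 * c2\<^sup>2 * \<sigma>\<^sup>2)"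
proof -
  note o = stoch_moments[OF k]
  interpret Dk: prob_space "D k" by (rule o(1))
  have bl: "bounded_linear (\<lambda>H :: ('x \<times> 'y) \<Rightarrow>\<^sub>L ('x \<times> 'y). H v)"
    by (rule blinfun.bounded_linear_left)
  have iH: "integrable (D k) (\<lambda>s. hQ k z s - hJ k z)" and ig: "integrable (D k) (\<lambda>s. gQ k z s - gJ k z)"
    using o by auto
  have "(\<integral>s. hQ k z s - hJ k z \<partial>D k) = 0" and g0: "(\<integral>s. gQ k z s - gJ k z \<partial>D k) = 0"
    using o by (simp_all add: Dk.prob_space)
  then have H0: "(\<integral>s. (hQ k z s - hJ k z) v \<partial>D k) = 0"
    using integral_bounded_linear[OF bl iH] by simp
  have iHv: "integrable (D k) (\<lambda>s. (hQ k z s - hJ k z) v)"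
    by (rule integrable_bounded_linear[OF bl iH])
  show "integrable (D k) (oerr c1 c2 k z v)"
    unfolding oerr_def[abs_def] using iHv ig by (intro Bochner_Integration.integrable_add integrable_scaleR_right)
  show "(\<integral>s. oerr c1 c2 k z v s \<partial>D k) = 0"
    unfolding oerr_def using iHv ig H0 g0
    by (subst Bochner_Integration.integral_add) (auto intro!: integrable_scaleR_right)
  have le: "(norm (oerr c1 c2 k z v s))\<^sup>2
      \<le> 2 * c1\<^sup>2 * (norm v)\<^sup>2 * (norm (hQ k z s - hJ k z))\<^sup>2 + 2 * c2\<^sup>2 * (norm (gQ k z s - gJ k z))\<^sup>2" for s
  proof -
    let ?a = "c1 *\<^sub>R ((hQ k z s - hJ k z) v)" and ?b = "c2 *\<^sub>R (gQ k z s - gJ k z)"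
    have "(norm (?a + ?b))\<^sup>2 \<le> (norm ?a + norm ?b)\<^sup>2"
      by (intro power_mono norm_triangle_ineq) auto
    also have "\<dots> \<le> 2 * (norm ?a)\<^sup>2 + 2 * (norm ?b)\<^sup>2"
      using sum_squares_bound[of "norm ?a" "norm ?b"] by (simp add: power2_sum)
    also have "(norm ?a)\<^sup>2 \<le> c1\<^sup>2 * (norm (hQ k z s - hJ k z) * norm v)\<^sup>2"
      unfolding norm_scaleR power_mult_distrib[of "\<bar>c1\<bar>"] power2_abs
      by (intro mult_left_mono power_mono norm_blinfun) auto
    finally show ?thesis
      by (simp add: oerr_def power_mult_distrib mult_ac)
  qed
  have "(\<integral>\<^sup>+s. ennreal ((norm (oerr c1 c2 k z v s))\<^sup>2) \<partial>D k)
      \<le> (\<integral>\<^sup>+s. ennreal (2 * c1\<^sup>2 * (norm v)\<^sup>2 * (norm (hQ k z s - hJ k z))\<^sup>2 + 2 * c2\<^sup>2 * (norm (gQ k z s - gJ k z))\<^sup>2) \<partial>D k)"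
    using le by (intro nn_integral_mono ennreal_leI)
  also have "\<dots> = ennreal (\<integral>s. 2 * c1\<^sup>2 * (norm v)\<^sup>2 * (norm (hQ k z s - hJ k z))\<^sup>2 + 2 * c2\<^sup>2 * (norm (gQ k z s - gJ k z))\<^sup>2 \<partial>D k)"
    using o by (intro nn_integral_eq_integral) auto
  also have "\<dots> = ennreal (2 * c1\<^sup>2 * (norm v)\<^sup>2 * (\<integral>s. (norm (hQ k z s - hJ k z))\<^sup>2 \<partial>D k) + 2 * c2\<^sup>2 * (\<integral>s. (norm (gQ k z s - gJ k z))\<^sup>2 \<partial>D k))"
    using o by simp
  also have "\<dots> \<le> ennreal (2 * c1\<^sup>2 * (norm v)\<^sup>2 * \<sigma>h\<^sup>2 + 2 * c2\<^sup>2 * \<sigma>\<^sup>2)"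
    using o by (intro ennreal_leI add_mono mult_left_mono) auto
  finally show "(\<integral>\<^sup>+s. ennreal ((norm (oerr c1 c2 k z v s))\<^sup>2) \<partial>D k)
      \<le> ennreal (2 * c1\<^sup>2 * \<sigma>h\<^sup>2 * (norm v)\<^sup>2 + 2 * c2\<^sup>2 * \<sigma>\<^sup>2)"
    by (simp add: mult_ac)
qed

lemma oerr_sample:
  fixes c1 c2 B :: real and Z' V' Y :: "'w \<Rightarrow> 'x \<times> 'y"
  assumes b: "b \<in> sample_idxs K N" and k: "k = agent_of b"
    and Z': "Z' \<in> borel_measurable (rest b)" and V': "V' \<in> borel_measurable (rest b)"
    and B: "\<And>w. norm (V' w) \<le> B"
  defines "f \<equiv> \<lambda>w. oerr c1 c2 k (Z' w) (V' w) (\<xi> b w)"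
  shows "square_integrable M f"
    and "(\<integral>w. (norm (f w))\<^sup>2 \<partial>M) \<le> (\<integral>w. 2 * c1\<^sup>2 * \<sigma>h\<^sup>2 * (norm (V' w))\<^sup>2 + 2 * c2\<^sup>2 * \<sigma>\<^sup>2 \<partial>M)"
    and "Y \<in> borel_measurable (rest b) \<Longrightarrow> square_integrable M Y \<Longrightarrow> (\<integral>w. Y w \<bullet> f w \<partial>M) = 0"
proof -
  have kK: "k < K" using agent_of_less[OF b] k by simp
  let ?R = "distr M (rest b) (\<lambda>w. w)"
  let ?P = "rest b \<Otimes>\<^sub>M D k"
  have idm: "(\<lambda>w. w) \<in> measurable M (rest b)" by (rule measurable_from_rest[of _ b]) simp
  have \<xi>b: "\<xi> b \<in> measurable M (D k)" using \<xi>[OF b] k by simp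
  have pm: "(\<lambda>w. (w, \<xi> b w)) \<in> measurable M ?P" using idm \<xi>b by simp
  have dist: "distr M ?P (\<lambda>w. (w, \<xi> b w)) = ?R \<Otimes>\<^sub>M D k"
    using distr_rest_sample[OF b] by (simp add: k)
  interpret R: prob_space ?R using idm by (rule prob_space_distr)
  interpret Dk: prob_space "D k" by (rule stoch_moments(1)[OF kK])
  interpret RD: pair_prob_space ?R "D k" ..
  define F where "F = (\<lambda>q. oerr c1 c2 k (Z' (fst q)) (V' (fst q)) (snd q))"
  have Fm: "F \<in> borel_measurable ?P"
  proof -
    have [measurable]: "(\<lambda>q. Z' (fst q)) \<in> borel_measurable ?P" "(\<lambda>q. V' (fst q)) \<in> borel_measurable ?P"
      using measurable_compose[OF measurable_fst] Z' V' by blast+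
    have [measurable]: "(\<lambda>q. hQ k (Z' (fst q)) (snd q) (V' (fst q))) \<in> borel_measurable ?P"
      "(\<lambda>q. gQ k (Z' (fst q)) (snd q)) \<in> borel_measurable ?P"
      by (intro measurable_hQ measurable_gQ kK; measurable)+
    show ?thesis unfolding F_def oerr_def minus_blinfun.rep_eq using kK by measurable
  qed
  have f_eq: "f w = F (w, \<xi> b w)" for w by (simp add: f_def F_def)
  have fm: "f \<in> borel_measurable M"
    unfolding f_eq[abs_def] by (rule measurable_compose[OF pm Fm])
  let ?v = "\<lambda>w. 2 * c1\<^sup>2 * \<sigma>h\<^sup>2 * (norm (V' w))\<^sup>2 + 2 * c2\<^sup>2 * \<sigma>\<^sup>2"
  have V'M: "V' \<in> borel_measurable M" using V' by (rule measurable_from_rest)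
  have vi: "integrable M ?v"
  proof (rule integrable_const_bound[of _ "2 * c1\<^sup>2 * \<sigma>h\<^sup>2 * B\<^sup>2 + 2 * c2\<^sup>2 * \<sigma>\<^sup>2"])
    show "AE w in M. norm (?v w) \<le> 2 * c1\<^sup>2 * \<sigma>h\<^sup>2 * B\<^sup>2 + 2 * c2\<^sup>2 * \<sigma>\<^sup>2"
      using power_mono[OF B norm_ge_zero, where n=2] by (intro AE_I2) (simp add: mult_left_mono)
  qed (use V'M in measurable)
  have "(\<integral>\<^sup>+w. ennreal ((norm (f w))\<^sup>2) \<partial>M) = (\<integral>\<^sup>+q. ennreal ((norm (F q))\<^sup>2) \<partial>distr M ?P (\<lambda>w. (w, \<xi> b w)))"
    unfolding f_eq using pm Fm by (subst nn_integral_distr) auto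
  also have "\<dots> = (\<integral>\<^sup>+w. (\<integral>\<^sup>+s. ennreal ((norm (F (w, s)))\<^sup>2) \<partial>D k) \<partial>?R)"
    unfolding dist using Fm by (subst Dk.nn_integral_fst[symmetric]) (auto cong: measurable_cong_sets)
  also have "\<dots> \<le> (\<integral>\<^sup>+w. ennreal (?v w) \<partial>?R)"
    unfolding F_def fst_conv snd_conv by (intro nn_integral_mono oerr_moments(3) kK)
  also have "\<dots> = (\<integral>\<^sup>+w. ennreal (?v w) \<partial>M)"
    using idm V' by (subst nn_integral_distr) auto
  also have "\<dots> = ennreal (\<integral>w. ?v w \<partial>M)"
    using vi by (intro nn_integral_eq_integral) auto
  finally have le: "(\<integral>\<^sup>+w. ennreal ((norm (f w))\<^sup>2) \<partial>M) \<le> ennreal (\<integral>w. ?v w \<partial>M)" .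
  have fi: "integrable M (\<lambda>w. (norm (f w))\<^sup>2)"
    using fm le by (intro integrableI_bounded) (auto simp: less_top[symmetric] top_unique)
  then show sq: "square_integrable M f" using fm by (simp add: square_integrable_def)
  have "ennreal (\<integral>w. (norm (f w))\<^sup>2 \<partial>M) \<le> ennreal (\<integral>w. ?v w \<partial>M)"
    using le fi by (subst nn_integral_eq_integral[symmetric]) auto
  then show "(\<integral>w. (norm (f w))\<^sup>2 \<partial>M) \<le> (\<integral>w. ?v w \<partial>M)"
    by (subst (asm) ennreal_le_iff) (auto intro!: integral_nonneg_AE)
  show "(\<integral>w. Y w \<bullet> f w \<partial>M) = 0" if Y: "Y \<in> borel_measurable (rest b)" "square_integrable M Y"
  proof -
    let ?G = "\<lambda>q. Y (fst q) \<bullet> F q"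
    have [measurable]: "(\<lambda>q. Y (fst q)) \<in> borel_measurable ?P"
      using measurable_compose[OF measurable_fst] Y by blast
    have Gm: "?G \<in> borel_measurable ?P" using Fm by measurable
    have "integrable M (\<lambda>w. ?G (w, \<xi> b w))"
      using square_integrable_inner[OF Y(2) sq] by (simp add: f_eq)
    then have Gi: "integrable (?R \<Otimes>\<^sub>M D k) ?G"
      unfolding dist[symmetric] by (subst integrable_distr_eq[OF pm Gm])
    have "(\<integral>w. Y w \<bullet> f w \<partial>M) = (\<integral>q. ?G q \<partial>distr M ?P (\<lambda>w. (w, \<xi> b w)))"
      by (subst integral_distr[OF pm Gm]) (simp add: f_eq)
    also have "\<dots> = (\<integral>w. (\<integral>s. ?G (w, s) \<partial>D k) \<partial>?R)"
      unfolding dist by (rule RD.integral_fst'[symmetric, OF Gi])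
    also have "\<dots> = 0"
      using oerr_moments[OF kK] by (simp add: F_def integral_inner_right)
    finally show ?thesis .
  qed
qed

end

section \<open>Expected errors of momentum and tracking\<close>

context dima_prob
begin

lemma zeta_oerr: "zeta z s i k n = oerr (1 - \<beta>) \<beta> k (W z s i k n) (V z s i k n) (s (Local k i n))"
  by (simp add: zeta_def oerr_def)

lemma Local_idx: "k < K \<Longrightarrow> n < N \<Longrightarrow> Local k i n \<in> sample_idxs K N"
  and Init_idx: "k < K \<Longrightarrow> Init k \<in> sample_idxs K N"
  by (auto simp: sample_idxs_def)

text \<open>
  Quantities that do not depend on the sample \<open>Local k i n\<close> are measurable with respect to the
  remaining randomness, since replacing that sample by a constant does not change them.
\<close>

lemma measurable_rest:
  assumes k: "k < K" and n: "n < N"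
  shows "(\<lambda>w. W (z0 w) (samp w) i k n) \<in> borel_measurable (rest (Local k i n))"
    and "(\<lambda>w. V (z0 w) (samp w) i k n) \<in> borel_measurable (rest (Local k i n))"
    and "(\<lambda>w. noise (z0 w) (samp w) i) \<in> borel_measurable (rest (Local k i n))"
    and "k' < K \<Longrightarrow> n' < N \<Longrightarrow> k' \<noteq> k \<or> n' < n \<Longrightarrow>
      (\<lambda>w. zeta (z0 w) (samp w) i k' n') \<in> borel_measurable (rest (Local k i n))"
proof -
  let ?b = "Local k i n"
  obtain s0 where s0: "s0 \<in> space (D k)"
    using prob_space.not_empty[OF stoch_moments(1)[OF k]] by blast
  define \<xi>' where "\<xi>' = \<xi>(?b := (\<lambda>_. s0))"
  interpret R: dima_measurable K N nb A D Q L Lh \<sigma> \<sigma>h \<beta> \<eta>x \<eta>y "rest ?b" z0 \<xi>'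
  proof
    show "z0 \<in> borel_measurable (rest ?b)" by (rule z0_rest)
    show "\<xi>' j \<in> measurable (rest ?b) (D (agent_of j))" if "j \<in> sample_idxs K N" for j
      using \<xi>_rest[OF that] s0 by (cases "j = ?b") (auto simp: \<xi>'_def)
  qed
  have eq: "samp w j = (\<lambda>j. \<xi>' j w) j" if "j \<noteq> ?b" for w j
    using that by (simp add: \<xi>'_def)
  show "(\<lambda>w. W (z0 w) (samp w) i k n) \<in> borel_measurable (rest ?b)"
    using R.measurable_run(5)[OF k n, of i]
    by (subst W_cong[where k=k and i=i and n=n, OF eq]) auto
  show "(\<lambda>w. V (z0 w) (samp w) i k n) \<in> borel_measurable (rest ?b)"
    using R.measurable_V[OF k n, of i]
    by (subst V_cong[where k=k and i=i and n=n, OF eq]) auto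
  show "(\<lambda>w. noise (z0 w) (samp w) i) \<in> borel_measurable (rest ?b)"
    using R.measurable_noise[of i]
    by (subst noise_cong[where k=k and i=i and n=n, OF eq]) auto
  show "(\<lambda>w. zeta (z0 w) (samp w) i k' n') \<in> borel_measurable (rest ?b)"
    if "k' < K" "n' < N" "k' \<noteq> k \<or> n' < n"
    using R.measurable_zeta[OF that(1,2), of i] that(3)
    by (subst zeta_cong[where k=k and i=i and n=n, OF eq]) auto
qed

definition "zt i k n w = zeta (z0 w) (samp w) i k n"
definition "vt i k n w = V (z0 w) (samp w) i k n"

lemma norm_vt: "k < K \<Longrightarrow> n < N \<Longrightarrow> norm (vt i k n w) \<le> sqrt (real K) * Dd"
  unfolding vt_def by (rule norm_V)

lemma integrable_vt: "k < K \<Longrightarrow> n < N \<Longrightarrow> integrable M (\<lambda>w. (norm (vt i k n w))\<^sup>2)"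
proof (rule integrable_const_bound[where B="(sqrt (real K) * Dd)\<^sup>2"])
  assume kn: "k < K" "n < N"
  show "AE w in M. norm ((norm (vt i k n w))\<^sup>2) \<le> (sqrt (real K) * Dd)\<^sup>2"
    using power_mono[OF norm_vt[OF kn] norm_ge_zero, where n=2] by (intro AE_I2) simp
  show "(\<lambda>w. (norm (vt i k n w))\<^sup>2) \<in> borel_measurable M"
    unfolding vt_def using measurable_V[OF kn] by measurable
qed

lemma zt_moments:
  assumes k: "k < K" and n: "n < N"
  shows "square_integrable M (zt i k n)"
    and "(\<integral>w. (norm (zt i k n w))\<^sup>2 \<partial>M) \<le> 2 * \<sigma>h\<^sup>2 * (\<integral>w. (norm (vt i k n w))\<^sup>2 \<partial>M) + 2 * \<beta>\<^sup>2 * \<sigma>\<^sup>2"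
    and "Y \<in> borel_measurable (rest (Local k i n)) \<Longrightarrow> square_integrable M Y \<Longrightarrow> (\<integral>w. Y w \<bullet> zt i k n w \<partial>M) = 0"
proof -
  note * = oerr_sample[where k=k and ?c1.0="1 - \<beta>" and ?c2.0=\<beta>,
      OF Local_idx[OF k n] agent_of.simps(2)[symmetric] measurable_rest(1,2)[OF k n] norm_V[OF k n]]
  show "square_integrable M (zt i k n)"
    using *(1) unfolding zt_def zeta_oerr by simp
  have "(\<integral>w. (norm (zt i k n w))\<^sup>2 \<partial>M)
      \<le> (\<integral>w. 2 * (1 - \<beta>)\<^sup>2 * \<sigma>h\<^sup>2 * (norm (vt i k n w))\<^sup>2 + 2 * \<beta>\<^sup>2 * \<sigma>\<^sup>2 \<partial>M)"
    using *(2) unfolding zt_def zeta_oerr vt_def by simp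
  also have "\<dots> = 2 * (1 - \<beta>)\<^sup>2 * \<sigma>h\<^sup>2 * (\<integral>w. (norm (vt i k n w))\<^sup>2 \<partial>M) + 2 * \<beta>\<^sup>2 * \<sigma>\<^sup>2"
    using integrable_vt[OF k n] by (simp add: prob_space)
  also have "\<dots> \<le> 2 * 1 * \<sigma>h\<^sup>2 * (\<integral>w. (norm (vt i k n w))\<^sup>2 \<partial>M) + 2 * \<beta>\<^sup>2 * \<sigma>\<^sup>2"
    using \<beta> by (intro add_mono mult_right_mono mult_left_mono order_refl)
      (auto simp: power_le_one Bochner_Integration.integral_nonneg)
  finally show "(\<integral>w. (norm (zt i k n w))\<^sup>2 \<partial>M) \<le> 2 * \<sigma>h\<^sup>2 * (\<integral>w. (norm (vt i k n w))\<^sup>2 \<partial>M) + 2 * \<beta>\<^sup>2 * \<sigma>\<^sup>2"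
    by simp
  show "Y \<in> borel_measurable (rest (Local k i n)) \<Longrightarrow> square_integrable M Y \<Longrightarrow> (\<integral>w. Y w \<bullet> zt i k n w \<partial>M) = 0"
    using *(3)[of Y] unfolding zt_def zeta_oerr by simp
qed

definition "zbar i w = mean K (\<lambda>k. mean N (\<lambda>n. zt i k n w))"

lemma zbar_sum: "zbar i w = (1 / (real K * real N)) *\<^sub>R (\<Sum>a\<in>{..<K} \<times> {..<N}. zt i (fst a) (snd a) w)"
  by (simp add: zbar_def mean_def scaleR_sum_right[symmetric] sum.cartesian_product case_prod_unfold)

lemma zbar_orth:
  assumes Y: "\<And>k n. k < K \<Longrightarrow> n < N \<Longrightarrow> Y \<in> borel_measurable (rest (Local k i n))" "square_integrable M Y"
  shows "(\<integral>w. Y w \<bullet> zbar i w \<partial>M) = 0"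
proof -
  have "(\<integral>w. Y w \<bullet> zbar i w \<partial>M)
      = (1 / (real K * real N)) * (\<integral>w. (\<Sum>a\<in>{..<K} \<times> {..<N}. Y w \<bullet> zt i (fst a) (snd a) w) \<partial>M)"
    by (simp add: zbar_sum inner_sum_right)
  also have "(\<integral>w. (\<Sum>a\<in>{..<K} \<times> {..<N}. Y w \<bullet> zt i (fst a) (snd a) w) \<partial>M)
      = (\<Sum>a\<in>{..<K} \<times> {..<N}. \<integral>w. Y w \<bullet> zt i (fst a) (snd a) w \<partial>M)"
    using Y(2) zt_moments(1) by (intro Bochner_Integration.integral_sum square_integrable_inner) auto
  also have "\<dots> = 0"
    using zt_moments(3)[OF _ _ Y(1) Y(2)] by (intro sum.neutral) auto
  finally show ?thesis by simp
qed

definition "nv = (2 * \<sigma>h\<^sup>2 * Dd\<^sup>2 + 2 * \<beta>\<^sup>2 * \<sigma>\<^sup>2) / real (N * K)"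

lemma nv_nonneg: "0 \<le> nv"
  by (simp add: nv_def)

lemma zbar_moments:
  "square_integrable M (zbar i)" "(\<integral>w. (norm (zbar i w))\<^sup>2 \<partial>M) \<le> nv"
proof -
  let ?I = "{..<K} \<times> {..<N}"
  have sq: "square_integrable M (\<lambda>w. zt i (fst a) (snd a) w)" if "a \<in> ?I" for a
    using zt_moments(1) that by auto
  show "square_integrable M (zbar i)"
    unfolding zbar_sum[abs_def] by (intro square_integrable_scaleR square_integrable_sum sq)
  have orth1: "(\<integral>w. zt i k' n' w \<bullet> zt i k n w \<partial>M) = 0"
    if "k < K" "n < N" "k' < K" "n' < N" "k' \<noteq> k \<or> n' < n" for k n k' n'
    using that zt_moments(1) measurable_rest(4)[of k n k' n' i]
    by (intro zt_moments(3)) (auto simp: zt_def[abs_def])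
  have orth: "(\<integral>w. zt i (fst a) (snd a) w \<bullet> zt i (fst b) (snd b) w \<partial>M) = 0"
    if "a \<in> ?I" "b \<in> ?I" "a \<noteq> b" for a b
  proof (cases "fst a \<noteq> fst b \<or> snd a < snd b")
    case True
    then show ?thesis using that by (intro orth1) auto
  next
    case False
    then have "snd b < snd a" using that by (auto simp: prod_eq_iff)
    then show ?thesis
      using orth1[of "fst a" "snd a" "fst b" "snd b"] that by (auto simp: inner_commute)
  qed
  have e1: "(\<integral>w. (norm (zbar i w))\<^sup>2 \<partial>M)
      = (1 / (real K * real N))\<^sup>2 * (\<integral>w. (norm (\<Sum>a\<in>?I. zt i (fst a) (snd a) w))\<^sup>2 \<partial>M)"
    unfolding zbar_sum norm_scaleR power_mult_distrib by simp
  have e2: "(\<integral>w. (norm (\<Sum>a\<in>?I. zt i (fst a) (snd a) w))\<^sup>2 \<partial>M)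
      = (\<Sum>a\<in>?I. \<integral>w. (norm (zt i (fst a) (snd a) w))\<^sup>2 \<partial>M)"
    by (rule integral_norm_sum_orthogonal[OF _ sq orth]) auto
  have e3: "(\<Sum>a\<in>?I. \<integral>w. (norm (zt i (fst a) (snd a) w))\<^sup>2 \<partial>M)
      \<le> (\<Sum>a\<in>?I. 2 * \<sigma>h\<^sup>2 * (\<integral>w. (norm (vt i (fst a) (snd a) w))\<^sup>2 \<partial>M) + 2 * \<beta>\<^sup>2 * \<sigma>\<^sup>2)"
    by (intro sum_mono zt_moments(2)) auto
  have e4: "(\<Sum>a\<in>?I. 2 * \<sigma>h\<^sup>2 * (\<integral>w. (norm (vt i (fst a) (snd a) w))\<^sup>2 \<partial>M) + 2 * \<beta>\<^sup>2 * \<sigma>\<^sup>2)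
      = 2 * \<sigma>h\<^sup>2 * (\<Sum>a\<in>?I. \<integral>w. (norm (vt i (fst a) (snd a) w))\<^sup>2 \<partial>M) + real K * real N * (2 * \<beta>\<^sup>2 * \<sigma>\<^sup>2)"
    by (simp add: sum.distrib sum_distrib_left)
  have "(\<Sum>a\<in>?I. \<integral>w. (norm (vt i (fst a) (snd a) w))\<^sup>2 \<partial>M)
      = (\<Sum>k<K. \<Sum>n<N. \<integral>w. (norm (vt i k n w))\<^sup>2 \<partial>M)"
    by (simp add: sum.cartesian_product case_prod_unfold)
  also have "\<dots> = (\<Sum>n<N. \<Sum>k<K. \<integral>w. (norm (vt i k n w))\<^sup>2 \<partial>M)"
    by (rule sum.swap)
  also have "\<dots> = (\<Sum>n<N. \<integral>w. (\<Sum>k<K. (norm (vt i k n w))\<^sup>2) \<partial>M)"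
    using integrable_vt by (intro sum.cong refl Bochner_Integration.integral_sum[symmetric]) auto
  also have "\<dots> \<le> (\<Sum>n<N. real K * Dd\<^sup>2)"
  proof (rule sum_mono)
    fix n assume "n \<in> {..<N}"
    then have n: "n < N" by simp
    have "(\<Sum>k<K. (norm (vt i k n w))\<^sup>2) \<le> real K * Dd\<^sup>2" for w
      using mean_V_power2[OF n, of "z0 w" "samp w" i] K
      by (simp add: mean_def vt_def field_simps)
    then have "(\<integral>w. (\<Sum>k<K. (norm (vt i k n w))\<^sup>2) \<partial>M) \<le> (\<integral>w. real K * Dd\<^sup>2 \<partial>M)"
      using integrable_vt n by (intro integral_mono) auto
    then show "(\<integral>w. (\<Sum>k<K. (norm (vt i k n w))\<^sup>2) \<partial>M) \<le> real K * Dd\<^sup>2"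
      by (simp add: prob_space)
  qed
  finally have e5: "(\<Sum>a\<in>?I. \<integral>w. (norm (vt i (fst a) (snd a) w))\<^sup>2 \<partial>M) \<le> real N * (real K * Dd\<^sup>2)"
    by simp
  have "(\<integral>w. (norm (zbar i w))\<^sup>2 \<partial>M) \<le> (1 / (real K * real N))\<^sup>2 *
      (2 * \<sigma>h\<^sup>2 * (real N * (real K * Dd\<^sup>2)) + real K * real N * (2 * \<beta>\<^sup>2 * \<sigma>\<^sup>2))"
    unfolding e1 e2 using e3 e4 mult_left_mono[OF e5, of "2 * \<sigma>h\<^sup>2"]
    by (intro mult_left_mono) auto
  also have "\<dots> = nv"
    using K N by (simp add: nv_def power2_eq_square field_simps)
  finally show "(\<integral>w. (norm (zbar i w))\<^sup>2 \<partial>M) \<le> nv" .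
qed

definition "nz i w = noise (z0 w) (samp w) i"

lemma nz_moments:
  "square_integrable M (nz i) \<and> (\<integral>w. (norm (nz i w))\<^sup>2 \<partial>M) \<le> nv / \<beta>"
proof (induction i)
  case 0
  then show ?case using \<beta> nv_nonneg by (simp add: nz_def[abs_def] square_integrable_zero)
next
  case (Suc i)
  then have sq: "square_integrable M (nz i)" and le: "(\<integral>w. (norm (nz i w))\<^sup>2 \<partial>M) \<le> nv / \<beta>" by auto
  have eq: "nz (Suc i) = (\<lambda>w. (1 - \<beta>) *\<^sub>R nz i w + zbar i w)"
    by (simp add: nz_def[abs_def] zbar_def[abs_def] zt_def)
  have cross: "(\<integral>w. nz i w \<bullet> zbar i w \<partial>M) = 0"
    using measurable_rest(3) by (intro zbar_orth sq) (auto simp: nz_def[abs_def])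
  have i2: "integrable M (\<lambda>w. (norm (nz i w))\<^sup>2)" "integrable M (\<lambda>w. (norm (zbar i w))\<^sup>2)"
    "integrable M (\<lambda>w. nz i w \<bullet> zbar i w)"
    using sq zbar_moments(1)[of i] square_integrable_inner[OF sq zbar_moments(1)]
    by (auto simp: square_integrable_def)
  have "(norm ((1 - \<beta>) *\<^sub>R nz i w + zbar i w))\<^sup>2
      = (1 - \<beta>)\<^sup>2 * (norm (nz i w))\<^sup>2 + 2 * (1 - \<beta>) * (nz i w \<bullet> zbar i w) + (norm (zbar i w))\<^sup>2" for w
    by (simp only: power2_norm_eq_inner inner_add_left inner_add_right inner_scaleR_left inner_scaleR_right
        inner_commute[of "zbar i w" "nz i w"]) (simp add: power2_eq_square algebra_simps)
  then have "(\<integral>w. (norm (nz (Suc i) w))\<^sup>2 \<partial>M)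
      = (1 - \<beta>)\<^sup>2 * (\<integral>w. (norm (nz i w))\<^sup>2 \<partial>M) + (\<integral>w. (norm (zbar i w))\<^sup>2 \<partial>M)"
    unfolding eq using i2 cross by simp
  also have "\<dots> \<le> (1 - \<beta>) * (nv / \<beta>) + nv"
  proof (intro add_mono mult_mono le zbar_moments)
    show "(1 - \<beta>)\<^sup>2 \<le> 1 - \<beta>" using \<beta> by (simp add: power2_eq_square mult_left_le)
  qed (use \<beta> in auto)
  also have "\<dots> = nv / \<beta>" using \<beta> by (simp add: field_simps)
  finally show ?case
    unfolding eq using sq zbar_moments by (auto intro: square_integrable_add square_integrable_scaleR)
qed

lemma expectation_nz: "expectation (\<lambda>w. norm (nz i w)) \<le> sqrt (nv / \<beta>)"
  using nz_moments[of i] \<beta> nv_nonneg by (intro expectation_norm_le) auto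

definition "ini k w = gQ k (z0 w) (\<xi> (Init k) w) - gJ k (z0 w)"

lemma ini_moments:
  assumes k: "k < K"
  shows "square_integrable M (ini k)" and "(\<integral>w. (norm (ini k w))\<^sup>2 \<partial>M) \<le> 2 * \<sigma>\<^sup>2"
    and "k' < K \<Longrightarrow> k' \<noteq> k \<Longrightarrow> (\<integral>w. ini k' w \<bullet> ini k w \<partial>M) = 0"
proof -
  have idx: "Init k \<in> sample_idxs K N" by (rule Init_idx[OF k])
  have ini_eq: "ini k w = oerr 0 1 k (z0 w) 0 (\<xi> (Init k) w)" for w
    by (simp add: ini_def oerr_def)
  note * = oerr_sample[where k=k and ?c1.0=0 and ?c2.0=1 and V'="\<lambda>_. 0" and B=0,
      OF idx agent_of.simps(1)[symmetric] z0_rest, simplified]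
  show "square_integrable M (ini k)"
    using *(1) by (simp add: ini_eq[abs_def])
  show "(\<integral>w. (norm (ini k w))\<^sup>2 \<partial>M) \<le> 2 * \<sigma>\<^sup>2"
    using *(2) by (simp add: ini_eq[abs_def] prob_space)
  show "(\<integral>w. ini k' w \<bullet> ini k w \<partial>M) = 0" if k': "k' < K" "k' \<noteq> k"
  proof -
    have "\<xi> (Init k') \<in> measurable (rest (Init k)) (D k')"
      using \<xi>_rest[OF Init_idx[OF k'(1)], of "Init k"] k' by simp
    then have "ini k' \<in> borel_measurable (rest (Init k))"
      unfolding ini_def[abs_def] using k' z0_rest
      by (intro borel_measurable_diff measurable_gQ measurable_gJ)
    moreover have "square_integrable M (ini k')"
      using oerr_sample(1)[where k=k' and ?c1.0=0 and ?c2.0=1 and V'="\<lambda>_. 0" and B=0,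
          OF Init_idx[OF k'(1)] agent_of.simps(1)[symmetric] z0_rest, simplified]
      by (simp add: ini_def[abs_def] oerr_def)
    ultimately show ?thesis using *(3) by (simp add: ini_eq)
  qed
qed

lemma ee_0: "ee (z0 w) (samp w) 0 k = ini k w"
  by (simp add: ee_def run_0 gp_def ini_def mean_const[OF N])

lemma mean_ini:
  "square_integrable M (\<lambda>w. mean K (\<lambda>k. ini k w))"
  "expectation (\<lambda>w. norm (mean K (\<lambda>k. ini k w))) \<le> 2 * \<sigma> / sqrt (real K)"
proof -
  show sq: "square_integrable M (\<lambda>w. mean K (\<lambda>k. ini k w))"
    unfolding mean_def using ini_moments(1) by (intro square_integrable_scaleR square_integrable_sum) auto
  have "(\<integral>w. (norm (mean K (\<lambda>k. ini k w)))\<^sup>2 \<partial>M) = (1 / real K)\<^sup>2 * (\<integral>w. (norm (\<Sum>k<K. ini k w))\<^sup>2 \<partial>M)"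
    unfolding mean_def norm_scaleR power_mult_distrib by simp
  also have "(\<integral>w. (norm (\<Sum>k<K. ini k w))\<^sup>2 \<partial>M) = (\<Sum>k<K. \<integral>w. (norm (ini k w))\<^sup>2 \<partial>M)"
    using ini_moments by (intro integral_norm_sum_orthogonal) auto
  also have "\<dots> \<le> (\<Sum>k<K. 4 * \<sigma>\<^sup>2)"
    by (intro sum_mono order_trans[OF ini_moments(2)]) auto
  finally have "(\<integral>w. (norm (mean K (\<lambda>k. ini k w)))\<^sup>2 \<partial>M) \<le> (1 / real K)\<^sup>2 * (real K * (4 * \<sigma>\<^sup>2))"
    by (simp add: mult_left_mono divide_right_mono)
  also have "\<dots> = (2 * \<sigma> / sqrt (real K))\<^sup>2"
    using K by (simp add: power_divide power_mult_distrib power2_eq_square field_simps)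
  finally show "expectation (\<lambda>w. norm (mean K (\<lambda>k. ini k w))) \<le> 2 * \<sigma> / sqrt (real K)"
    using sg by (intro expectation_norm_le sq) auto
qed

definition "eb i w = norm (mean K (ee (z0 w) (samp w) i))"

lemma eb_measurable[measurable]: "eb i \<in> borel_measurable M"
  unfolding eb_def[abs_def] by measurable

lemma expectation_eb:
  "integrable M (eb i)"
  "expectation (eb i) \<le> (1 - \<beta>) ^ i * (2 * \<sigma> / sqrt (real K)) + Lh * Dd\<^sup>2 / \<beta> + sqrt (nv / \<beta>)"
proof -
  let ?r = "\<lambda>w. (1 - \<beta>) ^ i * norm (mean K (\<lambda>k. ini k w)) + Lh * Dd\<^sup>2 / \<beta> + norm (nz i w)"
  have le: "eb i w \<le> ?r w" for w
    using mean_ee_le[of "z0 w" "samp w" i] by (simp add: eb_def nz_def ee_0[abs_def])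
  have ir: "integrable M (\<lambda>w. norm (mean K (\<lambda>k. ini k w)))" "integrable M (\<lambda>w. norm (nz i w))"
    using mean_ini(1) nz_moments[of i] by (auto intro: integrable_norm_of_square)
  show ie: "integrable M (eb i)"
    using ir le
    by (intro Bochner_Integration.integrable_bound[of M ?r "eb i"])
      (auto intro!: AE_I2 order_trans[OF _ abs_ge_self] simp: eb_def)
  have "expectation (eb i) \<le> expectation ?r"
    using ie ir le by (intro integral_mono) auto
  also have "\<dots> = (1 - \<beta>) ^ i * expectation (\<lambda>w. norm (mean K (\<lambda>k. ini k w))) + Lh * Dd\<^sup>2 / \<beta>
      + expectation (\<lambda>w. norm (nz i w))"
    using ir by (simp add: prob_space)
  also have "\<dots> \<le> (1 - \<beta>) ^ i * (2 * \<sigma> / sqrt (real K)) + Lh * Dd\<^sup>2 / \<beta> + sqrt (nv / \<beta>)"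
    using \<beta> mean_ini(2) expectation_nz by (intro add_mono mult_left_mono order_refl) auto
  finally show "expectation (eb i) \<le> (1 - \<beta>) ^ i * (2 * \<sigma> / sqrt (real K)) + Lh * Dd\<^sup>2 / \<beta> + sqrt (nv / \<beta>)" .
qed

definition "Bd = sqrt (real K) * Dd"
definition "qd = Lh * (real K * Dd\<^sup>2) + 2 * (\<sigma>h * Bd + \<beta> * \<sigma>)"

lemma Bd_nonneg: "0 \<le> Bd" using Dd_nonneg by (simp add: Bd_def)

lemma qd_nonneg: "0 \<le> qd"
  using Bd_nonneg Lh sg sgh \<beta> by (simp add: qd_def)

lemma mean_zt:
  assumes k: "k < K"
  shows "integrable M (\<lambda>w. norm (mean N (\<lambda>n. zt i k n w)))"
    and "expectation (\<lambda>w. norm (mean N (\<lambda>n. zt i k n w))) \<le> 2 * (\<sigma>h * Bd + \<beta> * \<sigma>)"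
proof -
  have one: "expectation (\<lambda>w. norm (zt i k n w)) \<le> 2 * (\<sigma>h * Bd + \<beta> * \<sigma>)" if n: "n < N" for n
  proof (rule expectation_norm_le[OF zt_moments(1)[OF k n]])
    have "(\<integral>w. (norm (vt i k n w))\<^sup>2 \<partial>M) \<le> (\<integral>w. Bd\<^sup>2 \<partial>M)"
      using integrable_vt[OF k n] norm_vt[OF k n] unfolding Bd_def
      by (intro integral_mono power_mono) auto
    then have v: "(\<integral>w. (norm (vt i k n w))\<^sup>2 \<partial>M) \<le> Bd\<^sup>2" by (simp add: prob_space)
    have "(\<integral>w. (norm (zt i k n w))\<^sup>2 \<partial>M) \<le> 2 * \<sigma>h\<^sup>2 * Bd\<^sup>2 + 2 * \<beta>\<^sup>2 * \<sigma>\<^sup>2"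
      using zt_moments(2)[OF k n, of i] mult_left_mono[OF v, of "2 * \<sigma>h\<^sup>2"] by simp
    also have "\<dots> \<le> (2 * (\<sigma>h * Bd + \<beta> * \<sigma>))\<^sup>2"
      using Bd_nonneg sg sgh \<beta> by (simp add: power2_eq_square algebra_simps add_nonneg_nonneg)
    finally show "(\<integral>w. (norm (zt i k n w))\<^sup>2 \<partial>M) \<le> (2 * (\<sigma>h * Bd + \<beta> * \<sigma>))\<^sup>2" .
    show "0 \<le> 2 * (\<sigma>h * Bd + \<beta> * \<sigma>)" using Bd_nonneg sg sgh \<beta> by simp
  qed
  have "square_integrable M (\<lambda>w. mean N (\<lambda>n. zt i k n w))"
    unfolding mean_def using zt_moments(1)[OF k] by (intro square_integrable_scaleR square_integrable_sum) auto
  then show i: "integrable M (\<lambda>w. norm (mean N (\<lambda>n. zt i k n w)))" by (rule integrable_norm_of_square)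
  have in1: "integrable M (\<lambda>w. norm (zt i k n w))" if "n < N" for n
    by (rule integrable_norm_of_square[OF zt_moments(1)[OF k that]])
  have in2: "integrable M (\<lambda>w. mean N (\<lambda>n. norm (zt i k n w)))"
    unfolding mean_def using in1
    by (intro integrable_scaleR_right Bochner_Integration.integrable_sum) auto
  have "expectation (\<lambda>w. norm (mean N (\<lambda>n. zt i k n w))) \<le> expectation (\<lambda>w. mean N (\<lambda>n. norm (zt i k n w)))"
    using i in2 by (intro integral_mono norm_mean_le)
  also have "\<dots> = mean N (\<lambda>n. expectation (\<lambda>w. norm (zt i k n w)))"
    unfolding mean_def using in1
    by (subst integral_scaleR_right, subst Bochner_Integration.integral_sum) auto
  also have "\<dots> \<le> 2 * (\<sigma>h * Bd + \<beta> * \<sigma>)" by (rule mean_le[OF N one])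
  finally show "expectation (\<lambda>w. norm (mean N (\<lambda>n. zt i k n w))) \<le> 2 * (\<sigma>h * Bd + \<beta> * \<sigma>)" .
qed

lemma expectation_ee:
  assumes k: "k < K"
  shows "integrable M (\<lambda>w. norm (ee (z0 w) (samp w) i k))
    \<and> expectation (\<lambda>w. norm (ee (z0 w) (samp w) i k)) \<le> 2 * \<sigma> + qd / \<beta>"
proof (induction i)
  case 0
  have "expectation (\<lambda>w. norm (ini k w)) \<le> 2 * \<sigma>"
    using sg by (intro expectation_norm_le ini_moments(1)[OF k] order_trans[OF ini_moments(2)[OF k]])
      (auto simp: power_mult_distrib)
  moreover have "0 \<le> qd / \<beta>" using qd_nonneg \<beta> by simp
  ultimately show ?case
    unfolding ee_0 using integrable_norm_of_square[OF ini_moments(1)[OF k]] by auto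
next
  case (Suc i)
  let ?e = "\<lambda>i w. norm (ee (z0 w) (samp w) i k)"
  let ?r = "\<lambda>w. (1 - \<beta>) * ?e i w + Lh * (real K * Dd\<^sup>2) + norm (mean N (\<lambda>n. zt i k n w))"
  have le: "?e (Suc i) w \<le> ?r w" for w
    using norm_ee_Suc[OF k, of "z0 w" "samp w" i] by (simp add: zt_def)
  have ir: "integrable M ?r" using Suc mean_zt(1)[OF k] by auto
  have ie: "integrable M (?e (Suc i))"
    using measurable_gp_ee(2)[OF k, of "Suc i"] le
    by (intro Bochner_Integration.integrable_bound[OF ir]) (auto intro!: AE_I2 order_trans[OF _ abs_ge_self])
  have "expectation (?e (Suc i)) \<le> expectation ?r"
    using ie ir le by (intro integral_mono) auto
  also have "\<dots> = (1 - \<beta>) * expectation (?e i) + Lh * (real K * Dd\<^sup>2) + expectation (\<lambda>w. norm (mean N (\<lambda>n. zt i k n w)))"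
    using Suc mean_zt(1)[OF k] by (simp add: prob_space)
  also have "\<dots> \<le> (1 - \<beta>) * (2 * \<sigma> + qd / \<beta>) + Lh * (real K * Dd\<^sup>2) + 2 * (\<sigma>h * Bd + \<beta> * \<sigma>)"
    using Suc mean_zt(2)[OF k] \<beta> by (intro add_mono mult_left_mono order_refl) auto
  also have "\<dots> = (1 - \<beta>) * (2 * \<sigma>) + qd / \<beta>"
    using \<beta> by (simp add: qd_def field_simps)
  also have "\<dots> \<le> 2 * \<sigma> + qd / \<beta>" using \<beta> sg by (simp add: algebra_simps)
  finally show ?case using ie by blast
qed

definition "wd = 2 * \<beta> * \<sigma> + 2 * qd + L * Bd"

lemma wd_nonneg: "0 \<le> wd"
  using qd_nonneg Bd_nonneg sg L \<beta> by (simp add: wd_def)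

lemma expectation_mm_diff:
  assumes k: "k < K"
  shows "integrable M (\<lambda>w. norm (mm (z0 w) (samp w) (Suc i) k - mm (z0 w) (samp w) i k))"
    and "expectation (\<lambda>w. norm (mm (z0 w) (samp w) (Suc i) k - mm (z0 w) (samp w) i k)) \<le> wd"
proof -
  let ?d = "\<lambda>w. norm (mm (z0 w) (samp w) (Suc i) k - mm (z0 w) (samp w) i k)"
  let ?e = "\<lambda>w. norm (ee (z0 w) (samp w) i k)"
  let ?r = "\<lambda>w. \<beta> * ?e w + Lh * (real K * Dd\<^sup>2) + norm (mean N (\<lambda>n. zt i k n w)) + L * Bd"
  have le: "?d w \<le> ?r w" for w
    using norm_mm_diff[OF k, of "z0 w" "samp w" i] by (simp add: zt_def Bd_def)
  have ir: "integrable M ?r" using expectation_ee[OF k, of i] mean_zt(1)[OF k] by auto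
  show id: "integrable M ?d"
    using measurable_run(2)[OF k, of "Suc i"] measurable_run(2)[OF k, of i] le
    by (intro Bochner_Integration.integrable_bound[OF ir]) (auto intro!: AE_I2 order_trans[OF _ abs_ge_self])
  have "expectation ?d \<le> expectation ?r"
    using id ir le by (intro integral_mono) auto
  also have "\<dots> = \<beta> * expectation ?e + Lh * (real K * Dd\<^sup>2)
      + expectation (\<lambda>w. norm (mean N (\<lambda>n. zt i k n w))) + L * Bd"
    using expectation_ee[OF k, of i] mean_zt(1)[OF k] by (simp add: prob_space)
  also have "\<dots> \<le> \<beta> * (2 * \<sigma> + qd / \<beta>) + Lh * (real K * Dd\<^sup>2) + 2 * (\<sigma>h * Bd + \<beta> * \<sigma>) + L * Bd"
    using expectation_ee[OF k, of i] mean_zt(2)[OF k] \<beta> by (intro add_mono mult_left_mono order_refl) auto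
  also have "\<dots> = wd" using \<beta> by (simp add: wd_def qd_def field_simps)
  finally show "expectation ?d \<le> wd" .
qed

definition "ud i w = udev (z0 w) (samp w) i"

lemma expectation_ud:
  assumes "integrable M (ud 0)"
  shows "integrable M (ud i) \<and> expectation (ud i) \<le> lam ^ i * expectation (ud 0) + real K * wd / (1 - lam)"
proof (induction i)
  case 0
  then show ?case using assms lam wd_nonneg by auto
next
  case (Suc i)
  let ?d = "\<lambda>k w. norm (mm (z0 w) (samp w) (Suc i) k - mm (z0 w) (samp w) i k)"
  let ?r = "\<lambda>w. lam * (ud i w + (\<Sum>k<K. ?d k w))"
  have le: "ud (Suc i) w \<le> ?r w" for w unfolding ud_def by (rule udev_Suc)
  have id: "integrable M (\<lambda>w. \<Sum>k<K. ?d k w)"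
    using expectation_mm_diff(1) by (intro Bochner_Integration.integrable_sum) auto
  have ir: "integrable M ?r"
    using Suc id by (intro integrable_mult_right Bochner_Integration.integrable_add) auto
  have nn: "0 \<le> ud (Suc i) w" for w by (simp add: ud_def udev_def frob_nonneg)
  have ie: "integrable M (ud (Suc i))"
    using measurable_udev[of "Suc i"] le nn
    by (intro Bochner_Integration.integrable_bound[OF ir])
      (auto intro!: AE_I2 order_trans[OF _ abs_ge_self] simp: ud_def[abs_def])
  have "expectation (ud (Suc i)) \<le> expectation ?r"
    using ie ir le by (intro integral_mono) auto
  also have "\<dots> = lam * (expectation (ud i) + expectation (\<lambda>w. \<Sum>k<K. ?d k w))"
    using Suc id by simp
  also have "\<dots> = lam * (expectation (ud i) + (\<Sum>k<K. expectation (?d k)))"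
    using expectation_mm_diff(1) by (subst Bochner_Integration.integral_sum) auto
  also have "\<dots> \<le> lam * ((lam ^ i * expectation (ud 0) + real K * wd / (1 - lam)) + (\<Sum>k<K. wd))"
    using Suc expectation_mm_diff(2) lam by (intro mult_left_mono add_mono sum_mono) auto
  also have "\<dots> = lam ^ Suc i * expectation (ud 0) + (lam * (2 - lam)) * (real K * wd / (1 - lam))"
    using lam by (simp add: field_simps)
  also have "\<dots> \<le> lam ^ Suc i * expectation (ud 0) + 1 * (real K * wd / (1 - lam))"
  proof (rule add_left_mono, rule mult_right_mono)
    show "lam * (2 - lam) \<le> 1" using zero_le_power2[of "1 - lam"] by (simp add: power2_eq_square algebra_simps)
  qed (use lam wd_nonneg in auto)
  finally show ?case using ie by simp
qed

definition "ue i w = uerr (z0 w) (samp w) i"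

definition "tail_err = real K * wd / (1 - lam) + Lh * Dd\<^sup>2 / \<beta> + L * (\<eta> / L + sqrt (real K) * \<eta> / (1 - lam))"

lemma ue_nonneg: "0 \<le> ue i w"
  by (simp add: ue_def uerr_def sum_nonneg)

lemma expectation_ue:
  assumes ud0: "integrable M (ud 0)"
  shows "integrable M (ue i)"
    and "expectation (ue i) \<le> lam ^ Suc i * expectation (ud 0) + (1 - \<beta>) ^ Suc i * (2 * \<sigma> / sqrt (real K))
      + sqrt (nv / \<beta>) + tail_err"
proof -
  let ?c = "L * (\<eta> / L + sqrt (real K) * \<eta> / (1 - lam))"
  let ?r = "\<lambda>w. ud (Suc i) w + eb (Suc i) w + ?c"
  have le: "ue i w \<le> ?r w" for w
    unfolding ue_def ud_def eb_def by (rule uerr_le)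
  note iu = expectation_ud[OF ud0, of "Suc i"]
  have ir: "integrable M ?r" using iu expectation_eb(1)[of "Suc i"] by auto
  show ie: "integrable M (ue i)"
    using measurable_uerr[of i] le ue_nonneg
    by (intro Bochner_Integration.integrable_bound[OF ir])
      (auto intro!: AE_I2 order_trans[OF _ abs_ge_self] simp: ue_def[abs_def])
  have "expectation (ue i) \<le> expectation ?r"
    using ie ir le by (intro integral_mono) auto
  also have "\<dots> = expectation (ud (Suc i)) + expectation (eb (Suc i)) + ?c"
    using iu expectation_eb(1)[of "Suc i"] by (simp add: prob_space)
  also have "\<dots> \<le> (lam ^ Suc i * expectation (ud 0) + real K * wd / (1 - lam))
      + ((1 - \<beta>) ^ Suc i * (2 * \<sigma> / sqrt (real K)) + Lh * Dd\<^sup>2 / \<beta> + sqrt (nv / \<beta>)) + ?c"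
    by (intro add_mono order_refl iu[THEN conjunct2] expectation_eb(2))
  finally show "expectation (ue i) \<le> lam ^ Suc i * expectation (ud 0) + (1 - \<beta>) ^ Suc i * (2 * \<sigma> / sqrt (real K))
      + sqrt (nv / \<beta>) + tail_err"
    by (simp add: tail_err_def)
qed

lemma geometric_sum_le: "(\<Sum>i<T. r ^ Suc i) \<le> 1 / (1 - r)" if "0 \<le> r" "r < 1" for r :: real
proof -
  have "(\<Sum>i<T. r ^ Suc i) = r * (\<Sum>i<T. r ^ i)" by (simp add: sum_distrib_left)
  also have "\<dots> \<le> 1 * (\<Sum>i<T. r ^ i)" using that by (intro mult_right_mono sum_nonneg) auto
  also have "\<dots> = (1 - r ^ T) / (1 - r)" using that by (simp add: sum_gp_strict)
  also have "\<dots> \<le> 1 / (1 - r)" using that by (intro divide_right_mono) auto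
  finally show ?thesis .
qed

lemma sum_expectation_ue:
  assumes ud0: "integrable M (ud 0)"
  shows "(\<Sum>i<T. expectation (ue i)) \<le> expectation (ud 0) / (1 - lam) + 2 * \<sigma> / (\<beta> * sqrt (real K))
    + real T * (sqrt (nv / \<beta>) + tail_err)"
proof -
  have nn: "0 \<le> expectation (ud 0)" by (intro Bochner_Integration.integral_nonneg) (simp add: ud_def udev_def frob_nonneg)
  have "(\<Sum>i<T. expectation (ue i)) \<le> (\<Sum>i<T. lam ^ Suc i * expectation (ud 0)
      + (1 - \<beta>) ^ Suc i * (2 * \<sigma> / sqrt (real K)) + (sqrt (nv / \<beta>) + tail_err))"
    using expectation_ue(2)[OF ud0] by (intro sum_mono) (simp add: add.assoc)
  also have "\<dots> = (\<Sum>i<T. lam ^ Suc i) * expectation (ud 0)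
      + (\<Sum>i<T. (1 - \<beta>) ^ Suc i) * (2 * \<sigma> / sqrt (real K)) + real T * (sqrt (nv / \<beta>) + tail_err)"
    unfolding sum.distrib sum_distrib_right by (simp add: distrib_left)
  also have "\<dots> \<le> (1 / (1 - lam)) * expectation (ud 0) + (1 / (1 - (1 - \<beta>))) * (2 * \<sigma> / sqrt (real K))
      + real T * (sqrt (nv / \<beta>) + tail_err)"
    using lam \<beta> nn sg by (intro add_mono mult_right_mono geometric_sum_le order_refl) auto
  finally show ?thesis by simp
qed

end

section \<open>Descent\<close>

locale dima_minimax = dima_prob K N nb A D Q L Lh \<sigma> \<sigma>h \<beta> \<eta>x \<eta>y M z0 \<xi>
  for K N nb A and D :: "nat \<Rightarrow> 's measure"
    and Q :: "nat \<Rightarrow> 'x::euclidean_space \<times> 'y::euclidean_space \<Rightarrow> 's \<Rightarrow> real"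
    and L Lh \<sigma> \<sigma>h \<beta> \<eta>x \<eta>y
    and M :: "'w measure" and z0 :: "'w \<Rightarrow> 'x \<times> 'y" and \<xi> :: "sample_idx \<Rightarrow> 'w \<Rightarrow> 's" +
  fixes \<nu> \<Delta>0 :: real
  assumes pl_J: "pl_condition (global_obj K D Q) \<nu>"
    and gap: "initial_gap K D Q M z0 \<Delta>0"
    and \<eta>_pos: "0 < \<eta>x" "0 < \<eta>y"
    and ratio: "\<eta>x \<le> \<eta>y / (2 * (L / \<nu>))"
begin

sublocale obj: pl_objective J L \<nu>
proof
  show "GDERIV J z :> grad J z" for z using GDERIV_J[of z] by (simp add: grad_J)
  show "pl_condition J \<nu>" using pl_J by (simp add: J_def)
qed (use Lip_J L in auto)

lemma gapD:
  "integrable M (\<lambda>w. J (z0 w))" "integrable M (\<lambda>w. primal J (fst (z0 w)))"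
  "k < K \<Longrightarrow> integrable M (\<lambda>w. norm (gJ k (z0 w)))"
  "(\<integral>w. primal J (fst (z0 w)) \<partial>M) - (INF x. primal J x) \<le> \<Delta>0"
  "(\<integral>w. primal J (fst (z0 w)) - J (z0 w) \<partial>M) \<le> \<Delta>0"
  using gap by (auto simp: initial_gap_def Let_def J_def gJ_def)

definition "zt_c i w = zc (z0 w) (samp w) i"

lemma zt_c_measurable[measurable]: "zt_c i \<in> borel_measurable M"
  unfolding zt_c_def[abs_def] by measurable

lemma dist_zt_c: "norm (zt_c i w - z0 w) \<le> real i * \<eta>"
  unfolding zt_c_def by (rule norm_zc_diff)

lemma integrable_grad_z0: "integrable M (\<lambda>w. norm (grad J (z0 w)))"
proof (rule Bochner_Integration.integrable_bound)
  show "integrable M (\<lambda>w. \<Sum>k<K. norm (gJ k (z0 w)))"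
    using gapD(3) by (intro Bochner_Integration.integrable_sum) auto
  show "(\<lambda>w. norm (grad J (z0 w))) \<in> borel_measurable M"
    using measurable_grad_J[OF z0] by measurable
  have "norm (grad J (z0 w)) \<le> (\<Sum>k<K. norm (gJ k (z0 w)))" for w
  proof -
    have "norm (grad J (z0 w)) \<le> mean K (\<lambda>k. norm (gJ k (z0 w)))"
      unfolding grad_J by (rule norm_mean_le)
    also have "\<dots> \<le> (\<Sum>k<K. norm (gJ k (z0 w)))"
      by (intro mean_le K member_le_sum) auto
    finally show ?thesis .
  qed
  then show "AE w in M. norm (norm (grad J (z0 w))) \<le> norm (\<Sum>k<K. norm (gJ k (z0 w)))"
    by (intro AE_I2) (auto intro: order_trans[OF _ abs_ge_self])
qed

lemma integrable_of_gradient_bound: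
  assumes f: "f \<in> borel_measurable borel" and c: "0 \<le> c" and le: "\<And>z. \<bar>f z\<bar> \<le> c * norm (grad J z)"
  shows "integrable M (\<lambda>w. f (zt_c i w))"
proof (rule Bochner_Integration.integrable_bound)
  show "integrable M (\<lambda>w. c * (norm (grad J (z0 w)) + L * (real i * \<eta>)))"
    using integrable_grad_z0 by auto
  show "(\<lambda>w. f (zt_c i w)) \<in> borel_measurable M" by (rule measurable_compose[OF zt_c_measurable f])
  have "\<bar>f (zt_c i w)\<bar> \<le> c * (norm (grad J (z0 w)) + L * (real i * \<eta>))" for w
  proof -
    have "norm (grad J (zt_c i w)) \<le> norm (grad J (z0 w)) + norm (grad J (zt_c i w) - grad J (z0 w))"
      by (rule norm_triangle_sub)
    also have "norm (grad J (zt_c i w) - grad J (z0 w)) \<le> L * (real i * \<eta>)"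
      using Lip_J[of "zt_c i w" "z0 w"] mult_left_mono[OF dist_zt_c[of i w], of L] L by linarith
    finally show ?thesis using le[of "zt_c i w"] c by (meson add_left_mono mult_left_mono order_trans)
  qed
  then show "AE w in M. norm (f (zt_c i w)) \<le> norm (c * (norm (grad J (z0 w)) + L * (real i * \<eta>)))"
    by (intro AE_I2) (auto intro: order_trans[OF _ abs_ge_self])
qed

lemma kappa_nonneg: "0 \<le> L / \<nu>" using L obj.nu_pos by simp

lemma integrable_crit: "integrable M (\<lambda>w. obj.crit (zt_c i w))"
  using obj.crit_le obj.crit_nonneg kappa_nonneg
  by (intro integrable_of_gradient_bound[where c="1 + 4 * (L / \<nu>)"]
      borel_measurable_continuous_onI obj.continuous_crit) auto

lemma integrable_grad_y: "integrable M (\<lambda>w. norm (snd (grad J (zt_c i w))))"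
proof (rule integrable_of_gradient_bound[where c=1])
  have "(\<lambda>z. grad J z) \<in> borel_measurable borel"
    unfolding grad_J by (intro borel_measurable_mean measurable_gJ) auto
  from borel_measurable_snd_euclidean[OF this]
  show "(\<lambda>z. norm (snd (grad J z))) \<in> borel_measurable borel" by measurable
qed (simp_all del: split_paired_All add: norm_snd_le_norm)

lemma integrable_quadratic:
  assumes f: "f \<in> borel_measurable borel" and c: "0 \<le> c" "0 \<le> c2"
    and f0: "integrable M (\<lambda>w. f (z0 w))"
    and le: "\<And>z z'. \<bar>f z' - f z\<bar> \<le> c * norm (grad J z) * norm (z' - z) + c2 * (norm (z' - z))\<^sup>2"
  shows "integrable M (\<lambda>w. f (zt_c i w))"
proof (rule Bochner_Integration.integrable_bound)
  let ?R = "real i * \<eta>"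
  let ?r = "\<lambda>w. \<bar>f (z0 w)\<bar> + (c * norm (grad J (z0 w)) * ?R + c2 * ?R\<^sup>2)"
  show "integrable M ?r" using integrable_grad_z0 f0 by auto
  show "(\<lambda>w. f (zt_c i w)) \<in> borel_measurable M" by (rule measurable_compose[OF zt_c_measurable f])
  have "\<bar>f (zt_c i w)\<bar> \<le> ?r w" for w
  proof -
    have "c * norm (grad J (z0 w)) * norm (zt_c i w - z0 w) + c2 * (norm (zt_c i w - z0 w))\<^sup>2
        \<le> c * norm (grad J (z0 w)) * ?R + c2 * ?R\<^sup>2"
      using dist_zt_c[of i w] c by (intro add_mono mult_left_mono power_mono) auto
    then show ?thesis using le[of "zt_c i w" "z0 w"] by linarith
  qed
  then show "AE w in M. norm (f (zt_c i w)) \<le> norm (?r w)"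
    by (intro AE_I2) (auto intro: order_trans[OF _ abs_ge_self])
qed

lemma integrable_J: "integrable M (\<lambda>w. J (zt_c i w))"
proof (rule integrable_quadratic[where c=1 and ?c2.0=L])
  fix z z'
  show "\<bar>J z' - J z\<bar> \<le> 1 * norm (grad J z) * norm (z' - z) + L * (norm (z' - z))\<^sup>2"
    using obj.quad[of z' z] Cauchy_Schwarz_ineq2[of "grad J z" "z' - z"] by linarith
qed (use L gapD obj.continuous_J borel_measurable_continuous_onI in auto)

lemma integrable_primal: "integrable M (\<lambda>w. primal J (fst (zt_c i w)))"
proof (rule integrable_quadratic[where f="\<lambda>z. primal J (fst z)" and c="1 + 4 * (L / \<nu>)" and ?c2.0=obj.LP])
  have D: "(primal J has_derivative (\<lambda>h. h \<bullet> grad (primal J) x)) (at x)" for x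
    using quadratic_remainder_imp_GDERIV[OF obj.primal_descent] unfolding gderiv_def .
  have "continuous_on UNIV (primal J)"
    by (intro continuous_at_imp_continuous_on ballI has_derivative_continuous[OF D])
  then have "continuous_on UNIV (\<lambda>z :: 'x \<times> 'y. primal J (fst z))"
    by (rule continuous_on_compose2) (simp_all add: continuous_on_fst)
  then show "(\<lambda>z :: 'x \<times> 'y. primal J (fst z)) \<in> borel_measurable borel"
    by (rule borel_measurable_continuous_onI)
  fix z z' :: "'x \<times> 'y"
  have n: "norm (fst z' - fst z) \<le> norm (z' - z)"
    using norm_fst_le_norm[of "z' - z"] by simp
  have g: "norm (grad (primal J) (fst z)) \<le> (1 + 4 * (L / \<nu>)) * norm (grad J z)"
  proof -
    have "0 \<le> 2 * L * infdist (snd z) (maximizers J (fst z))"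
      using L by (intro mult_nonneg_nonneg infdist_nonneg) auto
    then show ?thesis using obj.crit_le[of z] unfolding obj.crit_def by linarith
  qed
  have "\<bar>grad (primal J) (fst z) \<bullet> (fst z' - fst z)\<bar> \<le> norm (grad (primal J) (fst z)) * norm (fst z' - fst z)"
    by (rule Cauchy_Schwarz_ineq2)
  also have "\<dots> \<le> (1 + 4 * (L / \<nu>)) * norm (grad J z) * norm (z' - z)"
    using g n kappa_nonneg by (intro mult_mono) auto
  finally have 1: "\<bar>grad (primal J) (fst z) \<bullet> (fst z' - fst z)\<bar> \<le> (1 + 4 * (L / \<nu>)) * norm (grad J z) * norm (z' - z)" .
  have "obj.LP * (norm (fst z' - fst z))\<^sup>2 \<le> obj.LP * (norm (z' - z))\<^sup>2"
    using n obj.LP_pos by (intro mult_left_mono power_mono) auto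
  then show "\<bar>primal J (fst z') - primal J (fst z)\<bar>
      \<le> (1 + 4 * (L / \<nu>)) * norm (grad J z) * norm (z' - z) + obj.LP * (norm (z' - z))\<^sup>2"
    using 1 obj.primal_descent[of "fst z'" "fst z"] by linarith
qed (use kappa_nonneg obj.LP_pos gapD in auto)

lemma ud_0_le: "ud 0 w \<le> 2 * (\<Sum>k<K. norm (ini k w) + norm (gJ k (z0 w)))"
proof -
    let ?u = "\<lambda>k. ini k w + gJ k (z0 w)"
    let ?S = "\<Sum>k<K. norm (ini k w) + norm (gJ k (z0 w))"
    have "ud 0 w = frob K (\<lambda>k. ?u k - mean K ?u)"
      by (simp add: ud_def udev_def run_0 ini_def cong: frob_cong mean_cong)
    also have "\<dots> \<le> frob K ?u + frob K (\<lambda>k. mean K ?u)" by (rule frob_triangle_diff)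
    also have "frob K ?u \<le> ?S"
      by (intro order_trans[OF frob_le_sum] sum_mono norm_triangle_ineq)
    also have "frob K (\<lambda>k. mean K ?u) \<le> (\<Sum>k<K. norm (mean K ?u))" by (rule frob_le_sum)
    also have "\<dots> \<le> ?S"
    proof -
      have "(\<Sum>k<K. norm (mean K ?u)) = norm (\<Sum>k<K. ?u k)" using K by (simp add: mean_def)
      also have "\<dots> \<le> ?S" by (intro order_trans[OF norm_sum] sum_mono norm_triangle_ineq)
      finally show ?thesis .
    qed
    finally show ?thesis by simp
  qed

lemma integrable_ud0: "integrable M (ud 0)"
proof (rule Bochner_Integration.integrable_bound)
  show "integrable M (\<lambda>w. 2 * (\<Sum>k<K. norm (ini k w) + norm (gJ k (z0 w))))"
    using gapD(3) integrable_norm_of_square[OF ini_moments(1)]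
    by (intro integrable_mult_right Bochner_Integration.integrable_sum Bochner_Integration.integrable_add) auto
  show "ud 0 \<in> borel_measurable M"
    using measurable_udev[of 0] by (simp add: ud_def[abs_def])
  have "0 \<le> ud 0 w" for w by (simp add: ud_def udev_def frob_nonneg)
  then show "AE w in M. norm (ud 0 w) \<le> norm (2 * (\<Sum>k<K. norm (ini k w) + norm (gJ k (z0 w))))"
    using ud_0_le by (intro AE_I2) (auto intro: order_trans[OF _ abs_ge_self])
qed

abbreviation "gy i w \<equiv> norm (snd (grad J (zt_c i w)))"
abbreviation "P i w \<equiv> primal J (fst (zt_c i w))"
abbreviation "\<kappa> \<equiv> L / \<nu>"

lemma zt_c_Suc:
  "fst (zt_c (Suc i) w) = fst (zt_c i w) - \<eta>x *\<^sub>R ((1 / real K) *\<^sub>R (\<Sum>k<K. sgn (fst (uu (z0 w) (samp w) (Suc i) k))))"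
  "snd (zt_c (Suc i) w) = snd (zt_c i w) + \<eta>y *\<^sub>R ((1 / real K) *\<^sub>R (\<Sum>k<K. sgn (snd (uu (z0 w) (samp w) (Suc i) k))))"
  by (simp_all add: zt_c_def zc_Suc mean_def dir_def fst_sum snd_sum sum_negf
      scaleR_sum_right[symmetric] mult.commute)

lemma step_bounds:
  "\<eta>x * obj.crit (zt_c i w) \<le> P i w - P (Suc i) w + 16 / 3 * \<kappa> * \<eta>x * gy i w
    + 2 * \<eta>x * ue i w + obj.LP * \<eta>x\<^sup>2"
  "\<eta>y / 3 * gy i w \<le> (P i w - J (zt_c i w)) - (P (Suc i) w - J (zt_c (Suc i) w))
    + 2 * \<eta>y * ue i w + obj.LP * \<eta>x\<^sup>2 + L * \<eta>\<^sup>2"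
proof -
  define d where "d = L * infdist (snd (zt_c i w)) (maximizers J (fst (zt_c i w)))"
  have d: "d \<le> 4 / 3 * \<kappa> * gy i w"
    using obj.L_infdist_le[of "snd (zt_c i w)" "fst (zt_c i w)"] by (simp add: d_def)
  have ue: "ue i w = (1 / real K) * (\<Sum>k<K. norm (uu (z0 w) (samp w) (Suc i) k - grad J (zt_c i w)))"
    by (simp add: ue_def uerr_def zt_c_def)
  note os = obj.one_step[OF K \<eta> zt_c_Suc[of i w], folded ue d_def]
  have crit: "obj.crit (zt_c i w) = norm (grad (primal J) (fst (zt_c i w))) + 2 * d"
    by (simp add: obj.crit_def d_def)
  have xd: "\<eta>x * d \<le> \<eta>x * (4 / 3 * \<kappa> * gy i w)"
    using d \<eta> by (intro mult_left_mono)
  show "\<eta>x * obj.crit (zt_c i w) \<le> P i w - P (Suc i) w + 16 / 3 * \<kappa> * \<eta>x * gy i w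
    + 2 * \<eta>x * ue i w + obj.LP * \<eta>x\<^sup>2"
  proof -
    have "16 / 3 * \<kappa> * \<eta>x * gy i w = 4 * (\<eta>x * (4 / 3 * \<kappa> * gy i w))"
      "\<eta>x * obj.crit (zt_c i w) = \<eta>x * norm (grad (primal J) (fst (zt_c i w))) + 2 * (\<eta>x * d)"
      "2 * \<eta>x * (d + ue i w) = 2 * (\<eta>x * d) + 2 * \<eta>x * ue i w"
      by (simp_all add: crit algebra_simps)
    then show ?thesis using os(1) xd by linarith
  qed
  have "\<eta>x * \<kappa> \<le> \<eta>y / 2"
    using ratio L obj.nu_pos by (simp add: field_simps)
  then have A: "\<eta>x * \<kappa> * (4 / 3 * gy i w) \<le> \<eta>y / 2 * (4 / 3 * gy i w)"
    by (intro mult_right_mono) auto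
  have "\<eta>x * d \<le> \<eta>x * (4 / 3 * \<kappa> * gy i w)" by (rule xd)
  also have "\<dots> = \<eta>x * \<kappa> * (4 / 3 * gy i w)" by simp
  also note A
  also have "\<eta>y / 2 * (4 / 3 * gy i w) = \<eta>y * gy i w - \<eta>y / 3 * gy i w" by simp
  finally have "\<eta>x * d \<le> \<eta>y * gy i w - \<eta>y / 3 * gy i w" .
 then show "\<eta>y / 3 * gy i w \<le> (P i w - J (zt_c i w)) - (P (Suc i) w - J (zt_c (Suc i) w))
    + 2 * \<eta>y * ue i w + obj.LP * \<eta>x\<^sup>2 + L * \<eta>\<^sup>2"
    using os(2) unfolding \<eta>_def by linarith
qed

definition "U T = (\<Sum>i<T. expectation (ue i))"

lemma U_nonneg: "0 \<le> U T"
  unfolding U_def by (intro sum_nonneg Bochner_Integration.integral_nonneg ue_nonneg)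

lemma sum_crit:
  "(\<Sum>i<T. expectation (\<lambda>w. obj.crit (zt_c i w)))
    \<le> \<Delta>0 / \<eta>x + 16 * \<kappa> / \<eta>y * (\<Delta>0 + 2 * \<eta>y * U T + real T * (obj.LP * \<eta>x\<^sup>2 + L * \<eta>\<^sup>2))
      + 2 * U T + real T * (obj.LP * \<eta>x)"
proof -
  note int = integrable_crit integrable_grad_y integrable_primal integrable_J expectation_ue(1)[OF integrable_ud0]
  define p j where "p = (\<lambda>i. expectation (P i))" and "j = (\<lambda>i. expectation (\<lambda>w. J (zt_c i w)))"
  define g c where "g = (\<lambda>i. expectation (gy i))" and "c = (\<lambda>i. expectation (\<lambda>w. obj.crit (zt_c i w)))"
  have 0: "zt_c 0 w = z0 w" for w by (simp add: zt_c_def zc_0)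
  have "\<eta>x * c i \<le> p i - p (Suc i) + 16 / 3 * \<kappa> * \<eta>x * g i + 2 * \<eta>x * expectation (ue i) + obj.LP * \<eta>x\<^sup>2" for i
  proof -
    have "expectation (\<lambda>w. \<eta>x * obj.crit (zt_c i w)) \<le> expectation (\<lambda>w. P i w - P (Suc i) w + 16 / 3 * \<kappa> * \<eta>x * gy i w
      + 2 * \<eta>x * ue i w + obj.LP * \<eta>x\<^sup>2)"
      using int step_bounds(1) by (intro integral_mono) auto
    then show ?thesis using int by (simp add: p_def g_def c_def prob_space)
  qed
  then have "(\<Sum>i<T. \<eta>x * c i) \<le> (\<Sum>i<T. p i - p (Suc i) + 16 / 3 * \<kappa> * \<eta>x * g i + 2 * \<eta>x * expectation (ue i) + obj.LP * \<eta>x\<^sup>2)"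
    by (intro sum_mono)
  also have "\<dots> = (p 0 - p T) + 16 / 3 * \<kappa> * \<eta>x * sum g {..<T} + 2 * \<eta>x * U T + real T * (obj.LP * \<eta>x\<^sup>2)"
    by (simp add: sum.distrib sum_lessThan_telescope' sum_distrib_left U_def)
  also have "p 0 - p T \<le> \<Delta>0"
  proof -
    have "(INF x. primal J x) \<le> expectation (P T)"
      using int obj.primal_bdd by (intro integral_ge_const) (auto intro!: AE_I2 cINF_lower)
    then show ?thesis using gapD(4) by (simp add: p_def 0)
  qed
  finally have A: "\<eta>x * sum c {..<T} \<le> \<Delta>0 + 16 / 3 * \<kappa> * \<eta>x * sum g {..<T} + 2 * \<eta>x * U T + real T * (obj.LP * \<eta>x\<^sup>2)"
    by (simp add: sum_distrib_left)
  let ?e = "obj.LP * \<eta>x\<^sup>2 + L * \<eta>\<^sup>2"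
  have "\<eta>y / 3 * g i \<le> (p i - j i) - (p (Suc i) - j (Suc i)) + 2 * \<eta>y * expectation (ue i) + ?e" for i
  proof -
    have "expectation (\<lambda>w. \<eta>y / 3 * gy i w) \<le> expectation (\<lambda>w. (P i w - J (zt_c i w)) - (P (Suc i) w - J (zt_c (Suc i) w))
      + 2 * \<eta>y * ue i w + obj.LP * \<eta>x\<^sup>2 + L * \<eta>\<^sup>2)"
      using int step_bounds(2) by (intro integral_mono) auto
    then show ?thesis using int by (simp add: p_def g_def j_def prob_space)
  qed
  then have "(\<Sum>i<T. \<eta>y / 3 * g i) \<le> (\<Sum>i<T. ((p i - j i) - (p (Suc i) - j (Suc i))) + 2 * \<eta>y * expectation (ue i) + ?e)"
    by (intro sum_mono) auto
  also have "\<dots> = (\<Sum>i<T. (p i - j i) - (p (Suc i) - j (Suc i))) + 2 * \<eta>y * U T + real T * ?e"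
    unfolding sum.distrib sum_distrib_left U_def by (simp add: distrib_left)
  also have "(\<Sum>i<T. (p i - j i) - (p (Suc i) - j (Suc i))) = (p 0 - j 0) - (p T - j T)"
    by (rule sum_lessThan_telescope')
  also have "\<dots> \<le> \<Delta>0"
  proof -
    have "0 \<le> expectation (\<lambda>w. P T w - J (zt_c T w))"
      using obj.J_le_primal by (intro Bochner_Integration.integral_nonneg) (metis diff_ge_0_iff_ge prod.collapse)
    then have "0 \<le> p T - j T" using int by (simp add: p_def j_def)
    moreover have "p 0 - j 0 \<le> \<Delta>0" using gapD(5) gapD(1,2) by (simp add: p_def j_def 0)
    ultimately show ?thesis by linarith
  qed
  finally have "\<eta>y / 3 * sum g {..<T} \<le> \<Delta>0 + 2 * \<eta>y * U T + real T * ?e"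
    by (simp add: sum_distrib_left)
  then have B: "sum g {..<T} \<le> 3 / \<eta>y * (\<Delta>0 + 2 * \<eta>y * U T + real T * ?e)"
    using \<eta>_pos by (simp add: field_simps)
  have "sum c {..<T} \<le> (\<Delta>0 + 16 / 3 * \<kappa> * \<eta>x * sum g {..<T} + 2 * \<eta>x * U T + real T * (obj.LP * \<eta>x\<^sup>2)) / \<eta>x"
    using A \<eta>_pos by (simp add: pos_le_divide_eq mult.commute)
  also have "\<dots> = \<Delta>0 / \<eta>x + 16 / 3 * \<kappa> * sum g {..<T} + 2 * U T + real T * (obj.LP * \<eta>x)"
    using \<eta>_pos by (simp add: add_divide_distrib power2_eq_square)
  also have "16 / 3 * \<kappa> * sum g {..<T} \<le> 16 / 3 * \<kappa> * (3 / \<eta>y * (\<Delta>0 + 2 * \<eta>y * U T + real T * ?e))"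
    using B kappa_nonneg by (intro mult_left_mono) auto
  also have "\<dots> = 16 * \<kappa> / \<eta>y * (\<Delta>0 + 2 * \<eta>y * U T + real T * ?e)"
    using obj.nu_pos \<eta>_pos by (simp add: field_simps)
  finally show ?thesis by (simp add: c_def)
qed

end

section \<open>Rates\<close>

definition tail_const :: "nat \<Rightarrow> real \<Rightarrow> real \<Rightarrow> real \<Rightarrow> real \<Rightarrow> real \<Rightarrow> real \<Rightarrow> real \<Rightarrow> real" where
  "tail_const K lam L Lh \<sigma> \<sigma>h b e =
    (let d = (2 / L + 3) * e / (1 - lam);
         q = Lh * (real K * d\<^sup>2) + 2 * (\<sigma>h * (sqrt (real K) * d) + b * \<sigma>);
         w = 2 * b * \<sigma> + 2 * q + L * (sqrt (real K) * d)
     in real K * w / (1 - lam) + Lh * d\<^sup>2 / b + L * (e / L + sqrt (real K) * e / (1 - lam)))"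

context dima_prob
begin

lemma tail_err_le:
  assumes t: "0 < t" "t \<le> 1" and b: "0 < b" "\<beta> = b * t\<^sup>2" and e: "0 \<le> e" "\<eta> \<le> e * t\<^sup>2"
  shows "tail_err \<le> tail_const K lam L Lh \<sigma> \<sigma>h b e * t\<^sup>2"
proof -
  define d where "d = (2 / L + 3) * e / (1 - lam)"
  define q where "q = Lh * (real K * d\<^sup>2) + 2 * (\<sigma>h * (sqrt (real K) * d) + b * \<sigma>)"
  define w where "w = 2 * b * \<sigma> + 2 * q + L * (sqrt (real K) * d)"
  have t4: "(t\<^sup>2)\<^sup>2 \<le> t\<^sup>2" using t by (simp add: power2_eq_square mult_le_one mult_left_le)
  have Dd: "Dd \<le> d * t\<^sup>2"
  proof -
    have "(2 / L + 3) * \<eta> / (1 - lam) \<le> (2 / L + 3) * (e * t\<^sup>2) / (1 - lam)"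
      using e L lam by (intro divide_right_mono mult_left_mono) auto
    then show ?thesis by (simp add: Dd_def d_def)
  qed
  have Dd2: "Dd\<^sup>2 \<le> d\<^sup>2 * (t\<^sup>2)\<^sup>2"
    using power_mono[OF Dd Dd_nonneg, where n=2] by (simp add: power_mult_distrib)
  have Dd2': "Dd\<^sup>2 \<le> d\<^sup>2 * t\<^sup>2"
    using Dd2 mult_left_mono[OF t4, of "d\<^sup>2"] by simp
  have Bd: "Bd \<le> sqrt (real K) * d * t\<^sup>2"
    using mult_left_mono[OF Dd, of "sqrt (real K)"] by (simp add: Bd_def mult.assoc)
  have qd: "qd \<le> q * t\<^sup>2"
  proof -
    have "qd \<le> Lh * (real K * (d\<^sup>2 * t\<^sup>2)) + 2 * (\<sigma>h * (sqrt (real K) * d * t\<^sup>2) + \<beta> * \<sigma>)"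
      unfolding qd_def
      using Dd2' Bd Lh sgh by (intro add_mono mult_left_mono order_refl) auto
    also have "\<dots> = q * t\<^sup>2" by (simp add: q_def b(2) algebra_simps)
    finally show ?thesis .
  qed
  have wd: "wd \<le> w * t\<^sup>2"
  proof -
    have "wd \<le> 2 * \<beta> * \<sigma> + 2 * (q * t\<^sup>2) + L * (sqrt (real K) * d * t\<^sup>2)"
      unfolding wd_def using qd Bd L by (intro add_mono mult_left_mono order_refl) auto
    also have "\<dots> = w * t\<^sup>2" by (simp add: w_def b(2) algebra_simps)
    finally show ?thesis .
  qed
  have "tail_err \<le> real K * (w * t\<^sup>2) / (1 - lam) + Lh * (d\<^sup>2 * (t\<^sup>2)\<^sup>2) / \<beta>
      + L * ((e * t\<^sup>2) / L + sqrt (real K) * (e * t\<^sup>2) / (1 - lam))"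
    unfolding tail_err_def using wd Dd2 e L lam Lh \<beta>
    by (intro add_mono mult_left_mono divide_right_mono) auto
  also have "Lh * (d\<^sup>2 * (t\<^sup>2)\<^sup>2) / \<beta> = Lh * d\<^sup>2 / b * t\<^sup>2"
    using t b by (simp add: power2_eq_square)
  also have "real K * (w * t\<^sup>2) / (1 - lam) + Lh * d\<^sup>2 / b * t\<^sup>2
      + L * ((e * t\<^sup>2) / L + sqrt (real K) * (e * t\<^sup>2) / (1 - lam))
    = tail_const K lam L Lh \<sigma> \<sigma>h b e * t\<^sup>2"
    unfolding tail_const_def Let_def d_def[symmetric] q_def[symmetric] w_def[symmetric]
    by (simp add: distrib_left distrib_right mult_ac)
  finally show ?thesis .
qed

end

definition low_const :: "nat \<Rightarrow> real \<Rightarrow> real \<Rightarrow> real \<Rightarrow> real \<Rightarrow> real \<Rightarrow> real \<Rightarrow> real \<Rightarrow> real \<Rightarrow> real \<Rightarrow> real \<Rightarrow> real" where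
  "low_const K lam L Lh \<sigma> \<sigma>h \<nu> u0 b x y =
    34 * (L / \<nu>) * (u0 / (1 - lam) + tail_const K lam L Lh \<sigma> \<sigma>h b (2 * y))
    + 16 * (L / \<nu>) * ((L + L\<^sup>2 / (2 * \<nu>)) * x\<^sup>2 + L * (2 * y)\<^sup>2) / y + (L + L\<^sup>2 / (2 * \<nu>)) * x"

definition lead_const :: "real \<Rightarrow> real \<Rightarrow> real \<Rightarrow> real \<Rightarrow> real \<Rightarrow> real \<Rightarrow> real \<Rightarrow> real" where
  "lead_const L \<sigma> \<sigma>h \<Delta>0 cb cy cx = \<bar>\<Delta>0\<bar> / cx + 16 * \<bar>\<Delta>0\<bar> / cy
    + 34 * (2 * \<sigma> / cb + sqrt ((2 * \<sigma>h\<^sup>2 * (2 * (2 / L + 3) * cy)\<^sup>2 + 2 * cb\<^sup>2 * \<sigma>\<^sup>2) / cb)) + 1"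

lemma lead_const_pos:
  "0 \<le> \<sigma> \<Longrightarrow> 0 < cb \<Longrightarrow> 0 < cy \<Longrightarrow> 0 < cx \<Longrightarrow> 0 < lead_const L \<sigma> \<sigma>h \<Delta>0 cb cy cx"
  by (simp add: lead_const_def add_nonneg_pos)

context dima_minimax
begin

definition "u0 = 2 * (\<Sum>k<K. 2 * \<sigma> + (\<integral>w. norm (grad (local_obj D Q k) (z0 w)) \<partial>M))"

lemma expectation_ud0: "expectation (ud 0) \<le> u0"
proof -
  have ini: "expectation (\<lambda>w. norm (ini k w)) \<le> 2 * \<sigma>" if k: "k < K" for k
    using sg by (intro expectation_norm_le ini_moments(1)[OF k] order_trans[OF ini_moments(2)[OF k]])
      (auto simp: power_mult_distrib)
  have i: "integrable M (\<lambda>w. norm (ini k w))" if "k < K" for k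
    by (rule integrable_norm_of_square[OF ini_moments(1)[OF that]])
  have "expectation (ud 0) \<le> expectation (\<lambda>w. 2 * (\<Sum>k<K. norm (ini k w) + norm (gJ k (z0 w))))"
    using i gapD(3) ud_0_le integrable_ud0
    by (intro integral_mono integrable_mult_right Bochner_Integration.integrable_sum
        Bochner_Integration.integrable_add) auto
  also have "\<dots> = 2 * (\<Sum>k<K. expectation (\<lambda>w. norm (ini k w)) + expectation (\<lambda>w. norm (gJ k (z0 w))))"
    using i gapD(3) by (subst integral_mult_right_zero, subst Bochner_Integration.integral_sum) auto
  also have "\<dots> \<le> u0"
    unfolding u0_def gJ_def using ini by (intro mult_left_mono sum_mono add_mono order_refl) auto
  finally show ?thesis .
qed

lemma average_bound:
  fixes t a \<rho> cb cy cx :: real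
  assumes t: "0 < t" "t \<le> 1" "real T * t ^ 3 = 1"
    and a: "0 < a" "a ^ 3 = real (N * K)" and \<rho>: "0 < \<rho>" "\<rho>\<^sup>2 = 1 - lam"
    and c: "0 < cb" "0 < cy" "0 < cx"
    and \<beta>_eq: "\<beta> = cb * a * t\<^sup>2" and y_eq: "\<eta>y = cy * \<rho> * a * t\<^sup>2"
    and x_eq: "\<eta>x = cx * \<rho> * a / \<kappa> * t\<^sup>2" and \<kappa>: "1 < \<kappa>"
    and low: "t * low_const K lam L Lh \<sigma> \<sigma>h \<nu> u0 (cb * a) (cx * \<rho> * a / \<kappa>) (cy * \<rho> * a) \<le> \<kappa> / (\<rho> * a)"
  shows "(1 / real T) * (\<Sum>i<T. expectation (\<lambda>w. obj.crit (zt_c i w)))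
    \<le> lead_const L \<sigma> \<sigma>h \<Delta>0 cb cy cx * (\<kappa> * t / (\<rho> * a))"
proof -
  define r where "r = t / (\<rho> * a)"
  define x y where "x = cx * \<rho> * a / \<kappa>" and "y = cy * \<rho> * a"
  define tl where "tl = tail_const K lam L Lh \<sigma> \<sigma>h (cb * a) (2 * y)"
  define S where "S = (2 * \<sigma>h\<^sup>2 * (2 * (2 / L + 3) * cy)\<^sup>2 + 2 * cb\<^sup>2 * \<sigma>\<^sup>2) / cb"
  have T: "real T > 0" using t by (cases "T = 0") auto
  then have T1: "1 / real T = t ^ 3" using t(3) by (simp add: field_simps)
  have \<kappa>_pos: "0 < \<kappa>" using \<kappa> by linarith
  have y: "0 < y" and r: "0 < r" using c \<rho> a t by (simp_all add: y_def r_def)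
  have x: "0 < x"
    unfolding x_def by (intro divide_pos_pos mult_pos_pos c \<rho> a \<kappa>_pos)
  have y_eq': "\<eta>y = y * t\<^sup>2" and x_eq': "\<eta>x = x * t\<^sup>2" by (simp_all add: y_eq x_eq y_def x_def)
  have t3: "t ^ 3 = t\<^sup>2 * t" "t ^ 3 \<le> t\<^sup>2" using t by (auto simp: power3_eq_cube power2_eq_square mult_left_le)
  have \<rho>1: "\<rho> \<le> 1" using \<rho> lam by (intro power2_le_imp_le[of \<rho> 1]) auto
  have "\<eta>x \<le> \<eta>y"
  proof -
    have "\<eta>y / (2 * \<kappa>) \<le> \<eta>y / 1" using \<kappa> \<eta> by (intro divide_left_mono) auto
    then show ?thesis using ratio by simp
  qed
  then have \<eta>_le: "\<eta> \<le> 2 * y * t\<^sup>2" using y_eq' unfolding \<eta>_def by linarith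
  have tail: "tail_err \<le> tl * t\<^sup>2"
    unfolding tl_def using t a c y \<eta>_le \<beta>_eq by (intro tail_err_le) auto
  have Dd_le: "Dd \<le> (2 * (2 / L + 3) * cy) * (a * t\<^sup>2 / \<rho>)"
  proof -
    have "Dd \<le> (2 / L + 3) * (2 * y * t\<^sup>2) / \<rho>\<^sup>2"
      unfolding Dd_def \<rho>(2) using \<eta>_le L lam by (intro divide_right_mono mult_left_mono) auto
    also have "\<dots> = (2 * (2 / L + 3) * cy) * (a * t\<^sup>2 / \<rho>)"
      using \<rho>(1) L by (simp add: y_def power2_eq_square field_simps)
    finally show ?thesis .
  qed
  have nv_le: "nv / \<beta> \<le> S * r\<^sup>2"
  proof -
    have "Dd\<^sup>2 \<le> (2 * (2 / L + 3) * cy)\<^sup>2 * (a * t\<^sup>2 / \<rho>)\<^sup>2"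
      using power_mono[OF Dd_le Dd_nonneg, where n=2] by (simp only: power_mult_distrib)
    moreover have "\<beta>\<^sup>2 \<le> cb\<^sup>2 * (a * t\<^sup>2 / \<rho>)\<^sup>2"
    proof -
      have "a * t\<^sup>2 * \<rho> \<le> a * t\<^sup>2" using a t \<rho> \<rho>1 by (intro mult_left_le) auto
      then have "a * t\<^sup>2 \<le> a * t\<^sup>2 / \<rho>" using \<rho> by (simp add: pos_le_divide_eq)
      then have "(a * t\<^sup>2)\<^sup>2 \<le> (a * t\<^sup>2 / \<rho>)\<^sup>2" using a t by (intro power_mono) auto
      then show ?thesis unfolding \<beta>_eq mult.assoc power_mult_distrib[of cb]
        by (intro mult_left_mono) auto
    qed
    ultimately have "2 * \<sigma>h\<^sup>2 * Dd\<^sup>2 + 2 * \<beta>\<^sup>2 * \<sigma>\<^sup>2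
        \<le> 2 * \<sigma>h\<^sup>2 * ((2 * (2 / L + 3) * cy)\<^sup>2 * (a * t\<^sup>2 / \<rho>)\<^sup>2) + 2 * (cb\<^sup>2 * (a * t\<^sup>2 / \<rho>)\<^sup>2) * \<sigma>\<^sup>2"
      by (intro add_mono mult_left_mono mult_right_mono) auto
    also have "\<dots> = S * cb * (a * t\<^sup>2 / \<rho>)\<^sup>2"
    proof -
      have "S * cb = 2 * \<sigma>h\<^sup>2 * (2 * (2 / L + 3) * cy)\<^sup>2 + 2 * cb\<^sup>2 * \<sigma>\<^sup>2"
        using c by (simp add: S_def)
      then show ?thesis by (simp only: distrib_left distrib_right mult_ac)
    qed
    finally have "nv / \<beta> \<le> S * cb * (a * t\<^sup>2 / \<rho>)\<^sup>2 / a ^ 3 / \<beta>"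
      unfolding nv_def a(2)[symmetric] using a \<beta> by (intro divide_right_mono) auto
    also have "\<dots> = S * r\<^sup>2"
      unfolding \<beta>_eq r_def using c a(1) t(1) \<rho>(1) by (simp add: field_simps power2_eq_square power3_eq_cube)
    finally show ?thesis .
  qed
  have S: "0 \<le> S" using c by (simp add: S_def)
  have sq: "sqrt (nv / \<beta>) \<le> sqrt S * r"
    using real_sqrt_le_mono[OF nv_le] r by (simp add: real_sqrt_mult)
  have u0: "0 \<le> u0"
    unfolding u0_def using sg by (intro mult_nonneg_nonneg sum_nonneg add_nonneg_nonneg) auto
  have "t ^ 3 * U T \<le> t ^ 3 * (expectation (ud 0) / (1 - lam) + 2 * \<sigma> / (\<beta> * sqrt (real K))
    + real T * (sqrt (nv / \<beta>) + tail_err))"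
    unfolding U_def using sum_expectation_ue[OF integrable_ud0] t by (intro mult_left_mono) auto
  also have "\<dots> = t ^ 3 * (expectation (ud 0) / (1 - lam)) + t ^ 3 * (2 * \<sigma> / (\<beta> * sqrt (real K)))
    + (real T * t ^ 3) * (sqrt (nv / \<beta>) + tail_err)"
    by (simp add: algebra_simps)
  also have "\<dots> \<le> t\<^sup>2 * (u0 / (1 - lam)) + 2 * \<sigma> / cb * r + (sqrt S * r + tl * t\<^sup>2)"
  proof (intro add_mono)
    have "t ^ 3 * (expectation (ud 0) / (1 - lam)) \<le> t ^ 3 * (u0 / (1 - lam))"
      using expectation_ud0 lam t by (intro mult_left_mono divide_right_mono) auto
    also have "\<dots> \<le> t\<^sup>2 * (u0 / (1 - lam))"
      using t3 u0 lam by (intro mult_right_mono) auto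
    finally show "t ^ 3 * (expectation (ud 0) / (1 - lam)) \<le> t\<^sup>2 * (u0 / (1 - lam))" .
    have "2 * \<sigma> / (\<beta> * sqrt (real K)) \<le> 2 * \<sigma> / (\<beta> * \<rho>)"
    proof (rule divide_left_mono)
      have "1 \<le> sqrt (real K)" using K by simp
      then have "\<rho> \<le> sqrt (real K)" using \<rho>1 by (rule order_trans[rotated])
      then show "\<beta> * \<rho> \<le> \<beta> * sqrt (real K)" using \<beta> by (intro mult_left_mono) auto
    qed (use \<beta> \<rho> K sg in auto)
    then have "t ^ 3 * (2 * \<sigma> / (\<beta> * sqrt (real K))) \<le> t ^ 3 * (2 * \<sigma> / (\<beta> * \<rho>))"
      using t by (intro mult_left_mono) auto
    also have "\<dots> = 2 * \<sigma> / cb * r"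
      unfolding \<beta>_eq r_def using c a(1) t(1) \<rho>(1) by (simp add: field_simps power2_eq_square power3_eq_cube)
    finally show "t ^ 3 * (2 * \<sigma> / (\<beta> * sqrt (real K))) \<le> 2 * \<sigma> / cb * r" .
    show "(real T * t ^ 3) * (sqrt (nv / \<beta>) + tail_err) \<le> sqrt S * r + tl * t\<^sup>2"
      using sq tail t(3) by simp
  qed
  finally have U: "t ^ 3 * U T \<le> (2 * \<sigma> / cb + sqrt S) * r + (u0 / (1 - lam) + tl) * t\<^sup>2"
    by (simp add: algebra_simps)
  have D1: "t ^ 3 * (\<Delta>0 / \<eta>x) = \<Delta>0 / cx * (\<kappa> * r)"
    unfolding x_eq r_def using c a(1) t(1) \<rho>(1) \<kappa>_pos L obj.nu_pos by (simp add: field_simps power2_eq_square power3_eq_cube)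
  have D2: "16 * \<kappa> / \<eta>y * (t ^ 3 * \<Delta>0) = 16 * \<Delta>0 / cy * (\<kappa> * r)"
    unfolding y_eq r_def using c a(1) t(1) \<rho>(1) \<kappa>_pos L obj.nu_pos by (simp add: field_simps power2_eq_square power3_eq_cube)
  have E1: "16 * \<kappa> / \<eta>y * (obj.LP * \<eta>x\<^sup>2 + L * \<eta>\<^sup>2) \<le> 16 * \<kappa> * (obj.LP * x\<^sup>2 + L * (2 * y)\<^sup>2) / y * t\<^sup>2"
  proof -
    have "\<eta>\<^sup>2 \<le> (2 * y * t\<^sup>2)\<^sup>2" using \<eta>_le \<eta>_nonneg by (intro power_mono)
    moreover have "\<eta>x\<^sup>2 = (x * t\<^sup>2)\<^sup>2" by (simp add: x_eq')
    moreover have "0 \<le> 16 * \<kappa> / \<eta>y" 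
      by (rule divide_nonneg_pos[OF mult_nonneg_nonneg[OF _ less_imp_le[OF \<kappa>_pos]] \<eta>_pos(2)]) simp
    ultimately have "16 * \<kappa> / \<eta>y * (obj.LP * \<eta>x\<^sup>2 + L * \<eta>\<^sup>2) \<le> 16 * \<kappa> / \<eta>y * (obj.LP * (x * t\<^sup>2)\<^sup>2 + L * (2 * y * t\<^sup>2)\<^sup>2)"
      using L obj.LP_pos by (intro mult_left_mono add_mono) auto
    also have "\<dots> = 16 * \<kappa> * (obj.LP * x\<^sup>2 + L * (2 * y)\<^sup>2) / y * t\<^sup>2"
      unfolding y_eq' using y t by (simp add: power2_eq_square divide_simps) (simp add: algebra_simps)
    finally show ?thesis .
  qed
  have LP: "obj.LP = L + L\<^sup>2 / (2 * \<nu>)" by (rule obj.LP_def)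
  define \<Sigma> where "\<Sigma> = (\<Sum>i<T. expectation (\<lambda>w. obj.crit (zt_c i w)))"
  have "t ^ 3 * \<Sigma> \<le> t ^ 3 * (\<Delta>0 / \<eta>x + 16 * \<kappa> / \<eta>y * (\<Delta>0 + 2 * \<eta>y * U T
      + real T * (obj.LP * \<eta>x\<^sup>2 + L * \<eta>\<^sup>2)) + 2 * U T + real T * (obj.LP * \<eta>x))"
    unfolding \<Sigma>_def using sum_crit t by (intro mult_left_mono) auto
  also have "\<dots> = t ^ 3 * (\<Delta>0 / \<eta>x) + 16 * \<kappa> / \<eta>y * (t ^ 3 * \<Delta>0) + (32 * \<kappa> + 2) * (t ^ 3 * U T)
      + (real T * t ^ 3) * (16 * \<kappa> / \<eta>y * (obj.LP * \<eta>x\<^sup>2 + L * \<eta>\<^sup>2)) + (real T * t ^ 3) * (obj.LP * \<eta>x)"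
  proof -
    have "16 * \<kappa> / \<eta>y * (2 * \<eta>y * U T) = 32 * \<kappa> * U T" using \<eta>_pos by simp
    then show ?thesis by (simp only: distrib_left distrib_right mult_ac)
  qed
  also have "\<dots> \<le> \<Delta>0 / cx * (\<kappa> * r) + 16 * \<Delta>0 / cy * (\<kappa> * r)
      + 34 * \<kappa> * ((2 * \<sigma> / cb + sqrt S) * r + (u0 / (1 - lam) + tl) * t\<^sup>2)
      + 16 * \<kappa> * (obj.LP * x\<^sup>2 + L * (2 * y)\<^sup>2) / y * t\<^sup>2 + obj.LP * x * t\<^sup>2"
  proof -
    have "obj.LP * \<eta>x = obj.LP * x * t\<^sup>2" by (simp add: x_eq')
    moreover have "(32 * \<kappa> + 2) * (t ^ 3 * U T) \<le> 34 * \<kappa> * ((2 * \<sigma> / cb + sqrt S) * r + (u0 / (1 - lam) + tl) * t\<^sup>2)"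
    proof (rule mult_mono[OF _ U])
      show "32 * \<kappa> + 2 \<le> 34 * \<kappa>" "0 \<le> 34 * \<kappa>" using \<kappa> by linarith+
      show "0 \<le> t ^ 3 * U T" using U_nonneg[of T] t by simp
    qed
    ultimately show ?thesis
      unfolding D1 D2 t(3) mult_1 using E1 by linarith
  qed
  also have "\<dots> = (\<Delta>0 / cx + 16 * \<Delta>0 / cy + 34 * (2 * \<sigma> / cb + sqrt S)) * (\<kappa> * r)
      + t * (t * low_const K lam L Lh \<sigma> \<sigma>h \<nu> u0 (cb * a) x y)"
    unfolding low_const_def LP[symmetric] tl_def[symmetric]
    by (simp add: algebra_simps power2_eq_square)
  also have "\<dots> \<le> (\<bar>\<Delta>0\<bar> / cx + 16 * \<bar>\<Delta>0\<bar> / cy + 34 * (2 * \<sigma> / cb + sqrt S)) * (\<kappa> * r)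
      + t * (\<kappa> / (\<rho> * a))"
  proof (rule add_mono)
    show "t * (t * low_const K lam L Lh \<sigma> \<sigma>h \<nu> u0 (cb * a) x y) \<le> t * (\<kappa> / (\<rho> * a))"
      using low[folded x_def y_def] t by (intro mult_left_mono) auto
    have "0 \<le> \<kappa> * r" using \<kappa>_pos r by (intro mult_nonneg_nonneg) linarith+
    then show "(\<Delta>0 / cx + 16 * \<Delta>0 / cy + 34 * (2 * \<sigma> / cb + sqrt S)) * (\<kappa> * r)
        \<le> (\<bar>\<Delta>0\<bar> / cx + 16 * \<bar>\<Delta>0\<bar> / cy + 34 * (2 * \<sigma> / cb + sqrt S)) * (\<kappa> * r)"
      using c by (intro mult_right_mono add_mono divide_right_mono mult_left_mono order_refl) auto
  qed
  also have "t * (\<kappa> / (\<rho> * a)) = \<kappa> * r" by (simp add: r_def)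
  finally show ?thesis
    unfolding T1 \<Sigma>_def[symmetric] lead_const_def S_def[symmetric]
    by (simp add: r_def algebra_simps)
qed

end

lemma average_criterion_bound:
  fixes Q :: "nat \<Rightarrow> 'x::euclidean_space \<times> 'y::euclidean_space \<Rightarrow> 's \<Rightarrow> real"
    and Lf Lh \<sigma> \<sigma>h \<Delta>0 c\<^sub>\<beta> c\<^sub>y c\<^sub>x \<nu> :: real and K N T :: nat
  assumes pos: "0 < Lf" "0 \<le> Lh" "0 \<le> \<sigma>" "0 \<le> \<sigma>h" "0 < c\<^sub>\<beta>" "0 < c\<^sub>y" "0 < c\<^sub>x"
    and KN: "1 \<le> K" "1 \<le> N" and T: "1 \<le> T"
    and smooth: "smooth_objectives K D Q Lf Lh" and stoch: "stochastic_oracles K D Q \<sigma> \<sigma>h"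
    and pl: "pl_condition (global_obj K D Q) \<nu>" and \<kappa>: "Lf / \<nu> > 1"
    and net: "mixing_network K nb A" and samp: "dima_sampling K N D M z0 \<xi>"
    and gap: "initial_gap K D Q M z0 \<Delta>0"
  defines "a \<equiv> real (N * K) powr (1/3)" and "\<rho> \<equiv> (1 - mixing_rate K A) powr (1/2)"
    and "u \<equiv> 2 * (\<Sum>k<K. 2 * \<sigma> + (\<integral>\<omega>. norm (grad (local_obj D Q k) (z0 \<omega>)) \<partial>M))"
  assumes low: "real T powr (-1/3) * low_const K (mixing_rate K A) Lf Lh \<sigma> \<sigma>h \<nu> u (c\<^sub>\<beta> * a)
      (c\<^sub>x * \<rho> * a / (Lf / \<nu>)) (c\<^sub>y * \<rho> * a) \<le> (Lf / \<nu>) / (\<rho> * a)"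
  shows "let J = global_obj K D Q; P = primal J;
          \<kappa> = Lf / \<nu>; lam = mixing_rate K A;
          \<beta> = c\<^sub>\<beta> * (real (N * K) powr (1/3) / real T powr (2/3));
          \<eta>y = c\<^sub>y * ((1 - lam) powr (1/2) * real (N * K) powr (1/3) / real T powr (2/3));
          \<eta>x = c\<^sub>x * ((1 - lam) powr (1/2) * real (N * K) powr (1/3) / (\<kappa> * real T powr (2/3)));
          \<eta>lx = \<eta>x / (real N * Lf);
          \<eta>ly = \<eta>y / (real N * Lf);
          p = \<lparr>steps = N, eta_x = \<eta>x, eta_y = \<eta>y, loc_eta_x = \<eta>lx, loc_eta_y = \<eta>ly,
               mom_beta = \<beta>, corr_gamma = 1\<rparr>;
          zc = (\<lambda>i \<omega>. centroid K (dima_run K nb A p Q (z0 \<omega>) (\<lambda>j. \<xi> j \<omega>) i));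
          crit = (\<lambda>z. norm (grad P (fst z)) + 2 * Lf * infdist (snd z) (maximizers J (fst z)))
      in \<eta>x \<le> \<eta>y / (2 * \<kappa>) \<and> \<eta>lx \<le> \<eta>ly \<and> \<beta> < 1 \<and>
         (AE \<omega> in M. normalizable K nb A p Q (z0 \<omega>) (\<lambda>j. \<xi> j \<omega>) T)
         \<longrightarrow> (\<forall>i<T. integrable M (\<lambda>\<omega>. crit (zc i \<omega>))) \<and>
             (1 / real T) * (\<Sum>i<T. \<integral>\<omega>. crit (zc i \<omega>) \<partial>M)
               \<le> lead_const Lf \<sigma> \<sigma>h \<Delta>0 c\<^sub>\<beta> c\<^sub>y c\<^sub>x *
                  (\<kappa> / ((1 - lam) powr (1/2) * real (N * K * T) powr (1/3))
                      + \<kappa> * real (N * K) powr (1/3) / ((1 - lam) powr (3/2) * real T powr (2/3)))"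
proof -
  define \<beta> where "\<beta> = c\<^sub>\<beta> * (real (N * K) powr (1/3) / real T powr (2/3))"
  define \<eta>y where "\<eta>y = c\<^sub>y * ((1 - mixing_rate K A) powr (1/2) * real (N * K) powr (1/3) / real T powr (2/3))"
  define \<eta>x where "\<eta>x = c\<^sub>x * ((1 - mixing_rate K A) powr (1/2) * real (N * K) powr (1/3) / (Lf / \<nu> * real T powr (2/3)))"
  define t where "t = real T powr (-1/3)"
  have \<nu>: "0 < \<nu>" using pl by (simp add: pl_condition_def)
  have lam: "mixing_rate K A < 1" using net by (simp add: mixing_network_def)
  have NK: "0 < real (N * K)" and Tpos: "0 < real T" using KN T by auto
  have cube: "(b powr (1/3)) ^ 3 = b" if "0 < b" for b :: real
    using that by (simp add: powr_power)
  have a: "0 < a" "a ^ 3 = real (N * K)"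
    unfolding a_def using NK cube[OF NK] by (simp_all only: powr_gt_zero)
  have \<rho>: "0 < \<rho>" "\<rho>\<^sup>2 = 1 - mixing_rate K A"
    using lam by (simp_all add: \<rho>_def powr_power)
  have t0: "0 < t" using Tpos by (simp add: t_def)
  have t1: "t \<le> 1"
    unfolding t_def using T powr_mono[of "-1/3" 0 "real T"] by simp
  have t_inv: "t = 1 / real T powr (1/3)"
    using powr_minus_divide[of "real T" "1/3"] by (simp add: t_def)
  have t3: "real T * t ^ 3 = 1"
    unfolding t_inv power_divide cube[OF Tpos] using Tpos by simp
  have "(real T powr (1/3))\<^sup>2 = real T powr (2/3)" using Tpos by (simp add: powr_power)
  then have t2: "t\<^sup>2 = 1 / real T powr (2/3)"
    unfolding t_inv power_divide by simp
  have ti: "real T powr (1/3) = 1 / t" by (simp add: t_inv)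
  have \<beta>_eq: "\<beta> = c\<^sub>\<beta> * a * t\<^sup>2" by (simp add: \<beta>_def a_def t2)
  have y_eq: "\<eta>y = c\<^sub>y * \<rho> * a * t\<^sup>2" by (simp add: \<eta>y_def a_def \<rho>_def t2)
  have x_eq: "\<eta>x = c\<^sub>x * \<rho> * a / (Lf / \<nu>) * t\<^sup>2" by (simp add: \<eta>x_def a_def \<rho>_def t2)
  define p where "p = \<lparr>steps = N, eta_x = \<eta>x, eta_y = \<eta>y, loc_eta_x = \<eta>x / (real N * Lf),
    loc_eta_y = \<eta>y / (real N * Lf), mom_beta = \<beta>, corr_gamma = 1\<rparr>"
  define zc where "zc = (\<lambda>i \<omega>. centroid K (dima_run K nb A p Q (z0 \<omega>) (\<lambda>j. \<xi> j \<omega>) i))"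
  define J where "J = global_obj K D Q"
  define crit where "crit = (\<lambda>z. norm (grad (primal J) (fst z)) + 2 * Lf * infdist (snd z) (maximizers J (fst z)))"
  let ?C = "lead_const Lf \<sigma> \<sigma>h \<Delta>0 c\<^sub>\<beta> c\<^sub>y c\<^sub>x"
  let ?B = "Lf / \<nu> / ((1 - mixing_rate K A) powr (1/2) * real (N * K * T) powr (1/3))"
  let ?B' = "Lf / \<nu> * real (N * K) powr (1/3) / ((1 - mixing_rate K A) powr (3/2) * real T powr (2/3))"
  have "(\<forall>i<T. integrable M (\<lambda>\<omega>. crit (zc i \<omega>))) \<and>
      (1 / real T) * (\<Sum>i<T. \<integral>\<omega>. crit (zc i \<omega>) \<partial>M) \<le> ?C * (?B + ?B')"
    if ratio: "\<eta>x \<le> \<eta>y / (2 * (Lf / \<nu>))" and \<beta>1: "\<beta> < 1"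
  proof -
    have pos': "0 < \<beta>" "0 < \<eta>y" "0 < \<eta>x"
      using pos a \<rho> t0 \<nu> by (simp_all add: \<beta>_eq y_eq x_eq)
    interpret X: dima_minimax K N nb A D Q Lf Lh \<sigma> \<sigma>h \<beta> \<eta>x \<eta>y M z0 \<xi> \<nu> \<Delta>0
    proof unfold_locales
      show "z0 \<in> borel_measurable M"
        and "\<And>j. j \<in> sample_idxs K N \<Longrightarrow> \<xi> j \<in> measurable M (D (agent_of j))"
        using samp by (auto simp: dima_sampling_def)
    qed (use pos pos' KN smooth stoch net samp pl gap ratio \<beta>1 in auto)
    have crit: "crit (zc i \<omega>) = X.obj.crit (X.zt_c i \<omega>)" for i \<omega>
    proof -
      have "zc i \<omega> = X.zt_c i \<omega>"
        by (simp add: zc_def X.zt_c_def X.zc_def X.Z_def[abs_def] X.run_def X.p_def p_def mean_def centroid_def)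
      then show ?thesis unfolding crit_def X.obj.crit_def unfolding J_def X.J_def by simp
    qed
    have "(1 / real T) * (\<Sum>i<T. \<integral>\<omega>. crit (zc i \<omega>) \<partial>M) \<le> ?C * (Lf / \<nu> * t / (\<rho> * a))"
      unfolding crit
    proof (rule X.average_bound[OF t0 t1 t3 a \<rho>(1) _ pos(5,6,7) \<beta>_eq y_eq x_eq \<kappa>])
      show "\<rho>\<^sup>2 = 1 - X.lam" by (simp add: \<rho> X.lam_def)
      show "t * low_const K X.lam Lf Lh \<sigma> \<sigma>h \<nu> X.u0 (c\<^sub>\<beta> * a) (c\<^sub>x * \<rho> * a / (Lf / \<nu>)) (c\<^sub>y * \<rho> * a)
          \<le> Lf / \<nu> / (\<rho> * a)"
        using low by (simp add: t_def X.lam_def X.u0_def u_def)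
    qed
    also have "Lf / \<nu> * t / (\<rho> * a) = ?B"
    proof -
      have "real (N * K * T) powr (1/3) = a * real T powr (1/3)"
        unfolding of_nat_mult[of "N * K" T] a_def by (rule powr_mult)
      then show ?thesis using t0 by (simp add: ti \<rho>_def)
    qed
    also have "?C * ?B \<le> ?C * (?B + ?B')"
      using lead_const_pos[OF pos(3,5,6,7), of Lf \<sigma>h \<Delta>0] pos \<nu> by (intro mult_left_mono) auto
    finally show ?thesis using X.integrable_crit by (simp add: crit)
  qed
  then show ?thesis
    unfolding Let_def \<beta>_def[symmetric] \<eta>x_def[symmetric] \<eta>y_def[symmetric] p_def[symmetric]
      J_def[symmetric]
    unfolding zc_def crit_def by blast
qed

theorem theorem1:
  fixes Lf Lh \<sigma> \<sigma>h \<Delta>0 c\<^sub>\<beta> c\<^sub>y c\<^sub>x :: real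
  assumes "0 < Lf" "0 \<le> Lh" "0 \<le> \<sigma>" "0 \<le> \<sigma>h" "0 < c\<^sub>\<beta>" "0 < c\<^sub>y" "0 < c\<^sub>x"
  shows "\<exists>C>0. \<forall>(K::nat) (N::nat) (nb::nat \<Rightarrow> nat set) (A::nat \<Rightarrow> nat \<Rightarrow> real) (\<nu>::real)
      (D::nat \<Rightarrow> 's measure) (Q::nat \<Rightarrow> (real^'m) \<times> (real^'n) \<Rightarrow> 's \<Rightarrow> real)
      (M::'w measure) (z0::'w \<Rightarrow> (real^'m) \<times> (real^'n)) (\<xi>::sample_idx \<Rightarrow> 'w \<Rightarrow> 's).
    1 \<le> K \<and> 1 \<le> N \<and>
    smooth_objectives K D Q Lf Lh \<and>
    stochastic_oracles K D Q \<sigma> \<sigma>h \<and>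
    pl_condition (global_obj K D Q) \<nu> \<and> Lf / \<nu> > 1 \<and>
    mixing_network K nb A \<and>
    dima_sampling K N D M z0 \<xi> \<and>
    initial_gap K D Q M z0 \<Delta>0
    \<longrightarrow> (\<exists>T0. \<forall>T\<ge>T0.
      let J = global_obj K D Q; P = primal J;
          \<kappa> = Lf / \<nu>; lam = mixing_rate K A;
          \<beta> = c\<^sub>\<beta> * (real (N * K) powr (1/3) / real T powr (2/3));
          \<eta>y = c\<^sub>y * ((1 - lam) powr (1/2) * real (N * K) powr (1/3) / real T powr (2/3));
          \<eta>x = c\<^sub>x * ((1 - lam) powr (1/2) * real (N * K) powr (1/3) / (\<kappa> * real T powr (2/3)));
          \<eta>lx = \<eta>x / (real N * Lf);
          \<eta>ly = \<eta>y / (real N * Lf);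
          p = \<lparr>steps = N, eta_x = \<eta>x, eta_y = \<eta>y, loc_eta_x = \<eta>lx, loc_eta_y = \<eta>ly,
               mom_beta = \<beta>, corr_gamma = 1\<rparr>;
          zc = (\<lambda>i \<omega>. centroid K (dima_run K nb A p Q (z0 \<omega>) (\<lambda>j. \<xi> j \<omega>) i));
          crit = (\<lambda>z. norm (grad P (fst z)) + 2 * Lf * infdist (snd z) (maximizers J (fst z)))
      in \<eta>x \<le> \<eta>y / (2 * \<kappa>) \<and> \<eta>lx \<le> \<eta>ly \<and> \<beta> < 1 \<and>
         (AE \<omega> in M. normalizable K nb A p Q (z0 \<omega>) (\<lambda>j. \<xi> j \<omega>) T)
         \<longrightarrow> (\<forall>i<T. integrable M (\<lambda>\<omega>. crit (zc i \<omega>))) \<and>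
             (1 / real T) * (\<Sum>i<T. \<integral>\<omega>. crit (zc i \<omega>) \<partial>M)
               \<le> C * (\<kappa> / ((1 - lam) powr (1/2) * real (N * K * T) powr (1/3))
                      + \<kappa> * real (N * K) powr (1/3) / ((1 - lam) powr (3/2) * real T powr (2/3))))"
proof (intro exI[of _ "lead_const Lf \<sigma> \<sigma>h \<Delta>0 c\<^sub>\<beta> c\<^sub>y c\<^sub>x"] conjI allI impI, goal_cases)
  case 1
  show ?case using assms by (intro lead_const_pos)
next
  case (2 K N nb A \<nu> D Q M z0 \<xi>)
  define a where "a = real (N * K) powr (1/3)"
  define \<rho> where "\<rho> = (1 - mixing_rate K A) powr (1/2)"
  define u where "u = 2 * (\<Sum>k<K. 2 * \<sigma> + (\<integral>\<omega>. norm (grad (local_obj D Q k) (z0 \<omega>)) \<partial>M))"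
  define G where "G = low_const K (mixing_rate K A) Lf Lh \<sigma> \<sigma>h \<nu> u (c\<^sub>\<beta> * a)
      (c\<^sub>x * \<rho> * a / (Lf / \<nu>)) (c\<^sub>y * \<rho> * a)"
  have a\<rho>: "0 < a" "0 < \<rho>" using 2 by (auto simp: a_def \<rho>_def mixing_network_def)
  have "0 < Lf / \<nu>" using 2 by linarith
  then have X: "0 < (Lf / \<nu>) / (\<rho> * a)" by (rule divide_pos_pos[OF _ mult_pos_pos[OF a\<rho>(2,1)]])
  have "(\<lambda>T. real T powr (-1/3)) \<longlonglongrightarrow> 0"
    by (rule tendsto_neg_powr[OF _ filterlim_real_sequentially]) simp
  then have "(\<lambda>T. real T powr (-1/3) * G) \<longlonglongrightarrow> 0 * G" by (intro tendsto_intros)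
  then have "eventually (\<lambda>T. real T powr (-1/3) * G < (Lf / \<nu>) / (\<rho> * a)) sequentially"
    using X by (intro order_tendstoD) auto
  then obtain T1 where T1: "real T powr (-1/3) * G < (Lf / \<nu>) / (\<rho> * a)" if "T1 \<le> T" for T
    unfolding eventually_sequentially by blast
  show ?case
  proof (intro exI[of _ "max 1 T1"] allI impI, goal_cases)
    case (1 T)
    have *: "real T powr (-1/3) * G \<le> (Lf / \<nu>) / (\<rho> * a)" using T1[of T] 1 by simp
    from 1 2 show ?case
      by (intro average_criterion_bound[OF assms _ _ _ _ _ _ _ _ _ _ *[unfolded G_def u_def \<rho>_def a_def]]) auto
  qed
qed

end
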